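(* Let $\theta$ be an inner function in the open unit disk and let $1 \le p < \infty$. A function $g \in \bar\theta H^p$ is $H^p$-badly approximable if and only if $\theta g \in E_{\theta, p}$.
   Context: $\mathbb{T}$ is the unit circle with normalized Lebesgue measure, $L^p = L^p(\mathbb{T})$, and $H^p$ is the Hardy space in the open unit disk, identified with a closed subspace of $L^p$ via angular boundary values. A bounded analytic function $\theta$ in the open unit disk is inner if $|\theta| = 1$ a.e. on $\mathbb{T}$ in the sense of angular boundary values. $\bar\theta H^p = \{\bar\theta h : h \in H^p\} \subset L^p$. The coinvariant subspace is $K^2_\theta = H^2 \cap \bar z\theta\,\overline{H^2}$, where $\overline{H^2} = \{\bar f : f \in H^2\}$. The class $E_{\theta,p}$ is defined by $$E_{\theta,p} = \{ c I F^{2/p} : c \in \mathbb{C},\ I \text{ is inner},\ F \text{ is outer},\ IF \in K^2_\theta \},$$ where $F^{2/p}$ is an analytic branch in the disk (the choice of branch is immaterial because of the constant $c$). A function $g \in L^p$ is called $H^p$-badly approximable if the zero function is the best analytic approximation of $g$ in $L^p$, i.e. $\|g\|_{L^p} = \operatorname{dist}_{L^p}(g, H^p) = \inf_{h \in H^p}\|g - h\|_{L^p}$.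
   Formalization: The zero function is always counted in E_{θ,p}; for constant inner θ the literal class is empty (K²_θ = {0}) although g = 0 is badly approximable, while for nonconstant θ zero already belongs to the class with c = 0. *)

theory Defs
  imports "HOL-Analysis.Analysis"
begin

text \<open>
  Elements of \<open>L\<^sup>p\<close> of the circle are represented by functions, and all notions below are invariant
  under changes on null sets. Analytic functions in the disk are represented by total functions
  of which only the values in \<^term>\<open>ball 0 1 :: complex set\<close> matter.
\<close>

text \<open>
  The completion makes the measurable functions the Lebesgue (not just the Borel) measurable ones.
\<close>

definition circle_measure :: "complex measure" where
  "circle_measure =
     completion (distr (uniform_measure lborel {0..<2 * pi})
       (restrict_space borel (sphere 0 1)) cis)"

definition Lp_circle :: "real \<Rightarrow> (complex \<Rightarrow> complex) set" where
  "Lp_circle p = {f \<in> borel_measurable circle_measure.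
     integrable circle_measure (\<lambda>\<zeta>. cmod (f \<zeta>) powr p)}"

definition Lp_norm :: "real \<Rightarrow> (complex \<Rightarrow> complex) \<Rightarrow> real" where
  "Lp_norm p f = (\<integral>\<zeta>. cmod (f \<zeta>) powr p \<partial>circle_measure) powr (1 / p)"

text \<open>
  The Stolz region is empty for \<open>a \<le> 1\<close>; for \<open>a > 1\<close> it contains the radius ending in \<open>\<zeta>\<close>, so
  angular limits are unique.
\<close>

definition stolz_region :: "complex \<Rightarrow> real \<Rightarrow> complex set" where
  "stolz_region \<zeta> a = {z \<in> ball 0 1. cmod (z - \<zeta>) < a * (1 - cmod z)}"

definition has_angular_limit :: "(complex \<Rightarrow> complex) \<Rightarrow> complex \<Rightarrow> complex \<Rightarrow> bool" where
  "has_angular_limit f \<zeta> w \<longleftrightarrow> (\<forall>a>1. (f \<longlongrightarrow> w) (at \<zeta> within stolz_region \<zeta> a))"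

definition boundary_value :: "(complex \<Rightarrow> complex) \<Rightarrow> complex \<Rightarrow> complex" where
  "boundary_value f \<zeta> = (THE w. has_angular_limit f \<zeta> w)"

text \<open>
  The functions on the circle with which a set \<open>S\<close> of analytic functions in the disk is identified
  via angular boundary values.
\<close>

definition boundary_functions :: "(complex \<Rightarrow> complex) set \<Rightarrow> (complex \<Rightarrow> complex) set" where
  "boundary_functions S = {\<phi> \<in> borel_measurable circle_measure.
     \<exists>f\<in>S. AE \<zeta> in circle_measure. has_angular_limit f \<zeta> (\<phi> \<zeta>)}"

definition Hardy :: "real \<Rightarrow> (complex \<Rightarrow> complex) set" where
  "Hardy p = {f. f holomorphic_on ball 0 1 \<and>
     bdd_above ((\<lambda>r. \<integral>\<zeta>. cmod (f (of_real r * \<zeta>)) powr p \<partial>circle_measure) ` {0..<1})}"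

definition inner_function :: "(complex \<Rightarrow> complex) \<Rightarrow> bool" where
  "inner_function \<theta> \<longleftrightarrow> \<theta> holomorphic_on ball 0 1 \<and> bounded (\<theta> ` ball 0 1) \<and>
     (AE \<zeta> in circle_measure. \<exists>w. has_angular_limit \<theta> \<zeta> w \<and> cmod w = 1)"

text \<open>The function \<open>k\<close> is \<open>log \<bar>F\<bar>\<close> on the circle.\<close>

definition outer_function :: "(complex \<Rightarrow> complex) \<Rightarrow> bool" where
  "outer_function F \<longleftrightarrow>
     (\<exists>\<alpha> (k :: complex \<Rightarrow> real). cmod \<alpha> = 1 \<and> integrable circle_measure k \<and>
       (\<forall>z\<in>ball 0 1. F z =
          \<alpha> * exp (\<integral>\<zeta>. (\<zeta> + z) / (\<zeta> - z) * of_real (k \<zeta>) \<partial>circle_measure)))"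

definition analytic_power :: "(complex \<Rightarrow> complex) \<Rightarrow> real \<Rightarrow> (complex \<Rightarrow> complex) \<Rightarrow> bool" where
  "analytic_power F s G \<longleftrightarrow>
     (\<exists>L. L holomorphic_on ball 0 1 \<and>
       (\<forall>z\<in>ball 0 1. F z = exp (L z) \<and> G z = exp (of_real s * L z)))"

text \<open>\<open>K\<^sup>2\<^sub>\<theta>\<close>, as a set of functions in the disk.\<close>

definition coinvariant :: "(complex \<Rightarrow> complex) \<Rightarrow> (complex \<Rightarrow> complex) set" where
  "coinvariant \<theta> = {f \<in> Hardy 2. \<exists>h\<in>Hardy 2. AE \<zeta> in circle_measure.
     boundary_value f \<zeta> = cnj \<zeta> * boundary_value \<theta> \<zeta> * cnj (boundary_value h \<zeta>)}"

text \<open>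
  \<open>E\<^sub>\<theta>\<^sub>,\<^sub>p\<close>, as a set of functions in the disk. The zero function arises from \<open>c = 0\<close> whenever
  \<open>\<theta>\<close> is nonconstant. It is listed separately because for constant \<open>\<theta>\<close> the space \<open>K\<^sup>2\<^sub>\<theta>\<close> is
  trivial, so that no product \<open>I F\<close> lies in it (outer functions are not zero); the convention
  is that the class then consists of the zero function.
\<close>

definition E_class :: "(complex \<Rightarrow> complex) \<Rightarrow> real \<Rightarrow> (complex \<Rightarrow> complex) set" where
  "E_class \<theta> p = {u. (\<forall>z\<in>ball 0 1. u z = 0) \<or>
     (\<exists>c I F G. inner_function I \<and> outer_function F \<and> (\<lambda>z. I z * F z) \<in> coinvariant \<theta> \<and>
        analytic_power F (2 / p) G \<and> (\<forall>z\<in>ball 0 1. u z = c * I z * G z))}"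

definition conj_inner_Hardy :: "(complex \<Rightarrow> complex) \<Rightarrow> real \<Rightarrow> (complex \<Rightarrow> complex) set" where
  "conj_inner_Hardy \<theta> p = {g \<in> Lp_circle p. \<exists>h\<in>boundary_functions (Hardy p).
     AE \<zeta> in circle_measure. g \<zeta> = cnj (boundary_value \<theta> \<zeta>) * h \<zeta>}"

definition badly_approximable :: "real \<Rightarrow> (complex \<Rightarrow> complex) \<Rightarrow> bool" where
  "badly_approximable p g \<longleftrightarrow> g \<in> Lp_circle p \<and>
     Lp_norm p g = (INF h\<in>boundary_functions (Hardy p). Lp_norm p (\<lambda>\<zeta>. g \<zeta> - h \<zeta>))"

end

theory Submission
  imports Defs "HOL-Complex_Analysis.Complex_Analysis"
begin

text \<open>
  Write \<open>g = cnj \<theta> h\<close> on the circle with \<open>h\<close> in \<open>H\<^sup>p\<close>; let \<open>h\<close> be nonzero. Since \<open>\<bar>w\<bar>\<^sup>p\<close> is convex, zero is a best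
  approximation of \<open>g\<close> from \<open>H\<^sup>p\<close> if and only if the dual function \<open>\<psi> = \<bar>g\<bar>\<^bsup>p-2\<^esup> cnj g\<close> annihilates
  \<open>H\<^sup>p\<close>. This includes \<open>p = 1\<close>, because \<open>h\<close> vanishes almost nowhere. By duality \<open>\<psi>\<close>
  annihilates \<open>H\<^sup>p\<close> exactly if \<open>cnj \<zeta> \<psi>\<close> is the boundary function of some \<open>k\<close> in \<open>H\<^sup>1\<close>. Now factor
  \<open>h = I u\<close> with \<open>I\<close> inner and \<open>u\<close> outer, and put \<open>F = u\<^bsup>p/2\<^esup>\<close>, so that \<open>\<bar>F\<bar>\<^sup>2 = \<bar>h\<bar>\<^sup>p\<close>. Then
  \<open>\<psi> = \<theta> \<bar>h\<bar>\<^bsup>p-2\<^esup> cnj h\<close> has modulus \<open>\<bar>u\<bar>\<^bsup>p-1\<^esup>\<close>, and \<open>k\<close> is an inner function \<open>B\<close> times \<open>u\<^bsup>p-1\<^esup>\<close>.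
  Multiplying \<open>B u\<^bsup>p-1\<^esup> = cnj \<zeta> \<theta> \<bar>h\<bar>\<^bsup>p-2\<^esup> cnj h\<close> by \<open>u\<close> and dividing by \<open>F\<close> turns it into
  \<open>B F = cnj \<zeta> \<theta> cnj (I F)\<close>, which says that \<open>I F\<close> belongs to \<open>K\<^sup>2\<^sub>\<theta>\<close>; as \<open>h = I F\<^bsup>2/p\<^esup>\<close>, this is the
  assertion. All steps can be reversed. The two directions are \<open>badly_approximable_imp_E_class\<close> and
  \<open>E_class_imp_badly_approximable\<close>.

  The argument rests on four facts about Hardy spaces, which are developed from the Poisson kernel.
  The Poisson integral of an integrable function has that function as its angular limit almost
  everywhere (\<open>poisson_integral_angular_limit\<close>, from a weak type estimate and the density of the
  continuous functions). Functions in \<open>H\<^sup>2\<close> are the Poisson integrals of their boundary functions,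
  and their dilates converge in \<open>L\<^sup>2\<close> (\<open>Hardy2_boundary\<close>); hence the product of two of them
  satisfies Cauchy's theorem on the circle (\<open>Hardy2_product_orthogonal\<close>). A nonzero function in \<open>H\<^sup>p\<close> with a
  boundary function \<open>\<phi>\<close> is an inner function times the outer function with boundary modulus \<open>\<bar>\<phi>\<bar>\<close>
  (\<open>Hardy_inner_outer\<close>), because the quotient by the outer function is bounded by one. Conversely, a
  bounded function times an outer function is in \<open>H\<^sup>p\<close> as soon as its boundary values are in \<open>L\<^sup>p\<close>
  (\<open>Hardy_bounded_times_outer\<close>, a form of Smirnov's theorem).
\<close>

section \<open>The normalized Lebesgue measure on the circle\<close>

text \<open>The measure before its completion. Changes of variables and regularity are statements about this
  Borel measure.\<close>

definition circle_borel :: "complex measure" where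
  "circle_borel = distr (uniform_measure lborel {0..<2 * pi})
       (restrict_space borel (sphere 0 1)) cis"

abbreviation circle_mu :: "complex measure" ("\<mu>") where
  "\<mu> \<equiv> circle_measure"

lemma circle_measure_eq: "\<mu> = completion circle_borel"
  by (simp add: circle_measure_def circle_borel_def)

lemma measurable_cis_circle:
  "cis \<in> uniform_measure lborel {0..<2 * pi} \<rightarrow>\<^sub>M restrict_space borel (sphere 0 1)"
  by (rule measurable_restrict_space2)
     (auto simp: measurable_cong_sets[OF sets_uniform_measure refl] cis_conv_exp
       intro!: borel_measurable_continuous_onI continuous_intros)

lemma space_circle_borel [simp]: "space circle_borel = sphere 0 1"
  by (simp add: circle_borel_def space_restrict_space)

lemma sets_circle_borel [measurable_cong]: "sets circle_borel = sets (restrict_space borel (sphere 0 1))"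
  by (simp add: circle_borel_def)

lemma space_circle_measure [simp]: "space \<mu> = sphere 0 1"
  by (simp add: circle_measure_eq)

lemma emeasure_circle_borel_space: "emeasure circle_borel (sphere 0 1) = 1"
proof -
  have "emeasure circle_borel (sphere 0 1) =
      emeasure (uniform_measure lborel {0..<2 * pi}) (cis -` sphere 0 1 \<inter> space (uniform_measure lborel {0..<2 * pi}))"
    unfolding circle_borel_def
    by (rule emeasure_distr[OF measurable_cis_circle]) (simp add: sets_restrict_space_iff)
  also have "cis -` sphere 0 1 \<inter> space (uniform_measure lborel {0..<2 * pi}) = UNIV"
    by auto
  also have "emeasure (uniform_measure lborel {0..<2 * pi}) UNIV = 1"
    by (subst emeasure_uniform_measure) (auto simp: ennreal_divide_self)
  finally show ?thesis .
qed

interpretation circle_borel: finite_measure circle_borel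
  by standard (simp add: emeasure_circle_borel_space)

lemma emeasure_circle_space: "emeasure \<mu> (sphere 0 1) = 1"
proof -
  have "sphere 0 1 \<in> sets circle_borel"
    using sets.top[of circle_borel] by simp
  then show ?thesis
    by (simp add: circle_measure_eq emeasure_circle_borel_space)
qed

interpretation circle: finite_measure \<mu>
  by standard (simp add: emeasure_circle_space)

lemma measure_circle_space [simp]: "measure \<mu> (sphere 0 1) = 1"
  using emeasure_circle_space by (simp add: measure_def)

lemma AE_circle_norm: "AE \<zeta> in \<mu>. norm \<zeta> = 1"
  by (rule AE_I2) simp

lemma measurable_circle_borelI:
  "f \<in> measurable borel N \<Longrightarrow> f \<in> measurable circle_borel N"
  by (subst measurable_cong_sets[OF sets_circle_borel refl]) (rule measurable_restrict_space1)

lemma measurable_circleI: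
  "f \<in> measurable borel N \<Longrightarrow> f \<in> measurable \<mu> N"
  unfolding circle_measure_eq by (intro measurable_completion measurable_circle_borelI)

lemma measurable_circle_ident [measurable]: "(\<lambda>\<zeta>. \<zeta>) \<in> borel_measurable \<mu>"
  by (rule measurable_circleI) simp

lemma sets_circle_borelI: "A \<in> sets borel \<Longrightarrow> A \<inter> sphere 0 1 \<in> sets circle_borel"
  by (simp add: sets_circle_borel sets_restrict_space_iff) 

lemma sets_circleI: "A \<in> sets borel \<Longrightarrow> A \<inter> sphere 0 1 \<in> sets \<mu>"
  by (simp add: circle_measure_eq sets_circle_borelI)

lemma measurable_circle_borel_continuous:
  fixes f :: "complex \<Rightarrow> 'a::topological_space"
  shows "continuous_on (sphere 0 1) f \<Longrightarrow> f \<in> borel_measurable circle_borel"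
  by (subst measurable_cong_sets[OF sets_circle_borel refl])
     (rule borel_measurable_continuous_on_restrict)

lemma measurable_circle_continuous:
  fixes f :: "complex \<Rightarrow> 'a::topological_space"
  shows "continuous_on (sphere 0 1) f \<Longrightarrow> f \<in> borel_measurable \<mu>"
  unfolding circle_measure_eq by (intro measurable_completion measurable_circle_borel_continuous)

lemma integrable_circle_bounded:
  fixes f :: "complex \<Rightarrow> 'a::{banach, second_countable_topology}"
  assumes "f \<in> borel_measurable \<mu>" "\<And>\<zeta>. norm \<zeta> = 1 \<Longrightarrow> norm (f \<zeta>) \<le> B"
  shows "integrable \<mu> f"
  using assms by (intro circle.integrable_const_bound[of _ B]) auto

lemma integrable_circle_continuous:
  fixes f :: "complex \<Rightarrow> 'a::{banach, second_countable_topology}"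
  assumes "continuous_on (sphere 0 1) f"
  shows "integrable \<mu> f"
proof -
  have "bounded (f ` sphere 0 1)"
    using assms compact_continuous_image compact_imp_bounded compact_sphere by blast
  then obtain B where "\<And>\<zeta>. norm \<zeta> = 1 \<Longrightarrow> norm (f \<zeta>) \<le> B"
    unfolding bounded_iff by fastforce
  then show ?thesis
    using integrable_circle_bounded measurable_circle_continuous[OF assms] by blast
qed

lemma integral_circle_cis:
  fixes f :: "complex \<Rightarrow> 'a::{banach, second_countable_topology}"
  assumes "continuous_on (sphere 0 1) f"
  shows "(\<integral>\<zeta>. f \<zeta> \<partial>\<mu>) = (1 / (2 * pi)) *\<^sub>R (LBINT t:{0..<2*pi}. f (cis t))"
proof -
  have fm: "f \<in> borel_measurable circle_borel"
    by (rule measurable_circle_borel_continuous[OF assms])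
  have gm: "(\<lambda>t. f (cis t)) \<in> borel_measurable lborel"
    using measurable_comp[OF measurable_cis_circle, of f borel] fm
    by (simp add: measurable_cong_sets[OF sets_circle_borel refl]
        measurable_cong_sets[OF sets_uniform_measure refl] comp_def)
  have "(\<integral>\<zeta>. f \<zeta> \<partial>\<mu>) = (\<integral>t. f (cis t) \<partial>uniform_measure lborel {0..<2*pi})"
    unfolding circle_measure_eq integral_completion[OF fm] unfolding circle_borel_def
    using fm by (intro integral_distr measurable_cis_circle)
      (simp add: measurable_cong_sets[OF sets_circle_borel refl])
  also have "uniform_measure lborel {0..<2*pi} =
      density lborel (\<lambda>x. ennreal (indicator {0..<2*pi} x / (2 * pi)))"
    unfolding uniform_measure_def
    by (rule arg_cong[where f = "density lborel"])
       (auto simp: fun_eq_iff indicator_def divide_ennreal[symmetric])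
  also have "(\<integral>t. f (cis t) \<partial>\<dots>) = (\<integral>t. (indicator {0..<2*pi} t / (2 * pi)) *\<^sub>R f (cis t) \<partial>lborel)"
    by (intro integral_density gm) auto
  also have "\<dots> = (\<integral>t. (1 / (2 * pi)) *\<^sub>R (indicator {0..<2*pi} t *\<^sub>R f (cis t)) \<partial>lborel)"
    by (simp add: ac_simps)
  finally show ?thesis
    unfolding set_lebesgue_integral_def by (simp only: integral_scaleR_right)
qed

lemma integral_circle_power:
  "(\<integral>\<zeta>. \<zeta> ^ n \<partial>\<mu>) = (if n = 0 then 1 else 0)"
proof (cases "n = 0")
  case False
  have "(LBINT t:{0..<2*pi}. cis t ^ n) = (LBINT t=0..2*pi. cis t ^ n)"
    by (simp add: interval_integral_Ico zero_ereal_def)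
  also have "\<dots> = cis (n * (2*pi)) / (\<i> * n) - cis (real n * 0) / (\<i> * n)"
  proof -
    have "(LBINT t=ereal 0..ereal (2*pi). cis t ^ n) = cis (n * (2*pi)) / (\<i> * n) - cis (real n * 0) / (\<i> * n)"
    proof (rule interval_integral_FTC_finite[where F = "\<lambda>t. cis (real n * t) / (\<i> * n)"])
      show "continuous_on {min 0 (2*pi)..max 0 (2*pi)} (\<lambda>t. cis t ^ n)"
        by (intro continuous_intros)
      fix x assume "min 0 (2*pi) \<le> x" "x \<le> max 0 (2*pi)"
      have "((\<lambda>t. exp (\<i> * of_real (n * t)) / (\<i> * n)) has_vector_derivative exp (\<i> * of_real (n * x)))
         (at x within {min 0 (2*pi)..max 0 (2*pi)})"
        using False
        by (auto intro!: derivative_eq_intros has_vector_derivative_real_field[THEN has_vector_derivative_eq_rhs]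
            simp: algebra_simps)
      then show "((\<lambda>t. cis (n * t) / (\<i> * n)) has_vector_derivative cis x ^ n)
         (at x within {min 0 (2*pi)..max 0 (2*pi)})"
        by (simp add: cis_conv_exp mult.left_commute flip: exp_of_nat_mult)
    qed
    then show ?thesis by (simp add: zero_ereal_def)
  qed
  also have "\<dots> = 0"
    using cis_multiple_2pi[of "real n"] by (simp add: mult.commute mult.left_commute)
  finally show ?thesis
    using False integral_circle_cis[of "\<lambda>\<zeta>. \<zeta> ^ n"] by (simp add: continuous_intros)
qed simp

text \<open>Up to \<open>pi / 3\<close> the derivative of the sine is at least \<open>1 / 2\<close>; from there on \<open>sin x\<close> is at least
  \<open>sin (pi / 3)\<close>, which exceeds \<open>pi / 4\<close>.\<close>

lemma half_le_sin:
  fixes x :: real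
  assumes "0 \<le> x" "x \<le> pi / 2"
  shows "x / 2 \<le> sin x"
proof (cases "x \<le> pi / 3")
  case True
  show ?thesis
  proof (cases "x = 0")
    case False
    then have "0 < x" using assms by simp
    then obtain \<xi> where \<xi>: "0 < \<xi>" "\<xi> < x" "sin x - sin 0 = (x - 0) * cos \<xi>"
      using MVT2[of 0 x sin cos] by (auto intro: DERIV_sin)
    have "1 / 2 \<le> cos \<xi>"
      using cos_monotone_0_pi_le[of \<xi> "pi / 3"] \<xi> True by (simp add: cos_60)
    with \<xi> \<open>0 < x\<close> show ?thesis by (simp add: mult_left_mono[of "1/2" "cos \<xi>" x, simplified])
  qed simp
next
  case False
  then have "sin (pi / 3) \<le> sin x"
    using assms by (intro sin_monotone_2pi_le) auto
  moreover have "pi / 4 \<le> sin (pi / 3)"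
  proof (rule power2_le_imp_le)
    have "pi\<^sup>2 \<le> 3.2\<^sup>2"
      using pi_approx by (intro power_mono) auto
    then show "(pi / 4)\<^sup>2 \<le> (sin (pi / 3))\<^sup>2"
      by (simp add: sin_60 power_divide power2_eq_square)
  qed (simp add: sin_60)
  ultimately show ?thesis using assms by linarith
qed

lemma cmod_cis_diff: "cmod (cis s - cis t) = 2 * \<bar>sin ((s - t) / 2)\<bar>"
proof -
  have "(cmod (cis s - cis t))\<^sup>2 = 2 - 2 * cos (s - t)"
    by (simp add: cmod_power2 power2_diff cos_diff)
       (use sin_cos_squared_add[of s] sin_cos_squared_add[of t] in linarith)
  also have "cos (s - t) = 1 - 2 * (sin ((s - t) / 2))\<^sup>2"
    using cos_double_sin[of "(s - t) / 2"] by (simp del: right_diff_distrib_numeral)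
  also have "2 - 2 * (1 - 2 * (sin ((s - t) / 2))\<^sup>2) = (2 * \<bar>sin ((s - t) / 2)\<bar>)\<^sup>2"
    by (simp add: power_mult_distrib)
  finally show ?thesis
    by (rule power2_eq_imp_eq) auto
qed

text \<open>A chord of length at most \<open>\<delta>\<close> subtends an angle of at most \<open>2\<delta>\<close>. The cut of the parameter
  interval at the point 1 may divide the arc, hence the two additional intervals in \<open>U\<close>.\<close>

lemma measure_circle_cball:
  assumes "norm \<zeta>\<^sub>0 = 1" "0 \<le> \<delta>"
  shows "emeasure \<mu> (cball \<zeta>\<^sub>0 \<delta> \<inter> sphere 0 1) \<le> ennreal (2 * \<delta>)"
proof -
  obtain s where s: "0 \<le> s" "s < 2 * pi" "\<zeta>\<^sub>0 = cis s"
    using assms(1) by (metis cis_Arg_unique Arg2pi cmod_unit_one is_Arg_def mult_1 of_real_1 cis_conv_exp)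
  define U where "U = {s - 2*\<delta>..s + 2*\<delta>} \<union> {0..2*\<delta>} \<union> {2*pi - 2*\<delta>..2*pi}"
  have sub: "{0..<2*pi} \<inter> {t. cmod (cis s - cis t) \<le> \<delta>} \<subseteq> U"
  proof
    fix t assume "t \<in> {0..<2*pi} \<inter> {t. cmod (cis s - cis t) \<le> \<delta>}"
    then have t: "0 \<le> t" "t < 2 * pi" and d: "2 * \<bar>sin ((s - t) / 2)\<bar> \<le> \<delta>"
      by (auto simp: cmod_cis_diff)
    define x where "x = \<bar>s - t\<bar> / 2"
    have "(s - t) / 2 = x \<or> (s - t) / 2 = - x"
      by (auto simp: x_def)
    then have "\<bar>sin ((s - t) / 2)\<bar> = \<bar>sin x\<bar>"
      by auto
    moreover have "0 \<le> x" "x \<le> pi" using s t by (auto simp: x_def)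
    ultimately have d': "2 * sin x \<le> \<delta>" using d by (simp add: sin_ge_zero)
    show "t \<in> U"
    proof (cases "x \<le> pi / 2")
      case True
      then have "x \<le> \<delta>" using half_le_sin[of x] d' \<open>0 \<le> x\<close> by linarith
      then show ?thesis by (auto simp: x_def U_def abs_if split: if_splits)
    next
      case False
      then have "pi - x \<le> \<delta>" using half_le_sin[of "pi - x"] d' \<open>x \<le> pi\<close> by simp
      then have "\<bar>s - t\<bar> \<ge> 2 * pi - 2 * \<delta>" by (simp add: x_def)
      then show ?thesis using s t by (auto simp: U_def abs_if split: if_splits)
    qed
  qed
  have "emeasure \<mu> (cball \<zeta>\<^sub>0 \<delta> \<inter> sphere 0 1)
     = emeasure circle_borel (cball \<zeta>\<^sub>0 \<delta> \<inter> sphere 0 1)"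
    by (simp add: circle_measure_eq sets_circle_borelI)
  also have "\<dots> = emeasure (uniform_measure lborel {0..<2*pi}) {t. cmod (cis s - cis t) \<le> \<delta>}"
    unfolding circle_borel_def
    by (subst emeasure_distr[OF measurable_cis_circle])
       (auto simp: sets_circle_borel[symmetric] sets_circle_borelI s dist_norm
         intro!: arg_cong[where f = "emeasure _"])
  also have "\<dots> = emeasure lborel ({0..<2*pi} \<inter> {t. cmod (cis s - cis t) \<le> \<delta>}) / emeasure lborel {0..<2*pi}"
    by (rule emeasure_uniform_measure) (auto simp: cis_conv_exp intro!: borel_closed closed_Collect_le continuous_intros)
  also have "\<dots> \<le> emeasure lborel U / emeasure lborel {0..<2*pi}"
    by (intro divide_right_mono_ennreal emeasure_mono sub) (auto simp: U_def)
  also have "emeasure lborel U \<le> emeasure lborel {s - 2*\<delta>..s + 2*\<delta>} + emeasure lborel {0..2*\<delta>}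
      + emeasure lborel {2*pi - 2*\<delta>..2*pi}"
    unfolding U_def
    by (intro order.trans[OF emeasure_subadditive] add_mono order.refl) auto
  also have "\<dots> = ennreal (8 * \<delta>)"
    using assms by (simp flip: ennreal_plus)
  also have "ennreal (8 * \<delta>) / emeasure lborel {0..<2*pi} = ennreal (8 * \<delta> / (2 * pi))"
    using assms by (simp add: divide_ennreal)
  also have "8 * \<delta> / (2 * pi) \<le> 2 * \<delta>"
    using assms mult_right_mono[of 2 pi \<delta>] pi_gt3 by (simp add: field_simps)
  finally show ?thesis by (simp add: divide_right_mono_ennreal ennreal_leI)
qed

section \<open>Cauchy and Poisson integrals\<close>

lemma circle_cnj: "norm \<zeta> = 1 \<Longrightarrow> \<zeta> * cnj \<zeta> = 1"
  by (metis complex_norm_square mult_1 of_real_1 power_one)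

lemma integral_circle_monomial:
  "(\<integral>\<zeta>. \<zeta> ^ n * cnj \<zeta> ^ m \<partial>\<mu>) = (if n = m then 1 else 0)"
proof (cases "m \<le> n")
  case True
  have "(\<integral>\<zeta>. \<zeta> ^ n * cnj \<zeta> ^ m \<partial>\<mu>) = (\<integral>\<zeta>. \<zeta> ^ (n - m) \<partial>\<mu>)"
  proof (rule Bochner_Integration.integral_cong[OF refl])
    fix \<zeta> :: complex assume "\<zeta> \<in> space \<mu>"
    then have "\<zeta> ^ (n - m) * (\<zeta> * cnj \<zeta>) ^ m = \<zeta> ^ (n - m)" by (simp add: circle_cnj)
    then show "\<zeta> ^ n * cnj \<zeta> ^ m = \<zeta> ^ (n - m)"
      using True by (simp add: power_mult_distrib mult.assoc[symmetric] flip: power_add)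
  qed
  then show ?thesis using True by (auto simp: integral_circle_power)
next
  case False
  have "(\<integral>\<zeta>. \<zeta> ^ n * cnj \<zeta> ^ m \<partial>\<mu>) = (\<integral>\<zeta>. cnj (\<zeta> ^ (m - n)) \<partial>\<mu>)"
  proof (rule Bochner_Integration.integral_cong[OF refl])
    fix \<zeta> :: complex assume "\<zeta> \<in> space \<mu>"
    then have "cnj \<zeta> ^ (m - n) * (\<zeta> * cnj \<zeta>) ^ n = cnj \<zeta> ^ (m - n)" by (simp add: circle_cnj)
    then have "\<zeta> ^ n * (cnj \<zeta> ^ (m - n) * cnj \<zeta> ^ n) = cnj \<zeta> ^ (m - n)"
      by (simp add: power_mult_distrib ac_simps)
    then show "\<zeta> ^ n * cnj \<zeta> ^ m = cnj (\<zeta> ^ (m - n))"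
      using False by (simp flip: power_add)
  qed
  also have "\<dots> = cnj (\<integral>\<zeta>. \<zeta> ^ (m - n) \<partial>\<mu>)"
    by (rule Bochner_Integration.integral_cnj)
  finally show ?thesis using False by (auto simp: integral_circle_power)
qed

lemma integrable_circle_mult:
  fixes k :: "complex \<Rightarrow> 'a::{banach, second_countable_topology}"
  assumes "integrable \<mu> k" "h \<in> borel_measurable \<mu>"
    and "\<And>\<zeta>. norm \<zeta> = 1 \<Longrightarrow> \<bar>h \<zeta>\<bar> \<le> B"
  shows "integrable \<mu> (\<lambda>\<zeta>. h \<zeta> *\<^sub>R k \<zeta>)"
proof (rule Bochner_Integration.integrable_bound)
  show "integrable \<mu> (\<lambda>\<zeta>. B * norm (k \<zeta>))"
    using assms(1) by simp
  show "(\<lambda>\<zeta>. h \<zeta> *\<^sub>R k \<zeta>) \<in> borel_measurable \<mu>"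
    using assms by (intro borel_measurable_scaleR) auto
  show "AE \<zeta> in \<mu>. norm (h \<zeta> *\<^sub>R k \<zeta>) \<le> norm (B * norm (k \<zeta>))"
  proof (rule AE_I2)
    fix \<zeta> :: complex assume "\<zeta> \<in> space \<mu>"
    then have "\<bar>h \<zeta>\<bar> \<le> B" using assms(3) by simp
    then show "norm (h \<zeta> *\<^sub>R k \<zeta>) \<le> norm (B * norm (k \<zeta>))"
      by (auto intro!: mult_mono simp: abs_mult)
  qed
qed

lemma integrable_circle_mult_complex:
  fixes k h :: "complex \<Rightarrow> complex"
  assumes "integrable \<mu> k" "h \<in> borel_measurable \<mu>"
    and "\<And>\<zeta>. norm \<zeta> = 1 \<Longrightarrow> norm (h \<zeta>) \<le> B"
  shows "integrable \<mu> (\<lambda>\<zeta>. h \<zeta> * k \<zeta>)"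
proof (rule Bochner_Integration.integrable_bound)
  show "integrable \<mu> (\<lambda>\<zeta>. B * norm (k \<zeta>))"
    using assms(1) by simp
  show "(\<lambda>\<zeta>. h \<zeta> * k \<zeta>) \<in> borel_measurable \<mu>"
    using assms by (intro borel_measurable_times) auto
  show "AE \<zeta> in \<mu>. norm (h \<zeta> * k \<zeta>) \<le> norm (B * norm (k \<zeta>))"
  proof (rule AE_I2)
    fix \<zeta> :: complex assume "\<zeta> \<in> space \<mu>"
    then have "norm (h \<zeta>) \<le> B" using assms(3) by simp
    moreover have "B \<le> \<bar>B\<bar>" by simp
    ultimately show "norm (h \<zeta> * k \<zeta>) \<le> norm (B * norm (k \<zeta>))"
      unfolding norm_mult real_norm_def abs_mult abs_norm_cancel
      by (intro mult_right_mono) auto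
  qed
qed

definition cauchy_integral :: "(complex \<Rightarrow> complex) \<Rightarrow> complex \<Rightarrow> complex" where
  "cauchy_integral k z = (\<integral>\<zeta>. k \<zeta> / (1 - z * cnj \<zeta>) \<partial>\<mu>)"

lemma cauchy_kernel_lower:
  assumes "norm z < 1" "norm \<zeta> = 1"
  shows "1 - norm z \<le> norm (1 - z * cnj \<zeta>)"
  using norm_triangle_ineq2[of 1 "z * cnj \<zeta>"] assms by (simp add: norm_mult)

lemma cauchy_kernel_nonzero: "norm z < 1 \<Longrightarrow> norm \<zeta> = 1 \<Longrightarrow> 1 - z * cnj \<zeta> \<noteq> 0"
  using cauchy_kernel_lower[of z \<zeta>] by auto

lemma continuous_cauchy_kernel:
  "norm z < 1 \<Longrightarrow> continuous_on (sphere 0 1) (\<lambda>\<zeta>. 1 / (1 - z * cnj \<zeta>))"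
  using cauchy_kernel_nonzero[of z] by (intro continuous_intros) fastforce

lemma integrable_cauchy:
  assumes "integrable \<mu> k" "norm z < 1"
  shows "integrable \<mu> (\<lambda>\<zeta>. k \<zeta> / (1 - z * cnj \<zeta>))"
proof -
  have "integrable \<mu> (\<lambda>\<zeta>. 1 / (1 - z * cnj \<zeta>) * k \<zeta>)"
  proof (rule integrable_circle_mult_complex[OF assms(1), where B = "1 / (1 - norm z)"])
    show "(\<lambda>\<zeta>. 1 / (1 - z * cnj \<zeta>)) \<in> borel_measurable \<mu>"
      by (intro measurable_circle_continuous continuous_cauchy_kernel assms)
    show "norm (1 / (1 - z * cnj \<zeta>)) \<le> 1 / (1 - norm z)" if "norm \<zeta> = 1" for \<zeta>
      using cauchy_kernel_lower[OF assms(2) that] assms(2) by (simp add: norm_divide frac_le)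
  qed
  then show ?thesis by simp
qed

lemma integrable_circle_cnj_power:
  fixes k :: "complex \<Rightarrow> complex"
  assumes "integrable \<mu> k"
  shows "integrable \<mu> (\<lambda>\<zeta>. k \<zeta> * cnj \<zeta> ^ n)"
    and "integrable \<mu> (\<lambda>\<zeta>. k \<zeta> * \<zeta> ^ n)"
proof -
  have "(\<lambda>\<zeta>. cnj \<zeta> ^ n) \<in> borel_measurable \<mu>"
    "(\<lambda>\<zeta>. \<zeta> ^ n) \<in> borel_measurable \<mu>"
    by (intro measurable_circle_continuous continuous_intros)+
  then show "integrable \<mu> (\<lambda>\<zeta>. k \<zeta> * cnj \<zeta> ^ n)"
    "integrable \<mu> (\<lambda>\<zeta>. k \<zeta> * \<zeta> ^ n)"
    using assms integrable_circle_mult_complex[of k "\<lambda>\<zeta>. cnj \<zeta> ^ n" 1]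
      integrable_circle_mult_complex[of k "\<lambda>\<zeta>. \<zeta> ^ n" 1]
    by (simp_all add: norm_power mult.commute)
qed

text \<open>Integrate the geometric series of the Cauchy kernel term by term.\<close>

lemma cauchy_integral_sums:
  assumes k: "integrable \<mu> k" and z: "norm z < 1"
  shows "(\<lambda>n. (\<integral>\<zeta>. k \<zeta> * cnj \<zeta> ^ n \<partial>\<mu>) * z ^ n) sums cauchy_integral k z"
proof -
  let ?f = "\<lambda>n \<zeta>. k \<zeta> * cnj \<zeta> ^ n * z ^ n"
  have int: "integrable \<mu> (?f n)" for n
    using integrable_circle_cnj_power(1)[OF k] by simp
  have norm_eq: "norm (?f n \<zeta>) = norm (k \<zeta>) * norm z ^ n" if "norm \<zeta> = 1" for n \<zeta>
    using that by (simp add: norm_mult norm_power)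
  have "(\<lambda>n. integral\<^sup>L \<mu> (?f n)) sums (\<integral>\<zeta>. (\<Sum>n. ?f n \<zeta>) \<partial>\<mu>)"
  proof (rule sums_integral[OF int])
    show "AE \<zeta> in \<mu>. summable (\<lambda>n. norm (?f n \<zeta>))"
      using z by (intro AE_I2) (simp add: norm_eq summable_mult summable_geometric)
    have "(\<integral>\<zeta>. norm (?f n \<zeta>) \<partial>\<mu>) = (\<integral>\<zeta>. norm (k \<zeta>) \<partial>\<mu>) * norm z ^ n" for n
      by (subst Bochner_Integration.integral_cong[OF refl norm_eq]) auto
    then show "summable (\<lambda>n. \<integral>\<zeta>. norm (?f n \<zeta>) \<partial>\<mu>)"
      using z by (simp add: summable_mult summable_geometric)
  qed
  also have "(\<integral>\<zeta>. (\<Sum>n. ?f n \<zeta>) \<partial>\<mu>) = cauchy_integral k z"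
    unfolding cauchy_integral_def
  proof (rule Bochner_Integration.integral_cong[OF refl])
    fix \<zeta> :: complex assume "\<zeta> \<in> space \<mu>"
    then have *: "norm (z * cnj \<zeta>) < 1" using z by (simp add: norm_mult)
    have "(\<lambda>n. k \<zeta> * (z * cnj \<zeta>) ^ n) sums (k \<zeta> * (1 / (1 - z * cnj \<zeta>)))"
      by (intro sums_mult geometric_sums *)
    then have "(\<Sum>n. k \<zeta> * (z * cnj \<zeta>) ^ n) = k \<zeta> / (1 - z * cnj \<zeta>)"
      by (simp add: sums_iff)
    then show "(\<Sum>n. ?f n \<zeta>) = k \<zeta> / (1 - z * cnj \<zeta>)"
      by (simp add: power_mult_distrib mult_ac)
  qed
  finally show ?thesis by simp
qed

lemma holomorphic_cauchy_integral:
  assumes "integrable \<mu> k"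
  shows "cauchy_integral k holomorphic_on ball 0 1"
  by (rule power_series_holomorphic[where a = "\<lambda>n. \<integral>\<zeta>. k \<zeta> * cnj \<zeta> ^ n \<partial>\<mu>"])
     (use cauchy_integral_sums[OF assms] in auto)

lemma cauchy_integral_one: "norm z < 1 \<Longrightarrow> (\<integral>\<zeta>. 1 / (1 - z * cnj \<zeta>) \<partial>\<mu>) = 1"
proof -
  assume z: "norm z < 1"
  have "(\<integral>\<zeta>. 1 * cnj \<zeta> ^ n \<partial>\<mu>) * z ^ n = (if n = 0 then 1 else 0)" for n
    using integral_circle_monomial[of 0 n] by auto
  then have "(\<lambda>n::nat. if n = 0 then 1 else 0) sums cauchy_integral (\<lambda>_. 1) z"
    using cauchy_integral_sums[of "\<lambda>_. 1" z] z by simp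
  moreover have "(\<lambda>n::nat. if n = 0 then 1 else 0) sums (1::complex)"
    using sums_single[of 0 "\<lambda>_. 1::complex"] by simp
  ultimately show ?thesis
    unfolding cauchy_integral_def using sums_unique2 by blast
qed

definition poisson_kernel :: "complex \<Rightarrow> complex \<Rightarrow> real" where
  "poisson_kernel z \<zeta> = (1 - (norm z)\<^sup>2) / (norm (\<zeta> - z))\<^sup>2"

definition poisson_integral ::
    "(complex \<Rightarrow> 'a::{banach, second_countable_topology}) \<Rightarrow> complex \<Rightarrow> 'a" where
  "poisson_integral k z = (\<integral>\<zeta>. poisson_kernel z \<zeta> *\<^sub>R k \<zeta> \<partial>\<mu>)"

lemma norm_diff_circle:
  assumes "norm \<zeta> = 1"
  shows "norm (\<zeta> - z) = norm (1 - z * cnj \<zeta>)"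
proof -
  have "\<zeta> - z = \<zeta> * (1 - z * cnj \<zeta>)"
    using circle_cnj[OF assms] by (simp add: algebra_simps)
  then show ?thesis using assms by (metis mult_1 norm_mult)
qed

text \<open>The right-hand side is the real part of the Herglotz kernel, which reduces Poisson integrals to
  Cauchy integrals.\<close>

lemma poisson_kernel_cauchy:
  assumes "norm z < 1" "norm \<zeta> = 1"
  shows "poisson_kernel z \<zeta> = 2 * Re (1 / (1 - z * cnj \<zeta>)) - 1"
proof -
  define w where "w = z * cnj \<zeta>"
  have w: "norm w = norm z" "w \<noteq> 1"
    using assms cauchy_kernel_nonzero[of z \<zeta>] by (auto simp: w_def norm_mult)
  then have pos: "(norm (1 - w))\<^sup>2 \<noteq> 0" by simp
  have "Re (1 / (1 - w)) = (1 - Re w) / (norm (1 - w))\<^sup>2"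
    by (simp add: Re_divide cmod_power2)
  moreover have "1 - (norm w)\<^sup>2 = 2 * (1 - Re w) - (norm (1 - w))\<^sup>2"
    unfolding cmod_power2 by (simp add: power2_eq_square algebra_simps)
  ultimately have "(1 - (norm w)\<^sup>2) / (norm (1 - w))\<^sup>2 = 2 * Re (1 / (1 - w)) - 1"
    using pos by (simp only: divide_simps) (simp add: left_diff_distrib mult.assoc)
  then show ?thesis
    unfolding poisson_kernel_def norm_diff_circle[OF assms(2)]
    using w(1) by (simp add: w_def[symmetric])
qed

lemma poisson_kernel_nonneg: "norm z \<le> 1 \<Longrightarrow> 0 \<le> poisson_kernel z \<zeta>"
  unfolding poisson_kernel_def by (simp add: power_le_one)

lemma poisson_kernel_pos: "norm z < 1 \<Longrightarrow> norm \<zeta> = 1 \<Longrightarrow> 0 < poisson_kernel z \<zeta>"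
  unfolding poisson_kernel_def by (intro divide_pos_pos) (auto simp: abs_square_less_1)

lemma one_minus_norm_sq_le: "norm (z::complex) \<le> 1 \<Longrightarrow> 1 - (norm z)\<^sup>2 \<le> 2 * (1 - norm z)"
proof -
  assume "norm z \<le> 1"
  then have "(1 - norm z) * (1 + norm z) \<le> (1 - norm z) * 2"
    by (intro mult_left_mono) auto
  then show ?thesis by (simp add: algebra_simps power2_eq_square)
qed

lemma poisson_kernel_le:
  assumes "norm z < 1" "0 < d" "d \<le> norm (\<zeta> - z)"
  shows "poisson_kernel z \<zeta> \<le> 2 * (1 - norm z) / d\<^sup>2"
  unfolding poisson_kernel_def
  using assms one_minus_norm_sq_le[of z] by (intro frac_le power_mono) auto

lemma poisson_kernel_le_center:
  assumes "norm z < 1" "norm \<zeta> = 1"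
  shows "poisson_kernel z \<zeta> \<le> 2 / (1 - norm z)"
proof -
  have "1 - norm z \<le> norm (\<zeta> - z)"
    using norm_triangle_ineq2[of \<zeta> z] assms by simp
  from poisson_kernel_le[OF assms(1) _ this] assms
  have "poisson_kernel z \<zeta> \<le> 2 * (1 - norm z) / (1 - norm z)\<^sup>2" by simp
  also have "\<dots> = 2 / (1 - norm z)"
    using assms by (simp add: divide_simps power2_eq_square)
  finally show ?thesis .
qed

lemma abs_poisson_kernel_le:
  assumes "norm z < 1" "norm \<zeta> = 1"
  shows "\<bar>poisson_kernel z \<zeta>\<bar> \<le> 2 / (1 - norm z)"
  using poisson_kernel_le_center[OF assms] poisson_kernel_nonneg[of z \<zeta>] assms by simp

lemma continuous_poisson_kernel:
  "norm z < 1 \<Longrightarrow> continuous_on (sphere 0 1) (poisson_kernel z)"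
  unfolding poisson_kernel_def by (intro continuous_intros) auto

lemma measurable_poisson_kernel:
  "norm z < 1 \<Longrightarrow> poisson_kernel z \<in> borel_measurable \<mu>"
  by (intro measurable_circle_continuous continuous_poisson_kernel)

lemma integrable_poisson:
  fixes k :: "complex \<Rightarrow> 'a::{banach, second_countable_topology}"
  assumes "integrable \<mu> k" "norm z < 1"
  shows "integrable \<mu> (\<lambda>\<zeta>. poisson_kernel z \<zeta> *\<^sub>R k \<zeta>)"
  using assms abs_poisson_kernel_le[OF assms(2)]
  by (intro integrable_circle_mult measurable_poisson_kernel) auto

lemma integrable_poisson_real:
  fixes k :: "complex \<Rightarrow> real"
  assumes "integrable \<mu> k" "norm z < 1"
  shows "integrable \<mu> (\<lambda>\<zeta>. poisson_kernel z \<zeta> * k \<zeta>)"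
  using integrable_poisson[OF assms] by simp

lemma integral_poisson_kernel:
  assumes "norm z < 1"
  shows "(\<integral>\<zeta>. poisson_kernel z \<zeta> \<partial>\<mu>) = 1"
proof -
  have int: "integrable \<mu> (\<lambda>\<zeta>. 1 / (1 - z * cnj \<zeta>))"
    using integrable_cauchy[of "\<lambda>_. 1" z] assms by simp
  have "(\<integral>\<zeta>. poisson_kernel z \<zeta> \<partial>\<mu>) =
      (\<integral>\<zeta>. 2 * Re (1 / (1 - z * cnj \<zeta>)) - 1 \<partial>\<mu>)"
    by (rule Bochner_Integration.integral_cong[OF refl])
       (simp add: poisson_kernel_cauchy[OF assms])
  also have "\<dots> = 2 * (\<integral>\<zeta>. Re (1 / (1 - z * cnj \<zeta>)) \<partial>\<mu>) - 1"
    using int by (subst Bochner_Integration.integral_diff) auto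
  also have "(\<integral>\<zeta>. Re (1 / (1 - z * cnj \<zeta>)) \<partial>\<mu>) = 1"
    using cauchy_integral_one[OF assms] integral_Re[OF int] by simp
  finally show ?thesis by simp
qed

lemma poisson_integral_const:
  "norm z < 1 \<Longrightarrow> poisson_integral (\<lambda>_. c) z = c"
  unfolding poisson_integral_def
  using integral_poisson_kernel[of z] integrable_poisson_real[of "\<lambda>_. 1" z] by simp

lemma poisson_integral_diff:
  assumes "integrable \<mu> f" "integrable \<mu> g" "norm z < 1"
  shows "poisson_integral (\<lambda>\<zeta>. f \<zeta> - g \<zeta>) z = poisson_integral f z - poisson_integral g z"
  unfolding poisson_integral_def
  using integrable_poisson[OF assms(1,3)] integrable_poisson[OF assms(2,3)]
  by (simp add: scaleR_diff_right)

lemma poisson_integral_mono: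
  fixes f g :: "complex \<Rightarrow> real"
  assumes "integrable \<mu> f" "integrable \<mu> g" "norm z < 1"
    and "AE \<zeta> in \<mu>. f \<zeta> \<le> g \<zeta>"
  shows "poisson_integral f z \<le> poisson_integral g z"
  unfolding poisson_integral_def
proof (rule integral_mono_AE[OF integrable_poisson[OF assms(1,3)] integrable_poisson[OF assms(2,3)]])
  show "AE \<zeta> in \<mu>. poisson_kernel z \<zeta> *\<^sub>R f \<zeta> \<le> poisson_kernel z \<zeta> *\<^sub>R g \<zeta>"
    using assms(4) by eventually_elim (use assms(3) in \<open>auto intro!: mult_left_mono poisson_kernel_nonneg\<close>)
qed

lemma norm_poisson_integral_le:
  assumes "integrable \<mu> f" "norm z < 1"
  shows "norm (poisson_integral f z) \<le> poisson_integral (\<lambda>\<zeta>. norm (f \<zeta>)) z"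
proof -
  have "norm (poisson_integral f z) \<le> (\<integral>\<zeta>. norm (poisson_kernel z \<zeta> *\<^sub>R f \<zeta>) \<partial>\<mu>)"
    unfolding poisson_integral_def by (rule integral_norm_bound)
  also have "\<dots> = poisson_integral (\<lambda>\<zeta>. norm (f \<zeta>)) z"
    unfolding poisson_integral_def using assms(2)
    by (intro Bochner_Integration.integral_cong) (auto simp: poisson_kernel_nonneg)
  finally show ?thesis .
qed

text \<open>The Poisson kernel concentrates at the radial projection \<open>sgn z\<close> of its pole \<open>z\<close>, uniformly in the
  direction of \<open>z\<close>.\<close>

lemma poisson_integral_uniform:
  fixes c :: "complex \<Rightarrow> 'a::{banach, second_countable_topology}"
  assumes c: "continuous_on (sphere 0 1) c" and e: "0 < e"
  obtains s where "0 < s" "s < 1"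
    "\<And>z. s \<le> norm z \<Longrightarrow> norm z < 1 \<Longrightarrow> norm (poisson_integral c z - c (sgn z)) < e"
proof -
  have "uniformly_continuous_on (sphere 0 1) c"
    using c by (intro compact_uniformly_continuous) auto
  then obtain d where d: "d > 0"
    and close: "\<And>x y. norm x = 1 \<Longrightarrow> norm y = 1 \<Longrightarrow> dist x y < d \<Longrightarrow> dist (c x) (c y) < e / 2"
    using e unfolding uniformly_continuous_on_def by (metis half_gt_zero mem_sphere_0)
  have "bounded (c ` sphere 0 1)"
    using c compact_continuous_image compact_imp_bounded compact_sphere by blast
  then obtain B where B: "B > 0" "\<And>x. norm x = 1 \<Longrightarrow> norm (c x) \<le> B"
    unfolding bounded_pos by fastforce
  \<comment> \<open>Away from the disc of radius \<open>d\<close> about \<open>sgn z\<close> the integrand is at most \<open>16 B \<eta> / d\<^sup>2\<close>, which has to be below \<open>e / 2\<close>.\<close>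
  define Q where "Q = e * d\<^sup>2 / (32 * B)"
  define \<eta> where "\<eta> = Min {1 / 2, d / 2, Q / 2}"
  have \<eta>: "0 < \<eta>" "\<eta> \<le> 1 / 2" "\<eta> \<le> d / 2" "\<eta> < Q"
  proof -
    have q: "0 < Q" using e d B by (simp add: Q_def)
    show "0 < \<eta>" "\<eta> \<le> 1 / 2" "\<eta> \<le> d / 2"
      using q d by (auto simp: \<eta>_def)
    have "\<eta> \<le> Q / 2" by (auto simp: \<eta>_def)
    with q show "\<eta> < Q" by linarith
  qed
  show ?thesis
  proof (rule that[of "1 - \<eta>"])
    fix z :: complex assume z: "1 - \<eta> \<le> norm z" "norm z < 1"
    define u where "u = sgn z"
    have "z \<noteq> 0" using z \<eta> by auto
    then have u: "norm u = 1" by (simp add: u_def norm_sgn)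
    have "u - z = (1 - norm z) *\<^sub>R u"
      using \<open>z \<noteq> 0\<close> by (simp add: u_def scaleR_diff_left sgn_div_norm left_diff_distrib)
    then have uz: "norm (u - z) = 1 - norm z" using u z by simp
    have ic: "integrable \<mu> c"
      by (rule integrable_circle_continuous[OF c])
    have "poisson_integral c z - c u = poisson_integral (\<lambda>\<zeta>. c \<zeta> - c u) z"
      using ic z by (simp add: poisson_integral_diff poisson_integral_const)
    also have "norm \<dots> \<le> poisson_integral (\<lambda>\<zeta>. norm (c \<zeta> - c u)) z"
      using ic z by (intro norm_poisson_integral_le) auto
    also have "\<dots> \<le> (\<integral>\<zeta>. poisson_kernel z \<zeta> * (e / 2) + 16 * B * \<eta> / d\<^sup>2 \<partial>\<mu>)"
      unfolding poisson_integral_def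
    proof (rule integral_mono)
      show "integrable \<mu> (\<lambda>\<zeta>. poisson_kernel z \<zeta> *\<^sub>R norm (c \<zeta> - c u))"
        using ic z by (intro integrable_poisson) auto
      show "integrable \<mu> (\<lambda>\<zeta>. poisson_kernel z \<zeta> * (e / 2) + 16 * B * \<eta> / d\<^sup>2)"
        using z integrable_poisson_real[of "\<lambda>_. e / 2" z] by simp
      fix \<zeta> :: complex assume "\<zeta> \<in> space \<mu>"
      then have \<zeta>: "norm \<zeta> = 1" by simp
      show "poisson_kernel z \<zeta> *\<^sub>R norm (c \<zeta> - c u) \<le> poisson_kernel z \<zeta> * (e / 2) + 16 * B * \<eta> / d\<^sup>2"
      proof (cases "dist \<zeta> u < d")
        case True
        then have "poisson_kernel z \<zeta> * norm (c \<zeta> - c u) \<le> poisson_kernel z \<zeta> * (e / 2)"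
          using close[OF \<zeta> u] z by (intro mult_left_mono poisson_kernel_nonneg) (auto simp: dist_norm)
        moreover have "0 \<le> 16 * B * \<eta> / d\<^sup>2" using B \<eta> by simp
        ultimately show ?thesis by simp
      next
        case False
        have "norm (\<zeta> - u) \<le> norm (\<zeta> - z) + norm (u - z)"
          using norm_triangle_ineq4[of "\<zeta> - z" "u - z"] by simp
        then have "d / 2 \<le> norm (\<zeta> - z)"
          using False uz z \<eta> by (simp add: dist_norm)
        from poisson_kernel_le[OF z(2) _ this] d
        have "poisson_kernel z \<zeta> \<le> 8 * (1 - norm z) / d\<^sup>2"
          by (simp add: power_divide)
        also have "\<dots> \<le> 8 * \<eta> / d\<^sup>2"
          using z by (intro divide_right_mono) auto
        finally have "poisson_kernel z \<zeta> \<le> 8 * \<eta> / d\<^sup>2" .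
        moreover have "norm (c \<zeta> - c u) \<le> 2 * B"
          using B(2)[OF \<zeta>] B(2)[OF u] norm_triangle_ineq4[of "c \<zeta>" "c u"] by linarith
        ultimately have "poisson_kernel z \<zeta> * norm (c \<zeta> - c u) \<le> (8 * \<eta> / d\<^sup>2) * (2 * B)"
          using \<eta> by (intro mult_mono) auto
        moreover have "0 \<le> poisson_kernel z \<zeta> * (e / 2)"
          using e z by (simp add: poisson_kernel_nonneg)
        ultimately show ?thesis by (simp add: mult_ac)
      qed
    qed
    also have "\<dots> = e / 2 + 16 * B * \<eta> / d\<^sup>2"
      using z integrable_poisson_real[of "\<lambda>_. e / 2" z] integral_poisson_kernel[OF z(2)] by simp
    also have "\<dots> < e"
      using \<eta>(4) B d by (simp add: Q_def field_simps)
    finally show "norm (poisson_integral c z - c (sgn z)) < e" by (simp add: u_def)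
  qed (use \<eta> in auto)
qed

lemma poisson_integral_continuous_boundary:
  fixes c :: "complex \<Rightarrow> 'a::{banach, second_countable_topology}"
  assumes c: "continuous_on (sphere 0 1) c" and \<zeta>: "norm \<zeta> = 1"
  shows "(poisson_integral c \<longlongrightarrow> c \<zeta>) (at \<zeta> within ball 0 1)"
proof (rule tendstoI)
  fix e :: real assume e: "e > 0"
  obtain s where s: "0 < s" "s < 1"
    and close: "\<And>z. s \<le> norm z \<Longrightarrow> norm z < 1 \<Longrightarrow> norm (poisson_integral c z - c (sgn z)) < e / 2"
    using poisson_integral_uniform[OF c, of "e / 2"] e by auto
  have "\<zeta> \<noteq> 0" using \<zeta> by auto
  have sgn: "(sgn \<longlongrightarrow> \<zeta>) (at \<zeta> within ball 0 1)"
  proof -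
    have "((\<lambda>z. z /\<^sub>R norm z) \<longlongrightarrow> \<zeta> /\<^sub>R norm \<zeta>) (at \<zeta> within ball 0 1)"
      using \<zeta> by (intro tendsto_intros) auto
    then show ?thesis using \<zeta> by (simp add: sgn_div_norm[abs_def])
  qed
  have "((\<lambda>z. norm z) \<longlongrightarrow> norm \<zeta>) (at \<zeta> within ball 0 1)"
    by (intro tendsto_intros)
  then have ev1: "eventually (\<lambda>z. norm z > s) (at \<zeta> within ball 0 1)"
    using \<zeta> s by (intro order_tendstoD(1)) auto
  have ev2: "eventually (\<lambda>z. z \<in> ball 0 1) (at \<zeta> within ball 0 1)"
    by (simp add: eventually_at_filter)
  have "((\<lambda>z. c (sgn z)) \<longlongrightarrow> c \<zeta>) (at \<zeta> within ball 0 1)"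
  proof (rule continuous_on_tendsto_compose[OF c sgn])
    show "\<zeta> \<in> sphere 0 1" using \<zeta> by simp
    show "\<forall>\<^sub>F z in at \<zeta> within ball 0 1. sgn z \<in> sphere 0 1"
      using ev1 by eventually_elim (use s in \<open>auto simp: norm_sgn\<close>)
  qed
  then have "eventually (\<lambda>z. dist (c (sgn z)) (c \<zeta>) < e / 2) (at \<zeta> within ball 0 1)"
    using e by (intro tendstoD) auto
  with ev1 ev2 show "eventually (\<lambda>z. dist (poisson_integral c z) (c \<zeta>) < e) (at \<zeta> within ball 0 1)"
  proof eventually_elim
    case (elim z)
    then have "dist (poisson_integral c z) (c (sgn z)) < e / 2"
      using close[of z] by (simp add: dist_norm)
    with elim show ?case by (metis dist_triangle_half_r dist_commute)
  qed
qed

section \<open>The maximal function and angular limits of Poisson integrals\<close>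

text \<open>On a Stolz region at \<open>\<zeta>\<^sub>0\<close> the distance of \<open>\<zeta>\<close> from the pole \<open>z\<close> is comparable to its distance
  from \<open>\<zeta>\<^sub>0\<close>, as soon as the latter exceeds \<open>2 a (1 - \<bar>z\<bar>)\<close>. The quadratic decay of the kernel then
  gives coefficients of size \<open>4\<^bsup>-j\<^esup> / (1 - \<bar>z\<bar>)\<close> for the discs of radius \<open>2\<^sup>j \<cdot> 2 a (1 - \<bar>z\<bar>)\<close>. The condition on
  \<open>J\<close> makes the largest disc contain the circle.\<close>

lemma poisson_kernel_dyadic:
  assumes z: "z \<in> stolz_region \<zeta>\<^sub>0 a" and a: "a > 1" and \<zeta>0: "norm \<zeta>\<^sub>0 = 1" and \<zeta>: "norm \<zeta> = 1"
    and J: "2 \<le> 2 ^ J * (2 * a * (1 - norm z))"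
  shows "poisson_kernel z \<zeta> \<le> (\<Sum>j\<le>J. 8 / (1 - norm z) * (1 / 4) ^ j *
      indicator (cball \<zeta>\<^sub>0 (2 ^ j * (2 * a * (1 - norm z)))) \<zeta>)"
proof -
  define d where "d = 1 - norm z"
  define R where "R = (\<lambda>j::nat. 2 ^ j * (2 * a * d))"
  have z1: "norm z < 1" and zs: "norm (z - \<zeta>\<^sub>0) < a * d"
    using z by (auto simp: stolz_region_def d_def)
  have d: "d > 0" using z1 by (simp add: d_def)
  have "norm (\<zeta> - \<zeta>\<^sub>0) \<le> R J"
    using norm_triangle_ineq4[of \<zeta> \<zeta>\<^sub>0] \<zeta> \<zeta>0 J by (simp add: R_def d_def)
  \<comment> \<open>The term that belongs to the smallest disc containing \<open>\<zeta>\<close> already dominates the kernel.\<close>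
  define j where "j = (LEAST j. norm (\<zeta> - \<zeta>\<^sub>0) \<le> R j)"
  have j: "norm (\<zeta> - \<zeta>\<^sub>0) \<le> R j"
    unfolding j_def by (rule LeastI) fact
  have jJ: "j \<le> J"
    unfolding j_def by (rule Least_le) fact
  have "poisson_kernel z \<zeta> \<le> 8 / d * (1 / 4) ^ j"
  proof (cases j)
    case 0
    have "poisson_kernel z \<zeta> \<le> 2 / d"
      using poisson_kernel_le_center[OF z1 \<zeta>] by (simp add: d_def)
    also have "\<dots> \<le> 8 / d" using d by (simp add: divide_right_mono)
    finally show ?thesis using 0 by simp
  next
    case (Suc i)
    then have i: "R i < norm (\<zeta> - \<zeta>\<^sub>0)"
      using not_less_Least[of i "\<lambda>j. norm (\<zeta> - \<zeta>\<^sub>0) \<le> R j"] by (simp add: j_def)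
    have "norm (\<zeta> - \<zeta>\<^sub>0) \<le> norm (\<zeta> - z) + norm (z - \<zeta>\<^sub>0)"
      using norm_triangle_ineq[of "\<zeta> - z" "z - \<zeta>\<^sub>0"] by simp
    moreover have "a * d \<le> R i / 2"
      using a d by (simp add: R_def)
    ultimately have "R i / 2 \<le> norm (\<zeta> - z)" using i zs by linarith
    moreover have "d * 2 ^ i \<le> R i / 2"
      using a d by (simp add: R_def)
    ultimately have "d * 2 ^ i \<le> norm (\<zeta> - z)" by linarith
    from poisson_kernel_le[OF z1 _ this] d
    have "poisson_kernel z \<zeta> \<le> 2 * d / (d * 2 ^ i)\<^sup>2" by (simp add: d_def)
    also have "\<dots> = 8 / d * (1 / 4) ^ j"
      using d by (simp add: Suc power2_eq_square power_mult_distrib[symmetric] power_divide divide_simps)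
    finally show ?thesis .
  qed
  also have "\<dots> = 8 / d * (1 / 4) ^ j * indicator (cball \<zeta>\<^sub>0 (R j)) \<zeta>"
    using j by (simp add: indicator_def dist_norm norm_minus_commute)
  also have "\<dots> \<le> (\<Sum>j\<le>J. 8 / d * (1 / 4) ^ j * indicator (cball \<zeta>\<^sub>0 (R j)) \<zeta>)"
    using jJ d by (intro member_le_sum) auto
  finally show ?thesis by (simp add: R_def d_def)
qed

lemma integrable_indicator_mult_circle:
  fixes f :: "complex \<Rightarrow> real"
  assumes "integrable \<mu> f" "A \<in> sets borel"
  shows "integrable \<mu> (\<lambda>\<zeta>. indicator A \<zeta> * f \<zeta>)"
  using integrable_circle_mult[OF assms(1), of "indicator A" 1] assms(2)
  by (simp add: measurable_circleI indicator_le_1)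

text \<open>The integrals over discs grow at most linearly in the radius, so the coefficients \<open>4\<^bsup>-j\<^esup>\<close> of the dyadic
  majorant leave a convergent geometric series with ratio \<open>1 / 2\<close>.\<close>

lemma poisson_integral_stolz_le:
  fixes f :: "complex \<Rightarrow> real"
  assumes f: "integrable \<mu> f" "\<And>\<zeta>. 0 \<le> f \<zeta>"
    and \<zeta>0: "norm \<zeta>\<^sub>0 = 1" and a: "a > 1" and z: "z \<in> stolz_region \<zeta>\<^sub>0 a"
    and growth: "\<And>\<delta>. \<delta> > 0 \<Longrightarrow> (\<integral>\<zeta>. indicator (cball \<zeta>\<^sub>0 \<delta>) \<zeta> * f \<zeta> \<partial>\<mu>) \<le> c * \<delta>"
  shows "poisson_integral f z \<le> 32 * a * c"
proof -
  define d where "d = 1 - norm z"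
  define R where "R = (\<lambda>j::nat. 2 ^ j * (2 * a * d))"
  have z1: "norm z < 1" using z by (auto simp: stolz_region_def)
  have d: "d > 0" using z1 by (simp add: d_def)
  have R: "R j > 0" for j using a d by (simp add: R_def)
  have c: "0 \<le> c"
  proof -
    have "0 \<le> (\<integral>\<zeta>. indicator (cball \<zeta>\<^sub>0 1) \<zeta> * f \<zeta> \<partial>\<mu>)"
      using f(2) by (intro Bochner_Integration.integral_nonneg) auto
    also have "\<dots> \<le> c * 1" by (rule growth) simp
    finally show ?thesis by simp
  qed
  obtain J where "2 / (2 * a * d) < 2 ^ J"
    using real_arch_pow[of 2 "2 / (2 * a * d)"] by auto
  then have J: "2 \<le> 2 ^ J * (2 * a * d)"
    using a d by (simp add: field_simps)
  have int: "integrable \<mu> (\<lambda>\<zeta>. indicator (cball \<zeta>\<^sub>0 r) \<zeta> * f \<zeta>)" for r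
    by (intro integrable_indicator_mult_circle f) auto
  have "poisson_integral f z \<le>
      (\<integral>\<zeta>. (\<Sum>j\<le>J. 8 / d * (1 / 4) ^ j * (indicator (cball \<zeta>\<^sub>0 (R j)) \<zeta> * f \<zeta>)) \<partial>\<mu>)"
    unfolding poisson_integral_def
  proof (rule integral_mono)
    show "integrable \<mu> (\<lambda>\<zeta>. poisson_kernel z \<zeta> *\<^sub>R f \<zeta>)"
      by (intro integrable_poisson f z1)
    show "integrable \<mu>
        (\<lambda>\<zeta>. \<Sum>j\<le>J. 8 / d * (1 / 4) ^ j * (indicator (cball \<zeta>\<^sub>0 (R j)) \<zeta> * f \<zeta>))"
      by (intro Bochner_Integration.integrable_sum integrable_mult_right int)
    fix \<zeta> :: complex assume "\<zeta> \<in> space \<mu>"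
    then have "poisson_kernel z \<zeta> \<le> (\<Sum>j\<le>J. 8 / d * (1 / 4) ^ j * indicator (cball \<zeta>\<^sub>0 (R j)) \<zeta>)"
      using poisson_kernel_dyadic[OF z a \<zeta>0, of \<zeta> J] J by (simp add: R_def d_def)
    then have "poisson_kernel z \<zeta> * f \<zeta> \<le>
        (\<Sum>j\<le>J. 8 / d * (1 / 4) ^ j * indicator (cball \<zeta>\<^sub>0 (R j)) \<zeta>) * f \<zeta>"
      by (intro mult_right_mono f)
    then show "poisson_kernel z \<zeta> *\<^sub>R f \<zeta> \<le>
        (\<Sum>j\<le>J. 8 / d * (1 / 4) ^ j * (indicator (cball \<zeta>\<^sub>0 (R j)) \<zeta> * f \<zeta>))"
      by (simp only: sum_distrib_right mult.assoc real_scaleR_def)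
  qed
  also have "\<dots> = (\<Sum>j\<le>J. 8 / d * (1 / 4) ^ j * (\<integral>\<zeta>. indicator (cball \<zeta>\<^sub>0 (R j)) \<zeta> * f \<zeta> \<partial>\<mu>))"
    by (subst Bochner_Integration.integral_sum) (auto intro!: integrable_mult_right int)
  also have "\<dots> \<le> (\<Sum>j\<le>J. 8 / d * (1 / 4) ^ j * (c * R j))"
    using d R by (intro sum_mono mult_left_mono growth) auto
  also have "\<dots> = 16 * a * c * (\<Sum>j\<le>J. (1 / 2) ^ j)"
  proof -
    have "8 / d * (1 / 4) ^ j * (c * R j) = 16 * a * c * (1 / 2) ^ j" for j
    proof -
      have "(1 / 4 :: real) ^ j * 2 ^ j = (1 / 2) ^ j"
        by (simp flip: power_mult_distrib)
      moreover have "8 / d * (1 / 4) ^ j * (c * R j) = 16 * a * c * ((1 / 4) ^ j * 2 ^ j)"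
        using d by (simp add: R_def)
      ultimately show ?thesis by simp
    qed
    then show ?thesis by (simp add: sum_distrib_left)
  qed
  also have "\<dots> \<le> 16 * a * c * 2"
    using geometric_sum_less[of "1 / 2 :: real" "{..J}"] a c by (intro mult_left_mono) auto
  finally show ?thesis by simp
qed

text \<open>By Vitali's covering lemma the set where some average exceeds \<open>c\<close> is covered by the fivefold
  enlargements of disjoint discs, over each of which \<open>f\<close> has a large integral. The constant 10 is
  the factor 2 in \<open>measure_circle_cball\<close> times 5.\<close>

lemma maximal_function_weak_type:
  fixes f :: "complex \<Rightarrow> real"
  assumes f: "integrable \<mu> f" "\<And>\<zeta>. 0 \<le> f \<zeta>" and c: "c > 0"
  obtains E where "E \<in> sets \<mu>"
    "emeasure \<mu> E \<le> ennreal (10 / c * (\<integral>\<zeta>. f \<zeta> \<partial>\<mu>))"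
    "\<And>\<zeta>\<^sub>0 \<delta>. norm \<zeta>\<^sub>0 = 1 \<Longrightarrow> \<zeta>\<^sub>0 \<notin> E \<Longrightarrow> \<delta> > 0 \<Longrightarrow>
       (\<integral>\<zeta>. indicator (cball \<zeta>\<^sub>0 \<delta>) \<zeta> * f \<zeta> \<partial>\<mu>) \<le> c * \<delta>"
proof -
  define m where "m = (\<lambda>\<zeta>\<^sub>0 \<delta>. \<integral>\<zeta>. indicator (cball \<zeta>\<^sub>0 \<delta>) \<zeta> * f \<zeta> \<partial>\<mu>)"
  define K where "K = {\<zeta>\<^sub>0. norm \<zeta>\<^sub>0 = 1 \<and> (\<exists>\<delta>>0. m \<zeta>\<^sub>0 \<delta> > c * \<delta>)}"
  define r where "r = (\<lambda>\<zeta>\<^sub>0. SOME \<delta>. \<delta> > 0 \<and> m \<zeta>\<^sub>0 \<delta> > c * \<delta>)"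
  have r: "r x > 0 \<and> m x (r x) > c * r x" if "x \<in> K" for x
    unfolding r_def by (rule someI_ex) (use that in \<open>auto simp: K_def\<close>)
  have int: "integrable \<mu> (\<lambda>\<zeta>. indicator (cball x r) \<zeta> * f \<zeta>)" for x r
    by (intro integrable_indicator_mult_circle f) auto
  have mle: "m x \<delta> \<le> (\<integral>\<zeta>. f \<zeta> \<partial>\<mu>)" for x \<delta>
    unfolding m_def using f(2) by (intro integral_mono int f) (auto simp: indicator_def)
  define I where "I = (\<integral>\<zeta>. f \<zeta> \<partial>\<mu>)"
  have r_bound: "0 < r x \<and> r x \<le> I / c" if "x \<in> K" for x
  proof -
    have "c * r x \<le> I" using r[OF that] mle[of x "r x"] by (simp add: I_def)
    then show ?thesis using r[OF that] c by (simp add: field_simps)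
  qed
  have cover: "K \<subseteq> (\<Union>x\<in>K. cball x (r x))"
    using r by (force simp: less_imp_le)
  obtain C where C: "countable C" "C \<subseteq> K"
    "pairwise (\<lambda>i j. disjnt (cball i (r i)) (cball j (r j))) C"
    "K \<subseteq> (\<Union>i\<in>C. cball i (5 * r i))"
    by (rule Vitali_covering_lemma_cballs[OF cover r_bound])
  define X where "X = (\<lambda>i. cball i (5 * r i) \<inter> sphere 0 1)"
  define Y where "Y = (\<lambda>i. cball i (r i) \<inter> sphere 0 1)"
  define D where "D = density \<mu> (\<lambda>\<zeta>. ennreal (f \<zeta>))"
  have X: "X i \<in> sets \<mu>" and Y: "Y i \<in> sets \<mu>" for i
    by (auto simp: X_def Y_def sets_circleI)
  have fm: "(\<lambda>\<zeta>. ennreal (f \<zeta>)) \<in> borel_measurable \<mu>"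
    using f by auto
  have emD: "emeasure D (Y i) = ennreal (m i (r i))" for i
  proof -
    have "emeasure D (Y i) = (\<integral>\<^sup>+\<zeta>. ennreal (f \<zeta>) * indicator (Y i) \<zeta> \<partial>\<mu>)"
      unfolding D_def by (rule emeasure_density[OF fm Y])
    also have "\<dots> = (\<integral>\<^sup>+\<zeta>. ennreal (indicator (cball i (r i)) \<zeta> * f \<zeta>) \<partial>\<mu>)"
      by (intro nn_integral_cong) (auto simp: Y_def indicator_def)
    also have "\<dots> = ennreal (m i (r i))"
      unfolding m_def using f(2) by (intro nn_integral_eq_integral int) auto
    finally show ?thesis .
  qed
  show ?thesis
  proof (rule that[of "\<Union>i\<in>C. X i"])
    show "(\<Union>i\<in>C. X i) \<in> sets \<mu>"
      using C(1) X by auto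
    have "emeasure \<mu> (\<Union>i\<in>C. X i) =
        (\<integral>\<^sup>+\<zeta>. indicator (\<Union>i\<in>C. X i) \<zeta> \<partial>\<mu>)"
      using C(1) X by (subst nn_integral_indicator) auto
    also have "\<dots> \<le> (\<integral>\<^sup>+\<zeta>. (\<integral>\<^sup>+i. indicator (X i) \<zeta> \<partial>count_space C) \<partial>\<mu>)"
    proof (rule nn_integral_mono)
      fix \<zeta>
      show "indicator (\<Union>i\<in>C. X i) \<zeta> \<le> (\<integral>\<^sup>+i. indicator (X i) \<zeta> \<partial>count_space C :: ennreal)"
      proof (cases "\<zeta> \<in> (\<Union>i\<in>C. X i)")
        case True
        then obtain i where i: "i \<in> C" "\<zeta> \<in> X i" by auto
        have "1 = (\<integral>\<^sup>+j. indicator {i} j \<partial>count_space C :: ennreal)"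
          using i by (subst nn_integral_indicator) auto
        also have "\<dots> \<le> (\<integral>\<^sup>+i. indicator (X i) \<zeta> \<partial>count_space C)"
          using i by (intro nn_integral_mono) (auto simp: indicator_def)
        finally show ?thesis using True by simp
      qed simp
    qed
    also have "\<dots> = (\<integral>\<^sup>+i. (\<integral>\<^sup>+\<zeta>. indicator (X i) \<zeta> \<partial>\<mu>) \<partial>count_space C)"
      using X by (intro nn_integral_count_space_nn_integral C) auto
    also have "\<dots> = (\<integral>\<^sup>+i. emeasure \<mu> (X i) \<partial>count_space C)"
      using X by (intro nn_integral_cong) simp
    also have "\<dots> \<le> (\<integral>\<^sup>+i. ennreal (10 / c) * emeasure D (Y i) \<partial>count_space C)"
    proof (rule nn_integral_mono)
      fix i assume "i \<in> space (count_space C)"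
      then have i: "i \<in> K" using C by auto
      then have "norm i = 1" by (simp add: K_def)
      then have "emeasure \<mu> (X i) \<le> ennreal (2 * (5 * r i))"
        unfolding X_def using r[OF i] by (intro measure_circle_cball) auto
      also have "2 * (5 * r i) \<le> 10 / c * m i (r i)"
        using r[OF i] c by (simp add: field_simps)
      then have "ennreal (2 * (5 * r i)) \<le> ennreal (10 / c) * emeasure D (Y i)"
        using c unfolding emD by (simp flip: ennreal_mult' add: ennreal_leI)
      finally show "emeasure \<mu> (X i) \<le> ennreal (10 / c) * emeasure D (Y i)" .
    qed
    also have "\<dots> = ennreal (10 / c) * (\<integral>\<^sup>+i. emeasure D (Y i) \<partial>count_space C)"
      by (rule nn_integral_cmult) auto
    also have "(\<integral>\<^sup>+i. emeasure D (Y i) \<partial>count_space C) = emeasure D (\<Union>i\<in>C. Y i)"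
    proof (rule emeasure_UN_countable[symmetric])
      show "disjoint_family_on Y C"
        using C(3) unfolding disjoint_family_on_def pairwise_def disjnt_def Y_def by blast
    qed (use Y C in \<open>auto simp: D_def\<close>)
    also have "\<dots> \<le> emeasure D (space D)"
      by (rule emeasure_space)
    also have "emeasure D (space D) = ennreal I"
    proof -
      have "emeasure D (space D) = (\<integral>\<^sup>+\<zeta>. ennreal (f \<zeta>) * indicator (space \<mu>) \<zeta> \<partial>\<mu>)"
        unfolding D_def using emeasure_density[OF fm sets.top] by simp
      also have "\<dots> = (\<integral>\<^sup>+\<zeta>. ennreal (f \<zeta>) \<partial>\<mu>)"
        by (intro nn_integral_cong) auto
      also have "\<dots> = ennreal I"
        unfolding I_def using f by (intro nn_integral_eq_integral) auto
      finally show ?thesis .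
    qed
    finally show "emeasure \<mu> (\<Union>i\<in>C. X i) \<le> ennreal (10 / c * (\<integral>\<zeta>. f \<zeta> \<partial>\<mu>))"
      using c by (simp add: I_def mult_left_mono flip: ennreal_mult')
    fix \<zeta>\<^sub>0 :: complex and \<delta> :: real
    assume "norm \<zeta>\<^sub>0 = 1" "\<zeta>\<^sub>0 \<notin> (\<Union>i\<in>C. X i)" "\<delta> > 0"
    then have "\<zeta>\<^sub>0 \<notin> K" using C(4) by (auto simp: X_def)
    then show "(\<integral>\<zeta>. indicator (cball \<zeta>\<^sub>0 \<delta>) \<zeta> * f \<zeta> \<partial>\<mu>) \<le> c * \<delta>"
      using \<open>norm \<zeta>\<^sub>0 = 1\<close> \<open>\<delta> > 0\<close> unfolding K_def m_def by (force simp: not_less)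
  qed
qed

text \<open>Outer and inner regularity enclose the set, up to small measure, between a compact set and an open
  set; Urysohn's lemma gives a continuous function between their indicators.\<close>

lemma circle_indicator_approx:
  assumes A: "A \<in> sets \<mu>" and e: "e > 0"
  obtains u :: "complex \<Rightarrow> real" where "continuous_on UNIV u" "\<And>x. 0 \<le> u x" "\<And>x. u x \<le> 1"
    "(\<integral>\<zeta>. \<bar>indicator A \<zeta> - u \<zeta>\<bar> \<partial>\<mu>) < e"
proof -
  define D where "D = distr circle_borel borel (\<lambda>x. x)"
  have idm: "(\<lambda>x. x) \<in> measurable circle_borel borel"
    by (rule measurable_circle_borelI) simp
  have D: "emeasure D B = emeasure \<mu> (B \<inter> sphere 0 1)" if "B \<in> sets borel" for B
    unfolding D_def using that
    by (subst emeasure_distr[OF idm]) (auto simp: circle_measure_eq sets_circle_borelI)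
  have setsD: "sets D = sets borel" by (simp add: D_def)
  have finD: "emeasure D (space D) \<noteq> \<infinity>"
  proof -
    have "emeasure D (space D) = emeasure D UNIV" by (simp add: D_def)
    also have "\<dots> = 1" by (simp add: D emeasure_circle_space)
    finally show ?thesis by simp
  qed
  interpret D: finite_measure D by standard (rule finD)
  obtain B N N' where B: "A = B \<union> N" "B \<in> sets circle_borel" "N \<subseteq> N'" "N' \<in> null_sets circle_borel"
    using A unfolding circle_measure_eq by (rule sets_completionE)
  obtain S where S: "S \<in> sets borel" "B = S \<inter> sphere 0 1"
    using B(2) unfolding sets_circle_borel by (auto simp: sets_restrict_space)
  have S_less: "emeasure D S < emeasure D S + ennreal (e / 4)"
    using e by (simp add: D.emeasure_eq_measure ennreal_less_iff flip: ennreal_plus)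
  have "\<exists>K. K \<subseteq> S \<and> compact K \<and> emeasure D S < emeasure D K + ennreal (e / 4)"
  proof -
    have "emeasure D S - ennreal (e/4) < emeasure D S \<or> emeasure D S = 0"
    proof (cases "measure D S = 0")
      case False
      then have "0 < measure D S" by (simp add: zero_less_measure_iff)
      then have "ennreal (measure D S - e / 4) < ennreal (measure D S)"
        using e by (intro ennreal_lessI) auto
      then show ?thesis using e by (simp add: D.emeasure_eq_measure ennreal_minus)
    qed (simp add: D.emeasure_eq_measure)
    then show ?thesis
    proof
      assume "emeasure D S = 0"
      then show ?thesis using e by (intro exI[of _ "{}"]) auto
    next
      assume "emeasure D S - ennreal (e/4) < emeasure D S"
      also have "emeasure D S = (SUP K \<in> {K. K \<subseteq> S \<and> compact K}. emeasure D K)"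
        by (rule inner_regular[OF setsD finD S(1)])
      finally obtain K where K: "K \<subseteq> S" "compact K" "emeasure D S - ennreal (e/4) < emeasure D K"
        by (auto simp: less_SUP_iff)
      have "measure D S < measure D K + e / 4"
      proof (cases "e / 4 \<le> measure D S")
        case True
        then show ?thesis
          using K(3) e by (simp add: D.emeasure_eq_measure ennreal_minus ennreal_less_iff)
      next
        case False
        then show ?thesis using measure_nonneg[of D K] by linarith
      qed
      then have "emeasure D S < emeasure D K + ennreal (e/4)"
        using e by (simp add: D.emeasure_eq_measure ennreal_less_iff flip: ennreal_plus)
      with K show ?thesis by auto
    qed
  qed
  then obtain K where K: "K \<subseteq> S" "compact K" "emeasure D S < emeasure D K + ennreal (e / 4)"
    by auto
  note S_less
  moreover have "emeasure D S = (INF U \<in> {U. S \<subseteq> U \<and> open U}. emeasure D U)"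
    by (rule outer_regular[OF setsD finD S(1)])
  ultimately obtain U where U: "S \<subseteq> U" "open U" "emeasure D U < emeasure D S + ennreal (e / 4)"
    by (metis (no_types, lifting) INF_less_iff mem_Collect_eq)
  have meas: "K \<in> sets D" "U \<in> sets D"
    using K U by (auto simp: setsD compact_imp_closed)
  have UK: "measure D (U - K) < e"
  proof -
    have "measure D S < measure D K + e / 4" "measure D U < measure D S + e / 4"
      using K(3) U(3) e by (simp_all add: D.emeasure_eq_measure ennreal_less_iff flip: ennreal_plus)
    moreover have "measure D (U - K) = measure D U - measure D K"
      using meas K U by (intro D.finite_measure_Diff) auto
    ultimately show ?thesis using e by simp
  qed
  have "closed K" "closed (- U)" "K \<inter> - U = {}"
    using K U compact_imp_closed by auto
  then obtain u :: "complex \<Rightarrow> real" where u: "continuous_on UNIV u"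
    "\<And>x. u x \<in> closed_segment 1 0" "\<And>x. x \<in> K \<Longrightarrow> u x = 1" "\<And>x. x \<in> - U \<Longrightarrow> u x = 0"
    using Urysohn[of K "- U" 1 "0::real"] by metis
  then have u01: "0 \<le> u x" "u x \<le> 1" for x
    using u(2)[of x] by (auto simp: closed_segment_eq_real_ivl)
  have UKs: "(U - K) \<inter> sphere 0 1 \<in> sets \<mu>"
    using K U by (intro sets_circleI) (auto simp: compact_imp_closed)
  have "N' \<in> null_sets \<mu>"
    using B(4) unfolding circle_measure_eq by (rule null_sets_completionI)
  then have "AE \<zeta> in \<mu>. \<zeta> \<notin> N'"
    by (rule AE_not_in)
  then have ae: "AE \<zeta> in \<mu>. \<bar>indicator A \<zeta> - u \<zeta>\<bar> \<le> indicator ((U - K) \<inter> sphere 0 1) \<zeta>"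
    using AE_space[of \<mu>]
  proof eventually_elim
    case (elim \<zeta>)
    have "\<zeta> \<in> A \<longleftrightarrow> \<zeta> \<in> S" using elim B S by auto
    then show ?case
      using elim K(1) U(1) u(3)[of \<zeta>] u(4)[of \<zeta>] u01[of \<zeta>] by (auto simp: indicator_def)
  qed
  have um: "u \<in> borel_measurable \<mu>"
    by (rule measurable_circle_continuous[OF continuous_on_subset[OF u(1) subset_UNIV]])
  have "(\<integral>\<zeta>. \<bar>indicator A \<zeta> - u \<zeta>\<bar> \<partial>\<mu>) \<le>
     (\<integral>\<zeta>. indicator ((U - K) \<inter> sphere 0 1) \<zeta> \<partial>\<mu>)"
  proof (rule integral_mono_AE[OF _ _ ae])
    show "integrable \<mu> (\<lambda>\<zeta>. \<bar>indicator A \<zeta> - u \<zeta>\<bar>)"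
      using A um u01 by (intro integrable_circle_bounded[where B = 1])
        (auto simp: indicator_def abs_le_iff intro: order_trans[OF u01(2)] order_trans[OF _ u01(1)])
    show "integrable \<mu> (indicator ((U - K) \<inter> sphere 0 1) :: _ \<Rightarrow> real)"
      using UKs by (intro integrable_circle_bounded[where B = 1]) (auto simp: indicator_def)
  qed
  also have "\<dots> = measure \<mu> ((U - K) \<inter> sphere 0 1)"
    by (simp add: Bochner_Integration.integral_indicator Int_assoc)
  also have "\<dots> = measure D (U - K)"
    using K U D[of "U - K"] by (simp add: measure_def compact_imp_closed)
  also note UK
  finally show ?thesis using u(1) u01 that by blast
qed

text \<open>Induction over integrable functions, starting from multiples of indicators.\<close>

lemma circle_L1_approx:
  fixes k :: "complex \<Rightarrow> 'a::{banach, second_countable_topology}"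
  assumes "integrable \<mu> k" "e > 0"
  shows "\<exists>c. continuous_on UNIV c \<and> (\<integral>\<zeta>. norm (k \<zeta> - c \<zeta>) \<partial>\<mu>) < e"
  using assms
proof (induction arbitrary: e rule: integrable_induct)
  case (base A v)
  define e' where "e' = e / (norm v + 1)"
  have e': "e' > 0" using base.prems by (simp add: e'_def add_nonneg_pos)
  obtain u :: "complex \<Rightarrow> real" where u: "continuous_on UNIV u" "\<And>x. 0 \<le> u x" "\<And>x. u x \<le> 1"
    "(\<integral>\<zeta>. \<bar>indicator A \<zeta> - u \<zeta>\<bar> \<partial>\<mu>) < e'"
    using circle_indicator_approx[OF base(1) e'] by blast
  have "(\<integral>\<zeta>. norm (indicator A \<zeta> *\<^sub>R v - u \<zeta> *\<^sub>R v) \<partial>\<mu>)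
      = (\<integral>\<zeta>. \<bar>indicator A \<zeta> - u \<zeta>\<bar> \<partial>\<mu>) * norm v"
    by (simp flip: scaleR_diff_left)
  also have "\<dots> \<le> e' * norm v"
    using u(4) by (intro mult_right_mono) auto
  also have "\<dots> < e' * (norm v + 1)" using e' by simp
  also have "\<dots> = e" by (simp add: e'_def add_nonneg_eq_0_iff)
  finally show ?case
    using u(1) by (intro exI[of _ "\<lambda>\<zeta>. u \<zeta> *\<^sub>R v"]) (auto intro!: continuous_intros)
next
  case (add f g)
  obtain c d where c: "continuous_on UNIV c" "(\<integral>\<zeta>. norm (f \<zeta> - c \<zeta>) \<partial>\<mu>) < e / 2"
    and d: "continuous_on UNIV d" "(\<integral>\<zeta>. norm (g \<zeta> - d \<zeta>) \<partial>\<mu>) < e / 2"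
    using add.IH(1)[of "e / 2"] add.IH(2)[of "e / 2"] add.prems by auto
  have int: "integrable \<mu> c" "integrable \<mu> d"
    by (rule integrable_circle_continuous[OF continuous_on_subset[OF _ subset_UNIV]], fact)+
  have "(\<integral>\<zeta>. norm (f \<zeta> + g \<zeta> - (c \<zeta> + d \<zeta>)) \<partial>\<mu>) \<le>
     (\<integral>\<zeta>. norm (f \<zeta> - c \<zeta>) + norm (g \<zeta> - d \<zeta>) \<partial>\<mu>)"
    using add.hyps int norm_triangle_ineq[of "f \<zeta> - c \<zeta>" "g \<zeta> - d \<zeta>" for \<zeta>]
    by (intro integral_mono) (auto simp: algebra_simps)
  also have "\<dots> < e"
    using add.hyps int c(2) d(2) by simp
  finally show ?case
    using c(1) d(1) by (intro exI[of _ "\<lambda>\<zeta>. c \<zeta> + d \<zeta>"]) (auto intro!: continuous_intros)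
next
  case (lim f s)
  have "(\<lambda>i. \<integral>\<zeta>. norm (f \<zeta> - s i \<zeta>) \<partial>\<mu>) \<longlonglongrightarrow> (\<integral>\<zeta>. 0 \<partial>\<mu>)"
  proof (rule integral_dominated_convergence[where w = "\<lambda>\<zeta>. 3 * norm (f \<zeta>)"])
    show "AE \<zeta> in \<mu>. (\<lambda>i. norm (f \<zeta> - s i \<zeta>)) \<longlonglongrightarrow> 0"
    proof (rule AE_I2)
      fix \<zeta> assume "\<zeta> \<in> space \<mu>"
      then have "(\<lambda>i. norm (f \<zeta> - s i \<zeta>)) \<longlonglongrightarrow> norm (f \<zeta> - f \<zeta>)"
        by (intro tendsto_intros lim.hyps)
      then show "(\<lambda>i. norm (f \<zeta> - s i \<zeta>)) \<longlonglongrightarrow> 0" by simp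
    qed
    show "AE \<zeta> in \<mu>. norm (norm (f \<zeta> - s i \<zeta>)) \<le> 3 * norm (f \<zeta>)" for i
    proof (rule AE_I2)
      fix \<zeta> assume "\<zeta> \<in> space \<mu>"
      then show "norm (norm (f \<zeta> - s i \<zeta>)) \<le> 3 * norm (f \<zeta>)"
        using lim.hyps(3)[of \<zeta> i] norm_triangle_ineq4[of "f \<zeta>" "s i \<zeta>"] by simp
    qed
  qed (use lim.hyps in auto)
  then have "\<forall>\<^sub>F i in sequentially. (\<integral>\<zeta>. norm (f \<zeta> - s i \<zeta>) \<partial>\<mu>) < e / 2"
    using lim.prems by (intro order_tendstoD(2)) auto
  then obtain i where i: "(\<integral>\<zeta>. norm (f \<zeta> - s i \<zeta>) \<partial>\<mu>) < e / 2"
    unfolding eventually_sequentially by auto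
  obtain c where c: "continuous_on UNIV c" "(\<integral>\<zeta>. norm (s i \<zeta> - c \<zeta>) \<partial>\<mu>) < e / 2"
    using lim.IH[of "e / 2" i] lim.prems by auto
  have int: "integrable \<mu> c"
    by (rule integrable_circle_continuous[OF continuous_on_subset[OF c(1) subset_UNIV]])
  have "(\<integral>\<zeta>. norm (f \<zeta> - c \<zeta>) \<partial>\<mu>) \<le>
     (\<integral>\<zeta>. norm (f \<zeta> - s i \<zeta>) + norm (s i \<zeta> - c \<zeta>) \<partial>\<mu>)"
    using lim.hyps int norm_triangle_ineq[of "f \<zeta> - s i \<zeta>" "s i \<zeta> - c \<zeta>" for \<zeta>]
    by (intro integral_mono) auto
  also have "\<dots> < e"
    using lim.hyps int c(2) i by simp
  finally show ?case using c(1) by blast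
qed

text \<open>The form in which weak type estimates yield statements almost everywhere. The set where \<open>Q\<close> fails
  need not be known to be measurable: it lies in the intersection of the sets \<open>E\<close>.\<close>

lemma AE_circle_small:
  assumes "\<And>\<eta>. \<eta> > 0 \<Longrightarrow> \<exists>E\<in>sets \<mu>. emeasure \<mu> E \<le> ennreal \<eta> \<and>
     (\<forall>\<zeta>. norm \<zeta> = 1 \<longrightarrow> \<zeta> \<notin> E \<longrightarrow> Q \<zeta>)"
  shows "AE \<zeta> in \<mu>. Q \<zeta>"
proof -
  have "\<forall>n. \<exists>E\<in>sets \<mu>. emeasure \<mu> E \<le> ennreal (1 / real (Suc n)) \<and>
     (\<forall>\<zeta>. norm \<zeta> = 1 \<longrightarrow> \<zeta> \<notin> E \<longrightarrow> Q \<zeta>)"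
    using assms by simp
  then obtain E where E: "\<And>n. E n \<in> sets \<mu>"
    "\<And>n. emeasure \<mu> (E n) \<le> ennreal (1 / real (Suc n))"
    "\<And>n \<zeta>. norm \<zeta> = 1 \<Longrightarrow> \<zeta> \<notin> E n \<Longrightarrow> Q \<zeta>"
    by metis
  define N where "N = (\<Inter>n. E n)"
  have N: "N \<in> sets \<mu>" unfolding N_def using E(1) by auto
  have "emeasure \<mu> N = 0"
  proof (rule ccontr)
    assume "emeasure \<mu> N \<noteq> 0"
    then have pos: "measure \<mu> N > 0"
      by (simp add: circle.emeasure_eq_measure zero_less_measure_iff)
    then obtain n where n: "1 / real (Suc n) < measure \<mu> N"
      using nat_approx_posE by blast
    have "emeasure \<mu> N \<le> emeasure \<mu> (E n)"
      using E(1) by (intro emeasure_mono) (auto simp: N_def)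
    also note E(2)[of n]
    finally have "measure \<mu> N \<le> 1 / real (Suc n)"
      by (simp add: circle.emeasure_eq_measure)
    with n show False by simp
  qed
  with N have "N \<in> null_sets \<mu>" by auto
  then show ?thesis
    by (rule AE_I') (use E(3) in \<open>auto simp: N_def\<close>)
qed

text \<open>Fatou's theorem. For a continuous function \<open>c\<close> the limit exists everywhere. If \<open>c\<close> is close to \<open>k\<close>
  in the mean, then outside a set of small measure both \<open>k - c\<close> (by Markov's inequality) and the
  Poisson integral of \<open>k - c\<close> on the Stolz region (by the weak type estimate) are small.\<close>

theorem poisson_integral_angular_limit:
  fixes k :: "complex \<Rightarrow> 'a::{banach, second_countable_topology}"
  assumes k: "integrable \<mu> k"
  shows "AE \<zeta> in \<mu>. \<forall>a>1. (poisson_integral k \<longlongrightarrow> k \<zeta>) (at \<zeta> within stolz_region \<zeta> a)"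
proof -
  have main: "AE \<zeta> in \<mu>.
      eventually (\<lambda>z. dist (poisson_integral k z) (k \<zeta>) < e) (at \<zeta> within stolz_region \<zeta> a)"
    if a: "a > 1" and e: "e > 0" for a e
  proof (rule AE_circle_small)
    fix \<eta> :: real assume \<eta>: "\<eta> > 0"
    \<comment> \<open>With this level the bound \<open>32 a c\<^sub>1\<close> from \<open>poisson_integral_stolz_le\<close> equals \<open>e / 4\<close>.\<close>
    define c1 where "c1 = e / 4 / (32 * a)"
    have c1: "c1 > 0" using a e by (simp add: c1_def)
    define \<theta> where "\<theta> = min (\<eta> / 2 * c1 / 10) (\<eta> / 2 * (e / 4))"
    have \<theta>: "\<theta> > 0" "10 / c1 * \<theta> \<le> \<eta> / 2" "1 / (e / 4) * \<theta> \<le> \<eta> / 2"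
      using \<eta> e c1 by (auto simp: \<theta>_def min_def field_simps)
    obtain c where c: "continuous_on UNIV c" "(\<integral>\<zeta>. norm (k \<zeta> - c \<zeta>) \<partial>\<mu>) < \<theta>"
      using circle_L1_approx[OF k \<theta>(1)] by blast
    have cc: "continuous_on (sphere 0 1) c" using c(1) by (rule continuous_on_subset) simp
    have ic: "integrable \<mu> c" using cc by (rule integrable_circle_continuous)
    define f where "f = (\<lambda>\<zeta>. norm (k \<zeta> - c \<zeta>))"
    have f: "integrable \<mu> f" "\<And>\<zeta>. 0 \<le> f \<zeta>"
      using k ic by (auto simp: f_def)
    obtain E1 where E1: "E1 \<in> sets \<mu>"
      "emeasure \<mu> E1 \<le> ennreal (10 / c1 * (\<integral>\<zeta>. f \<zeta> \<partial>\<mu>))"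
      "\<And>\<zeta>\<^sub>0 \<delta>. norm \<zeta>\<^sub>0 = 1 \<Longrightarrow> \<zeta>\<^sub>0 \<notin> E1 \<Longrightarrow> \<delta> > 0 \<Longrightarrow>
         (\<integral>\<zeta>. indicator (cball \<zeta>\<^sub>0 \<delta>) \<zeta> * f \<zeta> \<partial>\<mu>) \<le> c1 * \<delta>"
      using maximal_function_weak_type[OF f c1] by blast
    define E2 where "E2 = {\<zeta> \<in> space \<mu>. f \<zeta> \<ge> e / 4}"
    have fm: "f \<in> borel_measurable \<mu>" using f by auto
    have E2: "E2 \<in> sets \<mu>" unfolding E2_def using fm by measurable
    have "emeasure \<mu> E2 \<le> ennreal (1 / (e / 4) * (\<integral>\<zeta>. f \<zeta> \<partial>\<mu>))"
      unfolding E2_def using f e by (intro integral_Markov_inequality) auto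
    also have "1 / (e / 4) * (\<integral>\<zeta>. f \<zeta> \<partial>\<mu>) \<le> 1 / (e / 4) * \<theta>"
      using c(2) e by (intro mult_left_mono) (auto simp: f_def)
    also note \<theta>(3)
    finally have E2m: "emeasure \<mu> E2 \<le> ennreal (\<eta> / 2)"
      by (simp add: ennreal_leI)
    have "10 / c1 * (\<integral>\<zeta>. f \<zeta> \<partial>\<mu>) \<le> 10 / c1 * \<theta>"
      using c(2) c1 by (intro mult_left_mono) (auto simp: f_def)
    with \<theta>(2) have "10 / c1 * (\<integral>\<zeta>. f \<zeta> \<partial>\<mu>) \<le> \<eta> / 2" by linarith
    with E1(2) have E1m: "emeasure \<mu> E1 \<le> ennreal (\<eta> / 2)"
      by (meson ennreal_leI order_trans)
    show "\<exists>E\<in>sets \<mu>. emeasure \<mu> E \<le> ennreal \<eta> \<and>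
       (\<forall>\<zeta>. norm \<zeta> = 1 \<longrightarrow> \<zeta> \<notin> E \<longrightarrow>
        (\<forall>\<^sub>F z in at \<zeta> within stolz_region \<zeta> a. dist (poisson_integral k z) (k \<zeta>) < e))"
    proof (intro bexI[of _ "E1 \<union> E2"] conjI allI impI)
      have "emeasure \<mu> (E1 \<union> E2) \<le> ennreal (\<eta> / 2) + ennreal (\<eta> / 2)"
        using emeasure_subadditive[OF E1(1) E2] E1m E2m by (meson add_mono order_trans)
      also have "\<dots> = ennreal \<eta>" using \<eta> by (simp flip: ennreal_plus)
      finally show "emeasure \<mu> (E1 \<union> E2) \<le> ennreal \<eta>" .
      fix \<zeta> :: complex assume \<zeta>: "norm \<zeta> = 1" "\<zeta> \<notin> E1 \<union> E2"
      then have fz: "norm (k \<zeta> - c \<zeta>) < e / 4"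
        by (auto simp: E2_def f_def)
      have sub: "stolz_region \<zeta> a \<subseteq> ball 0 1" by (auto simp: stolz_region_def)
      have "(poisson_integral c \<longlongrightarrow> c \<zeta>) (at \<zeta> within stolz_region \<zeta> a)"
        using poisson_integral_continuous_boundary[OF cc \<zeta>(1)] sub by (rule tendsto_within_subset)
      then have "eventually (\<lambda>z. dist (poisson_integral c z) (c \<zeta>) < e / 4) (at \<zeta> within stolz_region \<zeta> a)"
        using e by (intro tendstoD) auto
      moreover have "eventually (\<lambda>z. z \<in> stolz_region \<zeta> a) (at \<zeta> within stolz_region \<zeta> a)"
        by (simp add: eventually_at_filter)
      ultimately show "\<forall>\<^sub>F z in at \<zeta> within stolz_region \<zeta> a. dist (poisson_integral k z) (k \<zeta>) < e"
      proof eventually_elim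
        case (elim z)
        then have z: "norm z < 1" using sub by auto
        have "norm (poisson_integral k z - poisson_integral c z) = norm (poisson_integral (\<lambda>\<zeta>. k \<zeta> - c \<zeta>) z)"
          by (simp add: poisson_integral_diff[OF k ic z])
        also have "\<dots> \<le> poisson_integral f z"
          unfolding f_def using k ic z by (intro norm_poisson_integral_le) auto
        also have "\<dots> \<le> 32 * a * c1"
          using elim \<zeta> by (intro poisson_integral_stolz_le[OF f \<zeta>(1) a] E1(3)) auto
        also have "\<dots> = e / 4" using a by (simp add: c1_def)
        finally have "norm (poisson_integral k z - poisson_integral c z) \<le> e / 4" .
        moreover have "norm (poisson_integral k z - k \<zeta>) \<le>
           norm (poisson_integral k z - poisson_integral c z) + norm (poisson_integral c z - c \<zeta>) + norm (c \<zeta> - k \<zeta>)"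
          using norm_triangle_ineq[of "poisson_integral k z - poisson_integral c z" "poisson_integral c z - c \<zeta>"]
            norm_triangle_ineq[of "poisson_integral k z - c \<zeta>" "c \<zeta> - k \<zeta>"] by simp
        ultimately show ?case using elim fz e by (simp add: dist_norm norm_minus_commute)
      qed
    qed (use E1(1) E2 in auto)
  qed
  have "AE \<zeta> in \<mu>. \<forall>n m :: nat. eventually (\<lambda>z. dist (poisson_integral k z) (k \<zeta>) < 1 / real (Suc m))
      (at \<zeta> within stolz_region \<zeta> (real n + 2))"
    unfolding AE_all_countable by (intro allI main) auto
  then show ?thesis
  proof eventually_elim
    case (elim \<zeta>)
    show ?case
    proof (intro allI impI tendstoI)
      fix a e :: real assume a: "a > 1" and e: "0 < e"
      obtain n :: nat where n: "a \<le> real n" using real_arch_simple by blast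
      obtain m where m: "1 / real (Suc m) < e" using nat_approx_posE[OF e] by blast
      have "stolz_region \<zeta> a \<subseteq> stolz_region \<zeta> (real n + 2)"
      proof
        fix z assume "z \<in> stolz_region \<zeta> a"
        moreover from this have "a * (1 - norm z) \<le> (real n + 2) * (1 - norm z)"
          using n by (intro mult_right_mono) (auto simp: stolz_region_def)
        ultimately show "z \<in> stolz_region \<zeta> (real n + 2)"
          by (auto simp: stolz_region_def intro: less_le_trans)
      qed
      then have "at \<zeta> within stolz_region \<zeta> a \<le> at \<zeta> within stolz_region \<zeta> (real n + 2)"
        by (rule at_le)
      moreover have "eventually (\<lambda>z. dist (poisson_integral k z) (k \<zeta>) < 1 / real (Suc m))
        (at \<zeta> within stolz_region \<zeta> (real n + 2))" using elim by blast
      ultimately have "eventually (\<lambda>z. dist (poisson_integral k z) (k \<zeta>) < 1 / real (Suc m))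
        (at \<zeta> within stolz_region \<zeta> a)" by (rule filter_leD)
      then show "eventually (\<lambda>z. dist (poisson_integral k z) (k \<zeta>) < e) (at \<zeta> within stolz_region \<zeta> a)"
        by eventually_elim (use m in simp)
    qed
  qed
qed

section \<open>Angular limits\<close>

text \<open>The radius ends inside every Stolz region with aperture above one. Angular limits thus force radial
  limits, which live on a filter that is not trivial and are therefore unique.\<close>

lemma filterlim_radius_stolz:
  assumes "norm \<zeta> = 1" "a > 1"
  shows "filterlim (\<lambda>r. of_real r * \<zeta>) (at \<zeta> within stolz_region \<zeta> a) (at_left 1)"
proof -
  have ev: "eventually (\<lambda>r. r \<in> {0<..<1::real}) (at_left 1)"
    by (rule eventually_at_leftI[of 0]) auto
  have "((\<lambda>r. of_real r * \<zeta>) \<longlongrightarrow> of_real 1 * \<zeta>) (at_left 1)"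
    by (intro tendsto_intros)
  moreover have "eventually (\<lambda>r. of_real r * \<zeta> \<in> stolz_region \<zeta> a \<and> of_real r * \<zeta> \<noteq> \<zeta>) (at_left 1)"
    using ev
  proof eventually_elim
    case (elim r)
    have "of_real r * \<zeta> - \<zeta> = of_real (r - 1) * \<zeta>" by (simp add: algebra_simps)
    then have "norm (of_real r * \<zeta> - \<zeta>) = 1 - r"
      using elim assms by (simp add: norm_mult del: of_real_diff)
    then show ?case
      using elim assms by (auto simp: stolz_region_def norm_mult)
  qed
  ultimately show ?thesis
    unfolding filterlim_at by (auto elim: eventually_mono)
qed

lemma has_angular_limit_radial:
  assumes "has_angular_limit f \<zeta> w" "norm \<zeta> = 1"
  shows "((\<lambda>r. f (of_real r * \<zeta>)) \<longlongrightarrow> w) (at_left 1)"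
proof -
  have "(f \<longlongrightarrow> w) (at \<zeta> within stolz_region \<zeta> 2)"
    using assms(1) by (simp add: has_angular_limit_def)
  then show ?thesis
    by (rule filterlim_compose) (rule filterlim_radius_stolz[OF assms(2)], simp)
qed

lemma has_angular_limit_unique:
  assumes "has_angular_limit f \<zeta> v" "has_angular_limit f \<zeta> w" "norm \<zeta> = 1"
  shows "v = w"
  using tendsto_unique[OF _ has_angular_limit_radial[OF assms(1,3)] has_angular_limit_radial[OF assms(2,3)]]
  by simp

lemma boundary_value_eq:
  assumes "has_angular_limit f \<zeta> w" "norm \<zeta> = 1"
  shows "boundary_value f \<zeta> = w"
  unfolding boundary_value_def
  by (rule the_equality) (use assms has_angular_limit_unique in blast)+

lemma has_angular_limit_cong:
  assumes "\<And>z. norm z < 1 \<Longrightarrow> f z = g z" "has_angular_limit f \<zeta> w"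
  shows "has_angular_limit g \<zeta> w"
  unfolding has_angular_limit_def
proof (intro allI impI)
  fix a :: real assume "a > 1"
  then have "(f \<longlongrightarrow> w) (at \<zeta> within stolz_region \<zeta> a)"
    using assms(2) by (simp add: has_angular_limit_def)
  moreover have "eventually (\<lambda>z. f z = g z) (at \<zeta> within stolz_region \<zeta> a)"
    unfolding eventually_at_filter
    by (rule always_eventually) (auto simp: stolz_region_def assms(1))
  ultimately show "(g \<longlongrightarrow> w) (at \<zeta> within stolz_region \<zeta> a)"
    using tendsto_cong by force
qed

lemma has_angular_limit_const: "has_angular_limit (\<lambda>z. c) \<zeta> c"
  by (simp add: has_angular_limit_def)

lemma has_angular_limit_mult:
  "has_angular_limit f \<zeta> v \<Longrightarrow> has_angular_limit g \<zeta> w \<Longrightarrow> has_angular_limit (\<lambda>z. f z * g z) \<zeta> (v * w)"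
  by (auto simp: has_angular_limit_def intro!: tendsto_mult)

lemma has_angular_limit_divide:
  "has_angular_limit f \<zeta> v \<Longrightarrow> has_angular_limit g \<zeta> w \<Longrightarrow> w \<noteq> 0 \<Longrightarrow>
    has_angular_limit (\<lambda>z. f z / g z) \<zeta> (v / w)"
  by (auto simp: has_angular_limit_def intro!: tendsto_divide)

lemma AE_circle_boundary_unique:
  assumes "AE \<zeta> in \<mu>. has_angular_limit f \<zeta> (\<phi> \<zeta>)"
    and "AE \<zeta> in \<mu>. has_angular_limit f \<zeta> (\<psi> \<zeta>)"
  shows "AE \<zeta> in \<mu>. \<phi> \<zeta> = \<psi> \<zeta>"
  using assms AE_circle_norm by eventually_elim (rule has_angular_limit_unique)

section \<open>The space \<open>H\<^sup>2\<close>\<close>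

text \<open>Fatou's lemma for Bochner integrals with uniformly bounded values; the source of all statements that
  a boundary function is integrable.\<close>

lemma integrable_fatou:
  fixes u :: "nat \<Rightarrow> 'a \<Rightarrow> real"
  assumes int: "\<And>j. integrable M (u j)" and nonneg: "\<And>j. AE x in M. 0 \<le> u j x"
    and lim: "AE x in M. (\<lambda>j. u j x) \<longlonglongrightarrow> v x" and v: "v \<in> borel_measurable M"
    and bound: "\<And>j. (\<integral>x. u j x \<partial>M) \<le> C"
  shows "integrable M v" "(\<integral>x. v x \<partial>M) \<le> C"
proof -
  have nonneg': "AE x in M. \<forall>j. 0 \<le> u j x"
    using nonneg by (simp add: AE_all_countable)
  have v0: "AE x in M. 0 \<le> v x"
    using nonneg' lim by eventually_elim (auto intro: LIMSEQ_le_const)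
  have C: "0 \<le> C"
    using integral_nonneg_AE[OF nonneg[of 0]] bound[of 0] by linarith
  have "(\<integral>\<^sup>+x. ennreal (v x) \<partial>M) = (\<integral>\<^sup>+x. liminf (\<lambda>j. ennreal (u j x)) \<partial>M)"
  proof (rule nn_integral_cong_AE)
    show "AE x in M. ennreal (v x) = liminf (\<lambda>j. ennreal (u j x))"
      using lim
    proof eventually_elim
      case (elim x)
      then have "(\<lambda>j. ennreal (u j x)) \<longlonglongrightarrow> ennreal (v x)"
        by (rule tendsto_ennrealI)
      then show ?case by (simp add: lim_imp_Liminf)
    qed
  qed
  also have "\<dots> \<le> liminf (\<lambda>j. \<integral>\<^sup>+x. ennreal (u j x) \<partial>M)"
    using int by (intro nn_integral_liminf) auto
  also have "\<dots> \<le> liminf (\<lambda>j. ennreal C)"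
  proof (rule Liminf_mono, rule always_eventually, rule allI)
    fix j
    have "(\<integral>\<^sup>+x. ennreal (u j x) \<partial>M) = ennreal (\<integral>x. u j x \<partial>M)"
      by (rule nn_integral_eq_integral[OF int nonneg])
    then show "(\<integral>\<^sup>+x. ennreal (u j x) \<partial>M) \<le> ennreal C"
      using bound[of j] by (simp add: ennreal_leI)
  qed
  also have "\<dots> = ennreal C"
    by (rule lim_imp_Liminf) simp_all
  finally have *: "(\<integral>\<^sup>+x. ennreal (v x) \<partial>M) \<le> ennreal C" .
  then show vint: "integrable M v"
    by (intro integrableI_nonneg[OF v v0] order.strict_trans1[OF *]) simp
  have "ennreal (\<integral>x. v x \<partial>M) \<le> ennreal C"
    using * nn_integral_eq_integral[OF vint v0] by simp
  then show "(\<integral>x. v x \<partial>M) \<le> C"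
    using C by simp
qed

text \<open>Termwise integration of an absolutely convergent Fourier series against a continuous function. The
  coefficient formulas and Parseval's identity are special cases.\<close>

lemma circle_series_integral_sums:
  assumes b: "summable (\<lambda>n. norm (b n))"
    and F: "\<And>\<zeta>. norm \<zeta> = 1 \<Longrightarrow> (\<lambda>n. b n * \<zeta> ^ n) sums F \<zeta>"
    and h: "continuous_on (sphere 0 1) h"
  shows "(\<lambda>n. b n * (\<integral>\<zeta>. \<zeta> ^ n * h \<zeta> \<partial>\<mu>)) sums (\<integral>\<zeta>. F \<zeta> * h \<zeta> \<partial>\<mu>)"
proof -
  let ?f = "\<lambda>n \<zeta>. b n * (\<zeta> ^ n * h \<zeta>)"
  have "bounded (h ` sphere 0 1)"
    using h compact_continuous_image compact_imp_bounded compact_sphere by blast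
  then obtain B where B: "B > 0" "\<And>x. norm x = 1 \<Longrightarrow> norm (h x) \<le> B"
    unfolding bounded_pos by fastforce
  have int: "integrable \<mu> (?f n)" for n
    by (intro integrable_circle_continuous continuous_intros h)
  have le: "norm (?f n \<zeta>) \<le> norm (b n) * B" if "norm \<zeta> = 1" for n \<zeta>
    using B(2)[OF that] that by (simp add: norm_mult norm_power mult_left_mono)
  have sB: "summable (\<lambda>n. norm (b n) * B)"
    by (rule summable_mult2[OF b])
  have "(\<lambda>n. integral\<^sup>L \<mu> (?f n)) sums (\<integral>\<zeta>. (\<Sum>n. ?f n \<zeta>) \<partial>\<mu>)"
  proof (rule sums_integral[OF int])
    show "AE \<zeta> in \<mu>. summable (\<lambda>n. norm (?f n \<zeta>))"
    proof (rule AE_I2)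
      fix \<zeta> assume "\<zeta> \<in> space \<mu>"
      then show "summable (\<lambda>n. norm (?f n \<zeta>))"
        using le by (intro summable_comparison_test'[OF sB, where N = 0]) simp
    qed
    have "norm (\<integral>\<zeta>. norm (?f n \<zeta>) \<partial>\<mu>) \<le> norm (b n) * B" for n
    proof -
      have "(\<integral>\<zeta>. norm (?f n \<zeta>) \<partial>\<mu>) \<le> (\<integral>\<zeta>. norm (b n) * B \<partial>\<mu>)"
        using le int by (intro integral_mono integrable_norm) auto
      then show ?thesis by (simp add: integral_nonneg_AE)
    qed
    then show "summable (\<lambda>n. \<integral>\<zeta>. norm (?f n \<zeta>) \<partial>\<mu>)"
      by (intro summable_comparison_test'[OF sB, where N = 0])
  qed
  also have "(\<integral>\<zeta>. (\<Sum>n. ?f n \<zeta>) \<partial>\<mu>) = (\<integral>\<zeta>. F \<zeta> * h \<zeta> \<partial>\<mu>)"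
  proof (rule Bochner_Integration.integral_cong[OF refl])
    fix \<zeta> :: complex assume "\<zeta> \<in> space \<mu>"
    then have "(\<lambda>n. b n * \<zeta> ^ n * h \<zeta>) sums (F \<zeta> * h \<zeta>)"
      by (intro sums_mult2 F) simp
    then show "(\<Sum>n. ?f n \<zeta>) = F \<zeta> * h \<zeta>" by (simp add: sums_iff mult.assoc)
  qed
  finally show ?thesis by simp
qed

lemma circle_series_coeff:
  assumes b: "summable (\<lambda>n. norm (b n))"
    and F: "\<And>\<zeta>. norm \<zeta> = 1 \<Longrightarrow> (\<lambda>n. b n * \<zeta> ^ n) sums F \<zeta>"
  shows "(\<integral>\<zeta>. F \<zeta> * cnj \<zeta> ^ m \<partial>\<mu>) = b m"
    and "(\<integral>\<zeta>. F \<zeta> * \<zeta> ^ Suc m \<partial>\<mu>) = 0"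
proof -
  have "(\<lambda>n. b n * (\<integral>\<zeta>. \<zeta> ^ n * cnj \<zeta> ^ m \<partial>\<mu>)) sums (\<integral>\<zeta>. F \<zeta> * cnj \<zeta> ^ m \<partial>\<mu>)"
    by (rule circle_series_integral_sums[OF b F]) (auto intro!: continuous_intros)
  then have "(\<lambda>n. if n = m then b n else 0) sums (\<integral>\<zeta>. F \<zeta> * cnj \<zeta> ^ m \<partial>\<mu>)"
    unfolding integral_circle_monomial by (simp add: if_distrib cong: if_cong)
  then show "(\<integral>\<zeta>. F \<zeta> * cnj \<zeta> ^ m \<partial>\<mu>) = b m"
    using sums_unique2 sums_single by blast
  have "(\<lambda>n. b n * (\<integral>\<zeta>. \<zeta> ^ n * \<zeta> ^ Suc m \<partial>\<mu>)) sums (\<integral>\<zeta>. F \<zeta> * \<zeta> ^ Suc m \<partial>\<mu>)"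
    by (rule circle_series_integral_sums[OF b F]) (auto intro!: continuous_intros)
  then show "(\<integral>\<zeta>. F \<zeta> * \<zeta> ^ Suc m \<partial>\<mu>) = 0"
    unfolding power_add[symmetric] integral_circle_power by (simp add: sums_unique2)
qed

lemma circle_series_parseval:
  assumes b: "summable (\<lambda>n. norm (b n))"
    and F: "\<And>\<zeta>. norm \<zeta> = 1 \<Longrightarrow> (\<lambda>n. b n * \<zeta> ^ n) sums F \<zeta>"
    and cont: "continuous_on (sphere 0 1) F"
  shows "(\<lambda>n. (norm (b n))\<^sup>2) sums (\<integral>\<zeta>. (norm (F \<zeta>))\<^sup>2 \<partial>\<mu>)"
proof -
  have "(\<lambda>n. b n * (\<integral>\<zeta>. \<zeta> ^ n * cnj (F \<zeta>) \<partial>\<mu>)) sums (\<integral>\<zeta>. F \<zeta> * cnj (F \<zeta>) \<partial>\<mu>)"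
    by (rule circle_series_integral_sums[OF b F]) (auto intro!: continuous_intros cont)
  moreover have "(\<integral>\<zeta>. \<zeta> ^ n * cnj (F \<zeta>) \<partial>\<mu>) = cnj (b n)" for n
  proof -
    have "(\<integral>\<zeta>. \<zeta> ^ n * cnj (F \<zeta>) \<partial>\<mu>) = (\<integral>\<zeta>. cnj (F \<zeta> * cnj \<zeta> ^ n) \<partial>\<mu>)"
      by (simp add: mult.commute)
    also have "\<dots> = cnj (\<integral>\<zeta>. F \<zeta> * cnj \<zeta> ^ n \<partial>\<mu>)"
      by (rule Bochner_Integration.integral_cnj)
    finally show ?thesis using circle_series_coeff(1)[OF b F] by simp
  qed
  moreover have "(\<integral>\<zeta>. F \<zeta> * cnj (F \<zeta>) \<partial>\<mu>) = of_real (\<integral>\<zeta>. (norm (F \<zeta>))\<^sup>2 \<partial>\<mu>)"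
  proof -
    have "(\<integral>\<zeta>. F \<zeta> * cnj (F \<zeta>) \<partial>\<mu>) = (\<integral>\<zeta>. of_real ((norm (F \<zeta>))\<^sup>2) \<partial>\<mu>)"
      by (simp only: complex_norm_square)
    then show ?thesis by (simp only: integral_complex_of_real)
  qed
  ultimately have "(\<lambda>n. of_real ((norm (b n))\<^sup>2) :: complex) sums of_real (\<integral>\<zeta>. (norm (F \<zeta>))\<^sup>2 \<partial>\<mu>)"
    by (simp only: complex_norm_square)
  then show ?thesis by (simp only: sums_of_real_iff)
qed

definition taylor_coeff :: "(complex \<Rightarrow> complex) \<Rightarrow> nat \<Rightarrow> complex" where
  "taylor_coeff f n = (deriv ^^ n) f 0 / fact n"

lemma taylor_sums:
  assumes "f holomorphic_on ball 0 1" "norm z < 1"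
  shows "(\<lambda>n. taylor_coeff f n * z ^ n) sums f z"
  using holomorphic_power_series[OF assms(1), of z] assms(2) by (simp add: taylor_coeff_def)

lemma taylor_summable_norm:
  assumes f: "f holomorphic_on ball 0 1" and r: "0 \<le> r" "r < 1"
  shows "summable (\<lambda>n. norm (taylor_coeff f n * of_real r ^ n))"
proof -
  define s where "s = (r + 1) / 2"
  have s: "r < s" "s < 1" using r by (auto simp: s_def)
  have "summable (\<lambda>n. taylor_coeff f n * of_real s ^ n)"
    using taylor_sums[OF f, of "of_real s"] s r by (auto simp: sums_iff)
  then show ?thesis
    by (rule powser_insidea) (use s r in auto)
qed

lemma continuous_dilate:
  assumes "f holomorphic_on ball 0 1" "0 \<le> r" "r < 1"
  shows "continuous_on (sphere 0 1) (\<lambda>\<zeta>. f (of_real r * \<zeta>))"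
proof (rule continuous_on_compose2[OF holomorphic_on_imp_continuous_on[OF assms(1)]])
  show "(\<lambda>\<zeta>. of_real r * \<zeta> :: complex) ` sphere 0 1 \<subseteq> ball 0 1"
    using assms by (auto simp: norm_mult dist_norm)
qed (intro continuous_intros)

lemma dilate_sums:
  assumes "f holomorphic_on ball 0 1" "0 \<le> r" "r < 1" "norm \<zeta> = 1"
  shows "(\<lambda>n. taylor_coeff f n * of_real r ^ n * \<zeta> ^ n) sums f (of_real r * \<zeta>)"
  using taylor_sums[OF assms(1), of "of_real r * \<zeta>"] assms
  by (simp add: norm_mult power_mult_distrib mult.assoc)

lemma dilate_coeff:
  assumes "f holomorphic_on ball 0 1" "0 \<le> r" "r < 1"
  shows "(\<integral>\<zeta>. f (of_real r * \<zeta>) * cnj \<zeta> ^ n \<partial>\<mu>) = taylor_coeff f n * of_real r ^ n"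
    and "(\<integral>\<zeta>. f (of_real r * \<zeta>) * \<zeta> ^ Suc n \<partial>\<mu>) = 0"
  using circle_series_coeff[OF taylor_summable_norm[OF assms] dilate_sums[OF assms]] by auto

text \<open>The Poisson kernel is the sum of the Cauchy kernel and of the series of \<open>(cnj z)\<^sup>n \<zeta>\<^sup>n\<close> over
  \<open>n \<ge> 1\<close>; the hypothesis on the Fourier coefficients kills the latter.\<close>

lemma poisson_eq_cauchy_integral:
  assumes k: "integrable \<mu> k" and z: "norm z < 1"
    and coeff: "\<And>n. (\<integral>\<zeta>. k \<zeta> * \<zeta> ^ Suc n \<partial>\<mu>) = 0"
  shows "poisson_integral k z = cauchy_integral k z"
proof -
  have ck: "integrable \<mu> (\<lambda>\<zeta>. cnj (k \<zeta>))" using k by simp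
  have "(\<integral>\<zeta>. cnj (k \<zeta>) * cnj \<zeta> ^ n \<partial>\<mu>) * z ^ n =
      (if n = 0 then (\<integral>\<zeta>. cnj (k \<zeta>) \<partial>\<mu>) else 0)" for n
  proof (cases n)
    case (Suc m)
    have "(\<integral>\<zeta>. cnj (k \<zeta>) * cnj \<zeta> ^ n \<partial>\<mu>) = (\<integral>\<zeta>. cnj (k \<zeta> * \<zeta> ^ Suc m) \<partial>\<mu>)"
      by (simp add: Suc)
    also have "\<dots> = cnj (\<integral>\<zeta>. k \<zeta> * \<zeta> ^ Suc m \<partial>\<mu>)"
      by (rule Bochner_Integration.integral_cnj)
    finally show ?thesis using coeff[of m] Suc by simp
  qed simp
  then have "(\<lambda>n. if n = 0 then (\<integral>\<zeta>. cnj (k \<zeta>) \<partial>\<mu>) else 0) sums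
      cauchy_integral (\<lambda>\<zeta>. cnj (k \<zeta>)) z"
    using cauchy_integral_sums[OF ck z] by presburger
  then have "cauchy_integral (\<lambda>\<zeta>. cnj (k \<zeta>)) z = (\<integral>\<zeta>. cnj (k \<zeta>) \<partial>\<mu>)"
    using sums_single[of 0 "\<lambda>_. \<integral>\<zeta>. cnj (k \<zeta>) \<partial>\<mu>"] sums_unique2 by blast
  then have "cnj (cauchy_integral (\<lambda>\<zeta>. cnj (k \<zeta>)) z) = (\<integral>\<zeta>. k \<zeta> \<partial>\<mu>)"
    by simp
  then have anti: "(\<integral>\<zeta>. k \<zeta> / cnj (1 - z * cnj \<zeta>) \<partial>\<mu>) = (\<integral>\<zeta>. k \<zeta> \<partial>\<mu>)"
    unfolding cauchy_integral_def by (simp flip: Bochner_Integration.integral_cnj)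
  have int2: "integrable \<mu> (\<lambda>\<zeta>. k \<zeta> / cnj (1 - z * cnj \<zeta>))"
    using integrable_cnj[OF integrable_cauchy[OF ck z]] by simp
  have "poisson_integral k z = (\<integral>\<zeta>. k \<zeta> / (1 - z * cnj \<zeta>) + (k \<zeta> / cnj (1 - z * cnj \<zeta>) - k \<zeta>) \<partial>\<mu>)"
    unfolding poisson_integral_def
  proof (rule Bochner_Integration.integral_cong[OF refl])
    fix \<zeta> :: complex assume "\<zeta> \<in> space \<mu>"
    then have \<zeta>: "norm \<zeta> = 1" by simp
    have eq: "of_real (poisson_kernel z \<zeta>) = 1 / (1 - z * cnj \<zeta>) + cnj (1 / (1 - z * cnj \<zeta>)) - 1"
      unfolding poisson_kernel_cauchy[OF z \<zeta>] complex_add_cnj by simp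
    show "poisson_kernel z \<zeta> *\<^sub>R k \<zeta> = k \<zeta> / (1 - z * cnj \<zeta>) + (k \<zeta> / cnj (1 - z * cnj \<zeta>) - k \<zeta>)"
      unfolding scaleR_conv_of_real eq by (simp add: algebra_simps)
  qed
  also have "\<dots> = cauchy_integral k z + ((\<integral>\<zeta>. k \<zeta> / cnj (1 - z * cnj \<zeta>) \<partial>\<mu>) - (\<integral>\<zeta>. k \<zeta> \<partial>\<mu>))"
    unfolding cauchy_integral_def
    using integrable_cauchy[OF k z] int2 k
    by (simp only: Bochner_Integration.integral_add Bochner_Integration.integral_diff Bochner_Integration.integrable_diff)
  finally show ?thesis using anti by simp
qed

lemma poisson_integral_dilate:
  assumes f: "f holomorphic_on ball 0 1" and r: "0 \<le> r" "r < 1" and z: "norm z < 1"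
  shows "poisson_integral (\<lambda>\<zeta>. f (of_real r * \<zeta>)) z = f (of_real r * z)"
proof -
  have int: "integrable \<mu> (\<lambda>\<zeta>. f (of_real r * \<zeta>))"
    by (intro integrable_circle_continuous continuous_dilate f r)
  have rz: "norm (of_real r * z) < 1"
    using r z mult_right_mono[of r 1 "norm z"] by (simp add: norm_mult)
  have "(\<lambda>n. (\<integral>\<zeta>. f (of_real r * \<zeta>) * cnj \<zeta> ^ n \<partial>\<mu>) * z ^ n)
      sums cauchy_integral (\<lambda>\<zeta>. f (of_real r * \<zeta>)) z"
    by (rule cauchy_integral_sums[OF int z])
  then have "(\<lambda>n. taylor_coeff f n * (of_real r * z) ^ n) sums cauchy_integral (\<lambda>\<zeta>. f (of_real r * \<zeta>)) z"
    unfolding dilate_coeff(1)[OF f r] by (simp add: power_mult_distrib mult.assoc)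
  then have "cauchy_integral (\<lambda>\<zeta>. f (of_real r * \<zeta>)) z = f (of_real r * z)"
    using taylor_sums[OF f rz] sums_unique2 by blast
  then show ?thesis
    using poisson_eq_cauchy_integral[OF int z dilate_coeff(2)[OF f r]] by simp
qed

text \<open>By Parseval's identity the means of order two are \<open>\<Sum>n. \<bar>a\<^sub>n\<bar>\<^sup>2 r\<^bsup>2n\<^esup>\<close>; let \<open>r\<close> tend to one in the partial
  sums.\<close>

lemma summable_Hardy2:
  assumes "f \<in> Hardy 2"
  shows "summable (\<lambda>n. (norm (taylor_coeff f n))\<^sup>2)"
proof -
  have f: "f holomorphic_on ball 0 1" using assms by (simp add: Hardy_def)
  have parseval: "(\<lambda>n. (norm (taylor_coeff f n * of_real r ^ n))\<^sup>2) sums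
      (\<integral>\<zeta>. (norm (f (of_real r * \<zeta>)))\<^sup>2 \<partial>\<mu>)" if "0 \<le> r" "r < 1" for r
    by (rule circle_series_parseval[OF taylor_summable_norm[OF f that] dilate_sums[OF f that] continuous_dilate[OF f that]])
  obtain C where "\<forall>r\<in>{0..<1}. (\<integral>\<zeta>. (norm (f (of_real r * \<zeta>)))\<^sup>2 \<partial>\<mu>) \<le> C"
    using assms by (auto simp: Hardy_def bdd_above_def)
  then have C: "(\<integral>\<zeta>. (norm (f (of_real r * \<zeta>)))\<^sup>2 \<partial>\<mu>) \<le> C" if "0 \<le> r" "r < 1" for r
    using that by simp
  show ?thesis
  proof (rule summableI_nonneg_bounded[where x = C])
    fix N
    have "((\<lambda>r. \<Sum>n<N. (norm (taylor_coeff f n * of_real r ^ n))\<^sup>2) \<longlongrightarrow>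
        (\<Sum>n<N. (norm (taylor_coeff f n * of_real 1 ^ n))\<^sup>2)) (at_left 1)"
      by (intro tendsto_intros)
    moreover have "eventually (\<lambda>r. (\<Sum>n<N. (norm (taylor_coeff f n * of_real r ^ n))\<^sup>2) \<le> C) (at_left 1)"
    proof (rule eventually_at_leftI[of 0])
      fix r :: real assume r: "r \<in> {0<..<1}"
      have "(\<Sum>n<N. (norm (taylor_coeff f n * of_real r ^ n))\<^sup>2) \<le> (\<integral>\<zeta>. (norm (f (of_real r * \<zeta>)))\<^sup>2 \<partial>\<mu>)"
        using parseval[of r] r sum_le_suminf[of "\<lambda>n. (norm (taylor_coeff f n * of_real r ^ n))\<^sup>2" "{..<N}"]
        by (simp add: sums_iff)
      also have "\<dots> \<le> C" using r by (intro C) auto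
      finally show "(\<Sum>n<N. (norm (taylor_coeff f n * of_real r ^ n))\<^sup>2) \<le> C" .
    qed simp
    ultimately show "(\<Sum>n<N. (norm (taylor_coeff f n))\<^sup>2) \<le> C"
      by (intro tendsto_upperbound[of _ _ "at_left 1"]) auto
  qed simp
qed

text \<open>By Parseval's identity this is the square of the \<open>L\<^sup>2\<close> distance between the dilate with factor \<open>s\<close>
  and the boundary function, before the latter is known to exist.\<close>

definition dilation_defect :: "(complex \<Rightarrow> complex) \<Rightarrow> real \<Rightarrow> real" where
  "dilation_defect f s = (\<Sum>n. (norm (taylor_coeff f n))\<^sup>2 * (1 - s ^ n)\<^sup>2)"

text \<open>Dominated convergence for series.\<close>

lemma dilation_defect_tendsto:
  assumes "f \<in> Hardy 2"
  shows "(dilation_defect f \<longlongrightarrow> 0) (at_left 1)"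
proof -
  have "((\<lambda>s. \<Sum>n. (norm (taylor_coeff f n))\<^sup>2 * (1 - s ^ n)\<^sup>2) \<longlongrightarrow> (\<Sum>n. 0)) (at_left 1)"
  proof (rule tannerys_theorem[THEN conjunct2, THEN conjunct2])
    show "((\<lambda>s. (norm (taylor_coeff f n))\<^sup>2 * (1 - s ^ n)\<^sup>2) \<longlongrightarrow> 0) (at_left 1)" for n
      by (rule tendsto_eq_rhs[where x = "(norm (taylor_coeff f n))\<^sup>2 * (1 - 1 ^ n)\<^sup>2"])
         (intro tendsto_intros, simp)
    have "eventually (\<lambda>s. \<forall>n. norm ((norm (taylor_coeff f n))\<^sup>2 * (1 - s ^ n)\<^sup>2) \<le> (norm (taylor_coeff f n))\<^sup>2) (at_left 1)"
    proof (rule eventually_at_leftI[of 0])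
      fix s :: real assume s: "s \<in> {0<..<1}"
      then have "(1 - s ^ n)\<^sup>2 \<le> 1" for n
        by (intro power_le_one) (auto intro: power_le_one)
      then show "\<forall>n. norm ((norm (taylor_coeff f n))\<^sup>2 * (1 - s ^ n)\<^sup>2) \<le> (norm (taylor_coeff f n))\<^sup>2"
        by (auto intro!: mult_left_le)
    qed simp
    from eventually_prodI[OF eventually_True this] show "eventually (\<lambda>(n, s). norm ((norm (taylor_coeff f n))\<^sup>2 * (1 - s ^ n)\<^sup>2) \<le> (norm (taylor_coeff f n))\<^sup>2)
        (at_top \<times>\<^sub>F at_left 1)"
      by (rule eventually_mono) auto
  qed (use summable_Hardy2[OF assms] in simp_all)
  then show ?thesis by (simp add: dilation_defect_def[abs_def])
qed

lemma dilation_distance: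
  assumes "f \<in> Hardy 2" "0 \<le> s" "s \<le> r" "r < 1"
  shows "(\<integral>\<zeta>. (norm (f (of_real r * \<zeta>) - f (of_real s * \<zeta>)))\<^sup>2 \<partial>\<mu>) \<le> dilation_defect f s"
proof -
  have f: "f holomorphic_on ball 0 1" using assms(1) by (simp add: Hardy_def)
  define b where "b = (\<lambda>n. taylor_coeff f n * of_real r ^ n - taylor_coeff f n * of_real s ^ n)"
  have "summable (\<lambda>n. norm (taylor_coeff f n * of_real r ^ n) + norm (taylor_coeff f n * of_real s ^ n))"
    using assms by (intro summable_add taylor_summable_norm f) auto
  then have b: "summable (\<lambda>n. norm (b n))"
    by (rule summable_comparison_test'[where N = 0]) (simp add: b_def norm_triangle_ineq4)
  have 1: "(\<lambda>n. (norm (b n))\<^sup>2) sums (\<integral>\<zeta>. (norm (f (of_real r * \<zeta>) - f (of_real s * \<zeta>)))\<^sup>2 \<partial>\<mu>)"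
  proof (rule circle_series_parseval[OF b])
    show "(\<lambda>n. b n * \<zeta> ^ n) sums (f (of_real r * \<zeta>) - f (of_real s * \<zeta>))" if "norm \<zeta> = 1" for \<zeta>
      unfolding b_def left_diff_distrib using assms that by (intro sums_diff dilate_sums f) auto
    show "continuous_on (sphere 0 1) (\<lambda>\<zeta>. f (of_real r * \<zeta>) - f (of_real s * \<zeta>))"
      using assms by (intro continuous_intros continuous_dilate f) auto
  qed
  have 2: "(norm (b n))\<^sup>2 \<le> (norm (taylor_coeff f n))\<^sup>2 * (1 - s ^ n)\<^sup>2" for n
  proof -
    have "b n = taylor_coeff f n * of_real (r ^ n - s ^ n)"
      by (simp add: b_def algebra_simps)
    then have "norm (b n) = norm (taylor_coeff f n) * \<bar>r ^ n - s ^ n\<bar>"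
      by (simp add: norm_mult del: of_real_diff)
    also have "\<bar>r ^ n - s ^ n\<bar> \<le> 1 - s ^ n"
      using power_mono[of s r n] power_le_one[of r n] assms by simp
    finally have "norm (b n) \<le> norm (taylor_coeff f n) * (1 - s ^ n)"
      by (simp add: mult_left_mono)
    then have "(norm (b n))\<^sup>2 \<le> (norm (taylor_coeff f n) * (1 - s ^ n))\<^sup>2"
      by (intro power_mono) auto
    then show ?thesis by (simp add: power_mult_distrib)
  qed
  have 3: "summable (\<lambda>n. (norm (taylor_coeff f n))\<^sup>2 * (1 - s ^ n)\<^sup>2)"
  proof (rule summable_comparison_test'[OF summable_Hardy2[OF assms(1)], where N = 0])
    fix n
    have "(1 - s ^ n)\<^sup>2 \<le> 1"
      using assms by (intro power_le_one) (auto intro: power_le_one)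
    then show "norm ((norm (taylor_coeff f n))\<^sup>2 * (1 - s ^ n)\<^sup>2) \<le> (norm (taylor_coeff f n))\<^sup>2"
      by (auto intro!: mult_left_le)
  qed
  show ?thesis
    unfolding dilation_defect_def by (rule sums_le[OF 2 1 summable_sums[OF 3]])
qed

text \<open>Integrate \<open>x \<le> x\<^sup>2 / (2 c) + c / 2\<close>.\<close>

lemma integral_norm_le_L2:
  fixes u :: "complex \<Rightarrow> complex"
  assumes u: "integrable \<mu> (\<lambda>\<zeta>. (norm (u \<zeta>))\<^sup>2)" "u \<in> borel_measurable \<mu>"
    and c: "c > 0" "(\<integral>\<zeta>. (norm (u \<zeta>))\<^sup>2 \<partial>\<mu>) \<le> c\<^sup>2"
  shows "integrable \<mu> u" "(\<integral>\<zeta>. norm (u \<zeta>) \<partial>\<mu>) \<le> c"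
proof -
  have *: "x \<le> x\<^sup>2 / (2 * c) + c / 2" for x :: real
  proof -
    have "0 \<le> (x - c)\<^sup>2" by simp
    then show ?thesis using c(1) by (simp add: power2_diff field_simps power2_eq_square)
  qed
  have int: "integrable \<mu> (\<lambda>\<zeta>. (norm (u \<zeta>))\<^sup>2 / (2 * c) + c / 2)" using u by simp
  have "norm (u \<zeta>) \<le> norm ((norm (u \<zeta>))\<^sup>2 / (2 * c) + c / 2)" for \<zeta>
    using *[of "norm (u \<zeta>)"] by simp
  then show iu: "integrable \<mu> u"
    by (intro Bochner_Integration.integrable_bound[OF int u(2)] AE_I2)
  have "(\<integral>\<zeta>. norm (u \<zeta>) \<partial>\<mu>) \<le> (\<integral>\<zeta>. (norm (u \<zeta>))\<^sup>2 / (2 * c) + c / 2 \<partial>\<mu>)"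
    by (intro integral_mono integrable_norm iu int *)
  also have "\<dots> = (\<integral>\<zeta>. (norm (u \<zeta>))\<^sup>2 \<partial>\<mu>) / (2 * c) + c / 2"
    using u by simp
  also have "\<dots> \<le> c\<^sup>2 / (2 * c) + c / 2"
    using c by (intro add_mono divide_right_mono) auto
  also have "\<dots> = c" using c(1) by (simp add: power2_eq_square)
  finally show "(\<integral>\<zeta>. norm (u \<zeta>) \<partial>\<mu>) \<le> c" .
qed

lemma AE_summable_integral:
  fixes u :: "nat \<Rightarrow> 'a \<Rightarrow> 'b::{banach, second_countable_topology}"
  assumes int: "\<And>j. integrable M (u j)" and sum: "summable (\<lambda>j. \<integral>x. norm (u j x) \<partial>M)"
  shows "AE x in M. summable (\<lambda>j. norm (u j x))"
proof -
  have "(\<integral>\<^sup>+x. (\<Sum>j. ennreal (norm (u j x))) \<partial>M) = (\<Sum>j. \<integral>\<^sup>+x. ennreal (norm (u j x)) \<partial>M)"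
    using int by (intro nn_integral_suminf) auto
  also have "\<dots> = (\<Sum>j. ennreal (\<integral>x. norm (u j x) \<partial>M))"
    using int by (simp add: nn_integral_eq_integral)
  also have "\<dots> = ennreal (\<Sum>j. \<integral>x. norm (u j x) \<partial>M)"
    by (intro suminf_ennreal2 sum) auto
  finally have "(\<integral>\<^sup>+x. (\<Sum>j. ennreal (norm (u j x))) \<partial>M) \<noteq> \<infinity>" by simp
  then have "AE x in M. (\<Sum>j. ennreal (norm (u j x))) \<noteq> \<infinity>"
    using int by (intro nn_integral_PInf_AE) auto
  then show ?thesis
    by eventually_elim (auto intro: summable_suminf_not_top)
qed

text \<open>The radii are chosen so that the \<open>L\<^sup>2\<close> distances of consecutive dilates are summable.\<close>

lemma dilation_sequence:
  assumes f: "f \<in> Hardy 2"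
  obtains s :: "nat \<Rightarrow> real" where "\<And>j. 0 \<le> s j" "\<And>j. s j < 1" "\<And>j. s j \<le> s (Suc j)" "s \<longlonglongrightarrow> 1"
    "\<And>j. dilation_defect f (s j) \<le> ((1 / 2) ^ j)\<^sup>2"
proof -
  let ?P = "\<lambda>n x. 0 \<le> x \<and> x < 1 \<and> 1 - 1 / real (Suc n) \<le> x \<and> dilation_defect f x \<le> ((1 / 2) ^ n)\<^sup>2"
  have ex: "\<exists>x. ?P n x \<and> y \<le> x" if "y < 1" for n y
  proof -
    have "eventually (\<lambda>x. dilation_defect f x < ((1 / 2) ^ n)\<^sup>2) (at_left 1)"
      by (intro order_tendstoD(2)[OF dilation_defect_tendsto[OF f]]) simp
    moreover have "eventually (\<lambda>x. x \<in> {max 0 (max y (1 - 1 / real (Suc n)))<..<1}) (at_left 1)"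
      by (rule eventually_at_leftI[of "max 0 (max y (1 - 1 / real (Suc n)))"]) (use that in auto)
    ultimately have "eventually (\<lambda>x. ?P n x \<and> y \<le> x) (at_left 1)"
      by eventually_elim auto
    then show ?thesis
      using eventually_happens'[OF trivial_limit_at_left_real] by blast
  qed
  obtain s where s: "\<And>n. ?P n (s n)" "\<And>n. s n \<le> s (Suc n)"
    using dependent_nat_choice[of ?P "\<lambda>n x y. x \<le> y"] ex[of 0 0] ex by (metis zero_less_one)
  have "s \<longlonglongrightarrow> 1"
  proof (rule tendsto_sandwich[where h = "\<lambda>_. 1" and f = "\<lambda>n. 1 - 1 / real (Suc n)"])
    show "(\<lambda>n. 1 - 1 / real (Suc n)) \<longlonglongrightarrow> 1"
      using tendsto_diff[OF tendsto_const[of "1::real"] LIMSEQ_inverse_real_of_nat] by (simp add: inverse_eq_divide)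
  qed (use s in \<open>auto intro: always_eventually less_imp_le\<close>)
  with s show ?thesis using that by blast
qed

text \<open>Along a sequence of radii with summable consecutive distances the dilates converge almost
  everywhere, as in the proof of the Riesz-Fischer theorem. Fatou's lemma carries the distances over
  to the limit \<open>\<phi>\<close>. Each dilate is the Poisson integral of its restriction to the circle, and so is
  the limit; the angular limits of \<open>f\<close> are then those of a Poisson integral.\<close>

theorem Hardy2_boundary:
  assumes fH: "f \<in> Hardy 2"
  obtains \<phi> where "integrable \<mu> \<phi>"
    "integrable \<mu> (\<lambda>\<zeta>. (norm (\<phi> \<zeta>))\<^sup>2)"
    "AE \<zeta> in \<mu>. has_angular_limit f \<zeta> (\<phi> \<zeta>)"
    "\<forall>s\<in>{0..<1}. integrable \<mu> (\<lambda>\<zeta>. (norm (\<phi> \<zeta> - f (of_real s * \<zeta>)))\<^sup>2) \<and>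
      (\<integral>\<zeta>. (norm (\<phi> \<zeta> - f (of_real s * \<zeta>)))\<^sup>2 \<partial>\<mu>) \<le> dilation_defect f s"
    "\<forall>z\<in>ball 0 1. f z = poisson_integral \<phi> z"
proof -
  have f: "f holomorphic_on ball 0 1" using fH by (simp add: Hardy_def)
  obtain s :: "nat \<Rightarrow> real" where s: "\<And>j. 0 \<le> s j" "\<And>j. s j < 1" "\<And>j. s j \<le> s (Suc j)"
    "s \<longlonglongrightarrow> 1" "\<And>j. dilation_defect f (s j) \<le> ((1 / 2) ^ j)\<^sup>2"
    using dilation_sequence[OF fH] by blast
  define F where "F = (\<lambda>r \<zeta>. f (of_real r * \<zeta>))"
  have Fc: "continuous_on (sphere 0 1) (F r)" if "0 \<le> r" "r < 1" for r
    unfolding F_def by (rule continuous_dilate[OF f that])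
  note Fs = Fc[OF s(1,2)]
  define u where "u = (\<lambda>j \<zeta>. F (s (Suc j)) \<zeta> - F (s j) \<zeta>)"
  have uc: "continuous_on (sphere 0 1) (u j)" for j
    unfolding u_def by (intro continuous_intros Fs)
  have u1: "integrable \<mu> (u j)" for j
    by (rule integrable_circle_continuous[OF uc])
  have u2: "(\<integral>\<zeta>. norm (u j \<zeta>) \<partial>\<mu>) \<le> (1 / 2) ^ j" for j
  proof (rule integral_norm_le_L2)
    show "integrable \<mu> (\<lambda>\<zeta>. (norm (u j \<zeta>))\<^sup>2)"
      by (intro integrable_circle_continuous continuous_intros uc)
    have "(\<integral>\<zeta>. (norm (u j \<zeta>))\<^sup>2 \<partial>\<mu>) \<le> dilation_defect f (s j)"
      unfolding u_def F_def using s by (intro dilation_distance fH) auto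
    also note s(5)
    finally show "(\<integral>\<zeta>. (norm (u j \<zeta>))\<^sup>2 \<partial>\<mu>) \<le> ((1 / 2) ^ j)\<^sup>2" .
  qed (use u1 in auto)
  have sumu: "summable (\<lambda>j. \<integral>\<zeta>. norm (u j \<zeta>) \<partial>\<mu>)"
  proof (rule summable_comparison_test'[where N = 0])
    show "summable (\<lambda>j. (1 / 2 :: real) ^ j)" by (rule summable_geometric) simp
    show "norm (\<integral>\<zeta>. norm (u j \<zeta>) \<partial>\<mu>) \<le> (1 / 2) ^ j" for j
      using u2[of j] by (simp add: integral_nonneg_AE)
  qed
  have ae: "AE \<zeta> in \<mu>. summable (\<lambda>j. norm (u j \<zeta>))"
    by (rule AE_summable_integral[OF u1 sumu])
  define \<phi> where "\<phi> = (\<lambda>\<zeta>. F (s 0) \<zeta> + (\<Sum>j. u j \<zeta>))"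
  have i1: "integrable \<mu> \<phi>"
    unfolding \<phi>_def
    by (rule Bochner_Integration.integrable_add[OF integrable_circle_continuous[OF Fs]
          integrable_suminf[OF u1 ae sumu]])
  have lim: "AE \<zeta> in \<mu>. (\<lambda>j. F (s j) \<zeta>) \<longlonglongrightarrow> \<phi> \<zeta>"
    using ae
  proof eventually_elim
    case (elim \<zeta>)
    then have "(\<lambda>j. u j \<zeta>) sums (\<Sum>j. u j \<zeta>)"
      by (rule summable_sums[OF summable_norm_cancel])
    then have "(\<lambda>n. F (s 0) \<zeta> + (\<Sum>j<n. u j \<zeta>)) \<longlonglongrightarrow> \<phi> \<zeta>"
      unfolding \<phi>_def sums_def by (intro tendsto_intros)
    moreover have "F (s 0) \<zeta> + (\<Sum>j<n. u j \<zeta>) = F (s n) \<zeta>" for n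
      by (simp add: u_def sum_lessThan_telescope[of "\<lambda>j. F (s j) \<zeta>"])
    ultimately show ?case by simp
  qed
  have dist: "integrable \<mu> (\<lambda>\<zeta>. (norm (\<phi> \<zeta> - F r \<zeta>))\<^sup>2)"
     "(\<integral>\<zeta>. (norm (\<phi> \<zeta> - F r \<zeta>))\<^sup>2 \<partial>\<mu>) \<le> dilation_defect f r" if r: "0 \<le> r" "r < 1" for r
  proof -
    obtain N where N: "\<And>j. j \<ge> N \<Longrightarrow> r \<le> s j"
      using order_tendstoD(1)[OF s(4) r(2)] unfolding eventually_sequentially
      by (meson less_imp_le)
    have m: "(\<lambda>\<zeta>. (norm (\<phi> \<zeta> - F r \<zeta>))\<^sup>2) \<in> borel_measurable \<mu>"
      using i1 measurable_circle_continuous[OF Fc[OF r]] by measurable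
    have int: "integrable \<mu> (\<lambda>\<zeta>. (norm (F (s (j + N)) \<zeta> - F r \<zeta>))\<^sup>2)" for j
      by (intro integrable_circle_continuous continuous_intros Fs Fc r)
    have lim': "AE \<zeta> in \<mu>. (\<lambda>j. (norm (F (s (j + N)) \<zeta> - F r \<zeta>))\<^sup>2) \<longlonglongrightarrow> (norm (\<phi> \<zeta> - F r \<zeta>))\<^sup>2"
      using lim by eventually_elim (intro tendsto_intros LIMSEQ_ignore_initial_segment)
    have le: "(\<integral>\<zeta>. (norm (F (s (j + N)) \<zeta> - F r \<zeta>))\<^sup>2 \<partial>\<mu>) \<le> dilation_defect f r" for j
      unfolding F_def using r s N by (intro dilation_distance fH) auto
    show "integrable \<mu> (\<lambda>\<zeta>. (norm (\<phi> \<zeta> - F r \<zeta>))\<^sup>2)"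
     "(\<integral>\<zeta>. (norm (\<phi> \<zeta> - F r \<zeta>))\<^sup>2 \<partial>\<mu>) \<le> dilation_defect f r"
      using integrable_fatou[OF int _ lim' m le] by auto
  qed
  have i2: "integrable \<mu> (\<lambda>\<zeta>. (norm (\<phi> \<zeta>))\<^sup>2)"
  proof -
    have "integrable \<mu> (\<lambda>\<zeta>. (norm (F 0 \<zeta>))\<^sup>2)"
      by (intro integrable_circle_continuous continuous_intros Fc) auto
    then have int: "integrable \<mu> (\<lambda>\<zeta>. 2 * (norm (\<phi> \<zeta> - F 0 \<zeta>))\<^sup>2 + 2 * (norm (F 0 \<zeta>))\<^sup>2)"
      using dist(1)[of 0] by simp
    show ?thesis
    proof (rule Bochner_Integration.integrable_bound[OF int])
      show "(\<lambda>\<zeta>. (norm (\<phi> \<zeta>))\<^sup>2) \<in> borel_measurable \<mu>" using i1 by measurable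
      show "AE \<zeta> in \<mu>. norm ((norm (\<phi> \<zeta>))\<^sup>2) \<le> norm (2 * (norm (\<phi> \<zeta> - F 0 \<zeta>))\<^sup>2 + 2 * (norm (F 0 \<zeta>))\<^sup>2)"
      proof (rule AE_I2)
        fix \<zeta>
        have "norm (\<phi> \<zeta>) \<le> norm (\<phi> \<zeta> - F 0 \<zeta>) + norm (F 0 \<zeta>)"
          using norm_triangle_ineq[of "\<phi> \<zeta> - F 0 \<zeta>" "F 0 \<zeta>"] by simp
        then have "(norm (\<phi> \<zeta>))\<^sup>2 \<le> (norm (\<phi> \<zeta> - F 0 \<zeta>) + norm (F 0 \<zeta>))\<^sup>2"
          by (intro power_mono) auto
        also have "\<dots> \<le> 2 * (norm (\<phi> \<zeta> - F 0 \<zeta>))\<^sup>2 + 2 * (norm (F 0 \<zeta>))\<^sup>2"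
          using sum_squares_bound[of "norm (\<phi> \<zeta> - F 0 \<zeta>)" "norm (F 0 \<zeta>)"] by (simp add: power2_sum)
        finally show "norm ((norm (\<phi> \<zeta>))\<^sup>2) \<le> norm (2 * (norm (\<phi> \<zeta> - F 0 \<zeta>))\<^sup>2 + 2 * (norm (F 0 \<zeta>))\<^sup>2)"
          by simp
      qed
    qed
  qed
  have poisson: "f z = poisson_integral \<phi> z" if z: "norm z < 1" for z
  proof -
    have "(\<lambda>j. of_real (s j) * z) \<longlonglongrightarrow> of_real 1 * z"
      by (intro tendsto_intros s)
    moreover have "isCont f z"
      using f z by (intro holomorphic_on_imp_continuous_on[THEN continuous_on_interior]) auto
    ultimately have 1: "(\<lambda>j. f (of_real (s j) * z)) \<longlonglongrightarrow> f z"
      using isCont_tendsto_compose by fastforce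
    have "(\<lambda>j. poisson_integral \<phi> z - f (of_real (s j) * z)) \<longlonglongrightarrow> 0"
    proof (rule Lim_null_comparison[where g = "\<lambda>j. 2 / (1 - norm z) * (1 / 2) ^ j"])
      show "(\<lambda>j. 2 / (1 - norm z) * (1 / 2) ^ j) \<longlonglongrightarrow> 0"
        by (intro tendsto_mult_right_zero LIMSEQ_realpow_zero) auto
      show "\<forall>\<^sub>F j in sequentially. norm (poisson_integral \<phi> z - f (of_real (s j) * z)) \<le> 2 / (1 - norm z) * (1 / 2) ^ j"
      proof (rule always_eventually, rule allI)
        fix j
        have iF: "integrable \<mu> (F (s j))"
          by (rule integrable_circle_continuous[OF Fs])
        have l1: "(\<integral>\<zeta>. norm (\<phi> \<zeta> - F (s j) \<zeta>) \<partial>\<mu>) \<le> (1 / 2) ^ j"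
        proof (rule integral_norm_le_L2)
          show "(\<lambda>\<zeta>. \<phi> \<zeta> - F (s j) \<zeta>) \<in> borel_measurable \<mu>"
            using i1 iF by measurable
          show "(\<integral>\<zeta>. (norm (\<phi> \<zeta> - F (s j) \<zeta>))\<^sup>2 \<partial>\<mu>) \<le> ((1 / 2) ^ j)\<^sup>2"
            using dist(2)[OF s(1,2)] s(5) order_trans by blast
        qed (use dist(1)[OF s(1,2)] in auto)
        have "poisson_integral \<phi> z - f (of_real (s j) * z) = poisson_integral (\<lambda>\<zeta>. \<phi> \<zeta> - F (s j) \<zeta>) z"
          using poisson_integral_dilate[OF f s(1,2) z] poisson_integral_diff[OF i1 iF z]
          by (simp add: F_def)
        also have "norm \<dots> \<le> poisson_integral (\<lambda>\<zeta>. norm (\<phi> \<zeta> - F (s j) \<zeta>)) z"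
          using i1 iF z by (intro norm_poisson_integral_le) auto
        also have "\<dots> \<le> (\<integral>\<zeta>. 2 / (1 - norm z) * norm (\<phi> \<zeta> - F (s j) \<zeta>) \<partial>\<mu>)"
          unfolding poisson_integral_def
        proof (rule integral_mono)
          show "integrable \<mu> (\<lambda>\<zeta>. poisson_kernel z \<zeta> *\<^sub>R norm (\<phi> \<zeta> - F (s j) \<zeta>))"
            using i1 iF z by (intro integrable_poisson) auto
          show "integrable \<mu> (\<lambda>\<zeta>. 2 / (1 - norm z) * norm (\<phi> \<zeta> - F (s j) \<zeta>))"
            using i1 iF by (intro integrable_mult_right integrable_norm Bochner_Integration.integrable_diff)
          show "poisson_kernel z \<zeta> *\<^sub>R norm (\<phi> \<zeta> - F (s j) \<zeta>) \<le> 2 / (1 - norm z) * norm (\<phi> \<zeta> - F (s j) \<zeta>)"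
            if "\<zeta> \<in> space \<mu>" for \<zeta>
            using poisson_kernel_le_center[OF z, of \<zeta>] that
            unfolding real_scaleR_def by (intro mult_right_mono) auto
        qed
        also have "\<dots> = 2 / (1 - norm z) * (\<integral>\<zeta>. norm (\<phi> \<zeta> - F (s j) \<zeta>) \<partial>\<mu>)"
          by (rule Bochner_Integration.integral_mult_right) (use i1 iF in auto)
        also have "\<dots> \<le> 2 / (1 - norm z) * (1 / 2) ^ j"
          using z by (intro mult_left_mono l1) auto
        finally show "norm (poisson_integral \<phi> z - f (of_real (s j) * z)) \<le> 2 / (1 - norm z) * (1 / 2) ^ j" .
      qed
    qed
    from tendsto_diff[OF tendsto_const[of "poisson_integral \<phi> z"] this]
    have "(\<lambda>j. f (of_real (s j) * z)) \<longlonglongrightarrow> poisson_integral \<phi> z"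
      by simp
    with 1 show ?thesis using LIMSEQ_unique by blast
  qed
  have "AE \<zeta> in \<mu>. has_angular_limit f \<zeta> (\<phi> \<zeta>)"
    using poisson_integral_angular_limit[OF i1]
  proof eventually_elim
    case (elim \<zeta>)
    then have "has_angular_limit (poisson_integral \<phi>) \<zeta> (\<phi> \<zeta>)"
      by (simp add: has_angular_limit_def)
    then show ?case
      by (rule has_angular_limit_cong[rotated]) (simp add: poisson)
  qed
  then show ?thesis
    using dist poisson by (intro that[OF i1 i2]) (simp_all add: F_def)
qed

lemma integrable_mult_L2:
  fixes f g :: "complex \<Rightarrow> complex"
  assumes "integrable M (\<lambda>x. (norm (f x))\<^sup>2)" "integrable M (\<lambda>x. (norm (g x))\<^sup>2)"
    "f \<in> borel_measurable M" "g \<in> borel_measurable M"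
  shows "integrable M (\<lambda>x. f x * g x)"
proof (rule Bochner_Integration.integrable_bound)
  show "integrable M (\<lambda>x. (norm (f x))\<^sup>2 + (norm (g x))\<^sup>2)" using assms by simp
  show "(\<lambda>x. f x * g x) \<in> borel_measurable M" using assms by simp
  show "AE x in M. norm (f x * g x) \<le> norm ((norm (f x))\<^sup>2 + (norm (g x))\<^sup>2)"
  proof (rule AE_I2)
    fix x
    show "norm (f x * g x) \<le> norm ((norm (f x))\<^sup>2 + (norm (g x))\<^sup>2)"
      using sum_squares_bound[of "norm (f x)" "norm (g x)"] mult_nonneg_nonneg[OF norm_ge_zero[of "f x"] norm_ge_zero[of "g x"]]
      by (simp add: norm_mult del: mult_nonneg_nonneg)
  qed
qed

text \<open>With the parameter \<open>c\<close> the bound becomes small if \<open>f\<close> tends to zero in \<open>L\<^sup>2\<close> for fixed \<open>c\<close>, and then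
  \<open>c\<close> tends to zero.\<close>

lemma norm_integral_mult_le:
  fixes f g :: "complex \<Rightarrow> complex"
  assumes f: "integrable M (\<lambda>x. (norm (f x))\<^sup>2)" "f \<in> borel_measurable M"
    and g: "integrable M (\<lambda>x. (norm (g x))\<^sup>2)" "g \<in> borel_measurable M"
    and c: "c > 0"
  shows "norm (\<integral>x. f x * g x \<partial>M) \<le> (\<integral>x. (norm (f x))\<^sup>2 \<partial>M) / (2 * c) + c / 2 * (\<integral>x. (norm (g x))\<^sup>2 \<partial>M)"
proof -
  have int: "integrable M (\<lambda>x. f x * g x)"
    by (rule integrable_mult_L2[OF f(1) g(1) f(2) g(2)])
  have int2: "integrable M (\<lambda>x. (norm (f x))\<^sup>2 / (2 * c) + c / 2 * (norm (g x))\<^sup>2)"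
    using f g by simp
  have "norm (\<integral>x. f x * g x \<partial>M) \<le> (\<integral>x. norm (f x * g x) \<partial>M)"
    by (rule integral_norm_bound)
  also have "\<dots> \<le> (\<integral>x. (norm (f x))\<^sup>2 / (2 * c) + c / 2 * (norm (g x))\<^sup>2 \<partial>M)"
  proof (rule integral_mono[OF integrable_norm[OF int] int2])
    fix x
    have "0 \<le> (norm (f x) - c * norm (g x))\<^sup>2" by simp
    then show "norm (f x * g x) \<le> (norm (f x))\<^sup>2 / (2 * c) + c / 2 * (norm (g x))\<^sup>2"
      using c by (simp add: norm_mult power2_diff field_simps power2_eq_square)
  qed
  also have "\<dots> = (\<integral>x. (norm (f x))\<^sup>2 \<partial>M) / (2 * c) + c / 2 * (\<integral>x. (norm (g x))\<^sup>2 \<partial>M)"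
    using f g by simp
  finally show ?thesis .
qed

text \<open>Cauchy's theorem on the unit circle. For dilates the integral vanishes because the product is
  analytic beyond the circle, and the dilates converge in \<open>L\<^sup>2\<close>.\<close>

lemma Hardy2_product_orthogonal:
  assumes fH: "f \<in> Hardy 2" and gH: "g \<in> Hardy 2"
    and \<phi>: "\<phi> \<in> borel_measurable \<mu>" "AE \<zeta> in \<mu>. has_angular_limit f \<zeta> (\<phi> \<zeta>)"
    and \<gamma>: "\<gamma> \<in> borel_measurable \<mu>" "AE \<zeta> in \<mu>. has_angular_limit g \<zeta> (\<gamma> \<zeta>)"
  shows "(\<integral>\<zeta>. \<phi> \<zeta> * \<gamma> \<zeta> * \<zeta> \<partial>\<mu>) = 0"
proof -
  obtain \<phi>' where \<phi>': "integrable \<mu> \<phi>'"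
    "integrable \<mu> (\<lambda>\<zeta>. (norm (\<phi>' \<zeta>))\<^sup>2)"
    "AE \<zeta> in \<mu>. has_angular_limit f \<zeta> (\<phi>' \<zeta>)"
    and d1: "\<forall>s\<in>{0..<1}. integrable \<mu> (\<lambda>\<zeta>. (norm (\<phi>' \<zeta> - f (of_real s * \<zeta>)))\<^sup>2) \<and>
      (\<integral>\<zeta>. (norm (\<phi>' \<zeta> - f (of_real s * \<zeta>)))\<^sup>2 \<partial>\<mu>) \<le> dilation_defect f s"
    and "\<forall>z\<in>ball 0 1. f z = poisson_integral \<phi>' z"
    by (rule Hardy2_boundary[OF fH])
  obtain \<gamma>' where \<gamma>': "integrable \<mu> \<gamma>'"
    "integrable \<mu> (\<lambda>\<zeta>. (norm (\<gamma>' \<zeta>))\<^sup>2)"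
    "AE \<zeta> in \<mu>. has_angular_limit g \<zeta> (\<gamma>' \<zeta>)"
    and d2: "\<forall>s\<in>{0..<1}. integrable \<mu> (\<lambda>\<zeta>. (norm (\<gamma>' \<zeta> - g (of_real s * \<zeta>)))\<^sup>2) \<and>
      (\<integral>\<zeta>. (norm (\<gamma>' \<zeta> - g (of_real s * \<zeta>)))\<^sup>2 \<partial>\<mu>) \<le> dilation_defect g s"
    and "\<forall>z\<in>ball 0 1. g z = poisson_integral \<gamma>' z"
    by (rule Hardy2_boundary[OF gH])
  have f: "f holomorphic_on ball 0 1" and g: "g holomorphic_on ball 0 1"
    using fH gH by (auto simp: Hardy_def)
  have [measurable]: "\<phi>' \<in> borel_measurable \<mu>" "\<gamma>' \<in> borel_measurable \<mu>"
    using \<phi>' \<gamma>' by auto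
  have eq: "(\<integral>\<zeta>. \<phi> \<zeta> * \<gamma> \<zeta> * \<zeta> \<partial>\<mu>) = (\<integral>\<zeta>. \<phi>' \<zeta> * \<gamma>' \<zeta> * \<zeta> \<partial>\<mu>)"
  proof (rule integral_cong_AE)
    show "AE \<zeta> in \<mu>. \<phi> \<zeta> * \<gamma> \<zeta> * \<zeta> = \<phi>' \<zeta> * \<gamma>' \<zeta> * \<zeta>"
      using AE_circle_boundary_unique[OF \<phi>(2) \<phi>'(3)] AE_circle_boundary_unique[OF \<gamma>(2) \<gamma>'(3)]
      by eventually_elim simp
  qed (use \<phi>(1) \<gamma>(1) in measurable)
  define A where "A = (\<integral>\<zeta>. (norm (\<phi>' \<zeta>))\<^sup>2 \<partial>\<mu>)"
  define B where "B = (\<integral>\<zeta>. (norm (\<gamma>' \<zeta>))\<^sup>2 \<partial>\<mu>)"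
  have AB: "0 \<le> A" "0 \<le> B" by (auto simp: A_def B_def)
  have bound: "norm (\<integral>\<zeta>. \<phi>' \<zeta> * \<gamma>' \<zeta> * \<zeta> \<partial>\<mu>) \<le>
     (dilation_defect f s / (2 * c) + c / 2 * B) + (dilation_defect g s / (2 * c) + c / 2 * (2 * A + 2 * dilation_defect f s))"
    if s: "0 \<le> s" "s < 1" and c: "c > 0" for s c
  proof -
    define F where "F = (\<lambda>\<zeta>. f (of_real s * \<zeta>))"
    define G where "G = (\<lambda>\<zeta>. g (of_real s * \<zeta>))"
    have FG: "continuous_on (sphere 0 1) F" "continuous_on (sphere 0 1) G"
      unfolding F_def G_def by (intro continuous_dilate f g s)+
    then have [measurable]: "F \<in> borel_measurable \<mu>" "G \<in> borel_measurable \<mu>"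
      by (auto intro: measurable_circle_continuous)
    have iF2: "integrable \<mu> (\<lambda>\<zeta>. (norm (F \<zeta>))\<^sup>2)"
      by (intro integrable_circle_continuous continuous_intros FG)
    have D1: "integrable \<mu> (\<lambda>\<zeta>. (norm (\<phi>' \<zeta> - F \<zeta>))\<^sup>2)"
       "(\<integral>\<zeta>. (norm (\<phi>' \<zeta> - F \<zeta>))\<^sup>2 \<partial>\<mu>) \<le> dilation_defect f s"
     and D2: "integrable \<mu> (\<lambda>\<zeta>. (norm (\<gamma>' \<zeta> - G \<zeta>))\<^sup>2)"
       "(\<integral>\<zeta>. (norm (\<gamma>' \<zeta> - G \<zeta>))\<^sup>2 \<partial>\<mu>) \<le> dilation_defect g s"
      using d1 d2 s by (auto simp: F_def G_def)
    have zero: "(\<integral>\<zeta>. F \<zeta> * G \<zeta> * \<zeta> \<partial>\<mu>) = 0"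
      using dilate_coeff(2)[of "\<lambda>z. f z * g z" s 0] f g s
      by (simp add: F_def G_def holomorphic_on_mult)
    have normz: "(\<integral>\<zeta>. (norm (u \<zeta> * \<zeta>))\<^sup>2 \<partial>\<mu>) = (\<integral>\<zeta>. (norm (u \<zeta>))\<^sup>2 \<partial>\<mu>)" for u :: "complex \<Rightarrow> complex"
      by (intro Bochner_Integration.integral_cong) (auto simp: norm_mult)
    have intz: "integrable \<mu> (\<lambda>\<zeta>. (norm (u \<zeta> * \<zeta>))\<^sup>2) \<longleftrightarrow> integrable \<mu> (\<lambda>\<zeta>. (norm (u \<zeta>))\<^sup>2)" for u :: "complex \<Rightarrow> complex"
      by (intro Bochner_Integration.integrable_cong) (auto simp: norm_mult)
    have F2: "(\<integral>\<zeta>. (norm (F \<zeta>))\<^sup>2 \<partial>\<mu>) \<le> 2 * A + 2 * dilation_defect f s"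
    proof -
      have "(\<integral>\<zeta>. (norm (F \<zeta>))\<^sup>2 \<partial>\<mu>) \<le> (\<integral>\<zeta>. 2 * (norm (\<phi>' \<zeta>))\<^sup>2 + 2 * (norm (\<phi>' \<zeta> - F \<zeta>))\<^sup>2 \<partial>\<mu>)"
      proof (rule integral_mono[OF iF2])
        show "integrable \<mu> (\<lambda>\<zeta>. 2 * (norm (\<phi>' \<zeta>))\<^sup>2 + 2 * (norm (\<phi>' \<zeta> - F \<zeta>))\<^sup>2)"
          using \<phi>'(2) D1 by simp
        fix \<zeta>
        have "norm (F \<zeta>) \<le> norm (\<phi>' \<zeta>) + norm (\<phi>' \<zeta> - F \<zeta>)"
          using norm_triangle_ineq4[of "\<phi>' \<zeta>" "\<phi>' \<zeta> - F \<zeta>"] by simp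
        then have "(norm (F \<zeta>))\<^sup>2 \<le> (norm (\<phi>' \<zeta>) + norm (\<phi>' \<zeta> - F \<zeta>))\<^sup>2"
          by (intro power_mono) auto
        also have "\<dots> \<le> 2 * (norm (\<phi>' \<zeta>))\<^sup>2 + 2 * (norm (\<phi>' \<zeta> - F \<zeta>))\<^sup>2"
          using sum_squares_bound[of "norm (\<phi>' \<zeta>)" "norm (\<phi>' \<zeta> - F \<zeta>)"] by (simp add: power2_sum)
        finally show "(norm (F \<zeta>))\<^sup>2 \<le> 2 * (norm (\<phi>' \<zeta>))\<^sup>2 + 2 * (norm (\<phi>' \<zeta> - F \<zeta>))\<^sup>2" .
      qed
      also have "\<dots> = 2 * A + 2 * (\<integral>\<zeta>. (norm (\<phi>' \<zeta> - F \<zeta>))\<^sup>2 \<partial>\<mu>)"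
        unfolding A_def using \<phi>'(2) D1 by simp
      finally show ?thesis using D1 by linarith
    qed
    have i1: "integrable \<mu> (\<lambda>\<zeta>. (\<phi>' \<zeta> - F \<zeta>) * (\<gamma>' \<zeta> * \<zeta>))"
      using D1 \<gamma>'(2) by (intro integrable_mult_L2) (auto simp: intz)
    have i2: "integrable \<mu> (\<lambda>\<zeta>. (\<gamma>' \<zeta> - G \<zeta>) * (F \<zeta> * \<zeta>))"
      using D2 iF2 by (intro integrable_mult_L2) (auto simp: intz)
    have i3: "integrable \<mu> (\<lambda>\<zeta>. F \<zeta> * G \<zeta> * \<zeta>)"
      by (intro integrable_circle_continuous continuous_intros FG)
    have "(\<integral>\<zeta>. \<phi>' \<zeta> * \<gamma>' \<zeta> * \<zeta> \<partial>\<mu>) =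
        (\<integral>\<zeta>. ((\<phi>' \<zeta> - F \<zeta>) * (\<gamma>' \<zeta> * \<zeta>) + (\<gamma>' \<zeta> - G \<zeta>) * (F \<zeta> * \<zeta>)) + F \<zeta> * G \<zeta> * \<zeta> \<partial>\<mu>)"
      by (intro Bochner_Integration.integral_cong) (auto simp: algebra_simps)
    also have "\<dots> = (\<integral>\<zeta>. (\<phi>' \<zeta> - F \<zeta>) * (\<gamma>' \<zeta> * \<zeta>) \<partial>\<mu>) + (\<integral>\<zeta>. (\<gamma>' \<zeta> - G \<zeta>) * (F \<zeta> * \<zeta>) \<partial>\<mu>)"
      using i1 i2 i3 zero by (simp only: Bochner_Integration.integral_add Bochner_Integration.integrable_add) simp
    finally have "norm (\<integral>\<zeta>. \<phi>' \<zeta> * \<gamma>' \<zeta> * \<zeta> \<partial>\<mu>) =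
      norm ((\<integral>\<zeta>. (\<phi>' \<zeta> - F \<zeta>) * (\<gamma>' \<zeta> * \<zeta>) \<partial>\<mu>) + (\<integral>\<zeta>. (\<gamma>' \<zeta> - G \<zeta>) * (F \<zeta> * \<zeta>) \<partial>\<mu>))"
      by simp
    also have "\<dots> \<le> ((\<integral>\<zeta>. (norm (\<phi>' \<zeta> - F \<zeta>))\<^sup>2 \<partial>\<mu>) / (2 * c) + c / 2 * (\<integral>\<zeta>. (norm (\<gamma>' \<zeta> * \<zeta>))\<^sup>2 \<partial>\<mu>))
       + ((\<integral>\<zeta>. (norm (\<gamma>' \<zeta> - G \<zeta>))\<^sup>2 \<partial>\<mu>) / (2 * c) + c / 2 * (\<integral>\<zeta>. (norm (F \<zeta> * \<zeta>))\<^sup>2 \<partial>\<mu>))"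
      using D1 D2 \<gamma>'(2) iF2 c
      by (intro norm_triangle_le add_mono norm_integral_mult_le) (auto simp: intz)
    also have "\<dots> \<le> (dilation_defect f s / (2 * c) + c / 2 * B) + (dilation_defect g s / (2 * c) + c / 2 * (2 * A + 2 * dilation_defect f s))"
      unfolding normz B_def using D1 D2 F2 c
      by (intro add_mono divide_right_mono mult_left_mono) auto
    finally show ?thesis .
  qed
  \<comment> \<open>First the dilation factor tends to one for fixed \<open>c\<close>, then \<open>c\<close> tends to zero.\<close>
  have limc: "norm (\<integral>\<zeta>. \<phi>' \<zeta> * \<gamma>' \<zeta> * \<zeta> \<partial>\<mu>) \<le> c * (A + B)" if c: "c > 0" for c
  proof -
    have "((\<lambda>s. (dilation_defect f s / (2 * c) + c / 2 * B) + (dilation_defect g s / (2 * c) + c / 2 * (2 * A + 2 * dilation_defect f s)))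
      \<longlongrightarrow> (0 / (2 * c) + c / 2 * B) + (0 / (2 * c) + c / 2 * (2 * A + 2 * 0))) (at_left 1)"
      using c by (intro tendsto_intros dilation_defect_tendsto fH gH) auto
    moreover have "eventually (\<lambda>s. norm (\<integral>\<zeta>. \<phi>' \<zeta> * \<gamma>' \<zeta> * \<zeta> \<partial>\<mu>) \<le>
        (dilation_defect f s / (2 * c) + c / 2 * B) + (dilation_defect g s / (2 * c) + c / 2 * (2 * A + 2 * dilation_defect f s))) (at_left 1)"
      by (rule eventually_at_leftI[of 0]) (use bound c in auto)
    ultimately have "norm (\<integral>\<zeta>. \<phi>' \<zeta> * \<gamma>' \<zeta> * \<zeta> \<partial>\<mu>) \<le> (0 / (2 * c) + c / 2 * B) + (0 / (2 * c) + c / 2 * (2 * A + 2 * 0))"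
      by (intro tendsto_lowerbound[of _ _ "at_left 1"]) auto
    also have "\<dots> \<le> c * (A + B)" using c AB by (simp add: algebra_simps)
    finally show ?thesis .
  qed
  have "norm (\<integral>\<zeta>. \<phi>' \<zeta> * \<gamma>' \<zeta> * \<zeta> \<partial>\<mu>) \<le> 0"
  proof (rule field_le_epsilon)
    fix e :: real assume e: "e > 0"
    have "norm (\<integral>\<zeta>. \<phi>' \<zeta> * \<gamma>' \<zeta> * \<zeta> \<partial>\<mu>) \<le> e / (A + B + 1) * (A + B)"
      using e AB by (intro limc) (auto intro!: divide_pos_pos)
    also have "\<dots> \<le> e" using e AB by (simp add: field_simps)
    finally show "norm (\<integral>\<zeta>. \<phi>' \<zeta> * \<gamma>' \<zeta> * \<zeta> \<partial>\<mu>) \<le> 0 + e" by simp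
  qed
  then show ?thesis using eq by simp
qed

section \<open>Outer functions\<close>

definition herglotz :: "(complex \<Rightarrow> real) \<Rightarrow> complex \<Rightarrow> complex" where
  "herglotz k z = (\<integral>\<zeta>. (\<zeta> + z) / (\<zeta> - z) * of_real (k \<zeta>) \<partial>\<mu>)"

text \<open>The outer function with boundary modulus \<open>exp k\<close> that is positive at the origin.\<close>

definition outer_exp :: "(complex \<Rightarrow> real) \<Rightarrow> complex \<Rightarrow> complex" where
  "outer_exp k z = exp (herglotz k z)"

lemma herglotz_kernel_eq:
  assumes "norm z < 1" "norm \<zeta> = 1"
  shows "(\<zeta> + z) / (\<zeta> - z) = 2 / (1 - z * cnj \<zeta>) - 1"
proof -
  have 1: "\<zeta> - z = \<zeta> * (1 - z * cnj \<zeta>)" and 2: "\<zeta> + z = \<zeta> * (1 + z * cnj \<zeta>)"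
    using circle_cnj[OF assms(2)] by (simp_all add: algebra_simps)
  have "\<zeta> \<noteq> 0" using assms by auto
  moreover have "1 - z * cnj \<zeta> \<noteq> 0" by (rule cauchy_kernel_nonzero[OF assms])
  ultimately show ?thesis
    unfolding 1 2 by (simp add: divide_simps)
qed

lemma integrable_herglotz:
  assumes "integrable \<mu> k" "norm z < 1"
  shows "integrable \<mu> (\<lambda>\<zeta>. (\<zeta> + z) / (\<zeta> - z) * of_real (k \<zeta>))"
proof -
  have k: "integrable \<mu> (\<lambda>\<zeta>. of_real (k \<zeta>) :: complex)" using assms(1) by simp
  have "integrable \<mu> (\<lambda>\<zeta>. 2 * (of_real (k \<zeta>) / (1 - z * cnj \<zeta>)) - of_real (k \<zeta>))"
    using integrable_cauchy[OF k assms(2)] k by (intro Bochner_Integration.integrable_diff integrable_mult_right)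
  then show ?thesis
  proof (rule Bochner_Integration.integrable_cong[THEN iffD1, rotated -1])
    fix \<zeta> assume "\<zeta> \<in> space \<mu>"
    then show "2 * (of_real (k \<zeta>) / (1 - z * cnj \<zeta>)) - of_real (k \<zeta>) = (\<zeta> + z) / (\<zeta> - z) * of_real (k \<zeta>)"
      by (simp add: herglotz_kernel_eq[OF assms(2)] algebra_simps)
  qed simp
qed

lemma herglotz_eq_cauchy:
  assumes "integrable \<mu> k" "norm z < 1"
  shows "herglotz k z = 2 * cauchy_integral (\<lambda>\<zeta>. of_real (k \<zeta>)) z - of_real (\<integral>\<zeta>. k \<zeta> \<partial>\<mu>)"
proof -
  have k: "integrable \<mu> (\<lambda>\<zeta>. of_real (k \<zeta>) :: complex)" using assms(1) by simp
  note c = integrable_cauchy[OF k assms(2)]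
  have "herglotz k z = (\<integral>\<zeta>. 2 * (of_real (k \<zeta>) / (1 - z * cnj \<zeta>)) - of_real (k \<zeta>) \<partial>\<mu>)"
    unfolding herglotz_def
    by (rule Bochner_Integration.integral_cong) (simp_all add: herglotz_kernel_eq[OF assms(2)] algebra_simps)
  also have "\<dots> = 2 * (\<integral>\<zeta>. of_real (k \<zeta>) / (1 - z * cnj \<zeta>) \<partial>\<mu>) - (\<integral>\<zeta>. of_real (k \<zeta>) \<partial>\<mu>)"
    using Bochner_Integration.integral_diff[OF integrable_mult_right[of 2, OF c] k]
      Bochner_Integration.integral_mult_right[of 2, OF c] by simp
  finally show ?thesis
    unfolding cauchy_integral_def by (simp only: integral_complex_of_real)
qed

lemma holomorphic_herglotz:
  assumes "integrable \<mu> k"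
  shows "herglotz k holomorphic_on ball 0 1"
proof (rule holomorphic_transform)
  show "(\<lambda>z. 2 * cauchy_integral (\<lambda>\<zeta>. of_real (k \<zeta>)) z - of_real (\<integral>\<zeta>. k \<zeta> \<partial>\<mu>)) holomorphic_on ball 0 1"
    using assms by (intro holomorphic_intros holomorphic_cauchy_integral) simp
qed (use assms in \<open>simp add: herglotz_eq_cauchy\<close>)

lemma Re_herglotz:
  assumes "integrable \<mu> k" "norm z < 1"
  shows "Re (herglotz k z) = poisson_integral k z"
proof -
  have "Re (herglotz k z) = (\<integral>\<zeta>. Re ((\<zeta> + z) / (\<zeta> - z) * of_real (k \<zeta>)) \<partial>\<mu>)"
    unfolding herglotz_def using integral_Re[OF integrable_herglotz[OF assms]] by simp
  also have "\<dots> = poisson_integral k z"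
    unfolding poisson_integral_def
  proof (rule Bochner_Integration.integral_cong[OF refl])
    fix \<zeta> assume "\<zeta> \<in> space \<mu>"
    then have \<zeta>: "norm \<zeta> = 1" by simp
    have "Re (2 / (1 - z * cnj \<zeta>)) = 2 * Re (1 / (1 - z * cnj \<zeta>))"
      by (simp add: Re_divide)
    then show "Re ((\<zeta> + z) / (\<zeta> - z) * of_real (k \<zeta>)) = poisson_kernel z \<zeta> *\<^sub>R k \<zeta>"
      unfolding herglotz_kernel_eq[OF assms(2) \<zeta>] poisson_kernel_cauchy[OF assms(2) \<zeta>] by simp
  qed
  finally show ?thesis .
qed

lemma herglotz_add:
  assumes "integrable \<mu> k" "integrable \<mu> l" "norm z < 1"
  shows "herglotz (\<lambda>\<zeta>. k \<zeta> + l \<zeta>) z = herglotz k z + herglotz l z"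
  unfolding herglotz_def
  using Bochner_Integration.integral_add[OF integrable_herglotz[OF assms(1,3)] integrable_herglotz[OF assms(2,3)]]
  by (simp add: distrib_left)

lemma herglotz_mult:
  assumes "integrable \<mu> k" "norm z < 1"
  shows "herglotz (\<lambda>\<zeta>. c * k \<zeta>) z = of_real c * herglotz k z"
proof -
  have "herglotz (\<lambda>\<zeta>. c * k \<zeta>) z = (\<integral>\<zeta>. of_real c * ((\<zeta> + z) / (\<zeta> - z) * of_real (k \<zeta>)) \<partial>\<mu>)"
    unfolding herglotz_def by (simp add: mult_ac)
  also have "\<dots> = of_real c * herglotz k z"
    unfolding herglotz_def
    by (rule Bochner_Integration.integral_mult_right) (rule integrable_herglotz[OF assms])
  finally show ?thesis .
qed

lemma outer_exp_nonzero: "outer_exp k z \<noteq> 0"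
  by (simp add: outer_exp_def)

lemma holomorphic_outer_exp:
  "integrable \<mu> k \<Longrightarrow> outer_exp k holomorphic_on ball 0 1"
  unfolding outer_exp_def[abs_def] by (intro holomorphic_intros holomorphic_herglotz)

lemma norm_outer_exp:
  "integrable \<mu> k \<Longrightarrow> norm z < 1 \<Longrightarrow> norm (outer_exp k z) = exp (poisson_integral k z)"
  by (simp add: outer_exp_def Re_herglotz)

lemma outer_exp_add:
  "integrable \<mu> k \<Longrightarrow> integrable \<mu> l \<Longrightarrow> norm z < 1 \<Longrightarrow>
    outer_exp (\<lambda>\<zeta>. k \<zeta> + l \<zeta>) z = outer_exp k z * outer_exp l z"
  by (simp add: outer_exp_def herglotz_add exp_add)

lemma outer_exp_mult:
  "integrable \<mu> k \<Longrightarrow> norm z < 1 \<Longrightarrow>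
    outer_exp (\<lambda>\<zeta>. c * k \<zeta>) z = exp (of_real c * herglotz k z)"
  by (simp add: outer_exp_def herglotz_mult)

lemma outer_function_outer_exp:
  "integrable \<mu> k \<Longrightarrow> outer_function (outer_exp k)"
  unfolding outer_function_def outer_exp_def herglotz_def
  by (intro exI[of _ 1] exI[of _ k]) auto

text \<open>Jensen's inequality for the probability measure with the Poisson kernel as density; integrate the
  tangent to the exponential function at the mean \<open>m\<close>.\<close>

lemma exp_poisson_integral_le:
  fixes k :: "complex \<Rightarrow> real"
  assumes k: "integrable \<mu> k" "integrable \<mu> (\<lambda>\<zeta>. exp (k \<zeta>))" and z: "norm z < 1"
  shows "exp (poisson_integral k z) \<le> poisson_integral (\<lambda>\<zeta>. exp (k \<zeta>)) z"
proof -
  define m where "m = poisson_integral k z"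
  have tangent: "exp m * (1 - m) + exp m * x \<le> exp x" for x
  proof -
    have "exp m * (1 + (x - m)) \<le> exp m * exp (x - m)"
      by (intro mult_left_mono exp_ge_add_one_self) auto
    then show ?thesis by (simp add: exp_diff algebra_simps)
  qed
  have "exp m = exp m * (1 - m) + exp m * m" by (simp add: algebra_simps)
  also have "\<dots> = poisson_integral (\<lambda>\<zeta>. exp m * (1 - m) + exp m * k \<zeta>) z"
  proof -
    have "poisson_integral (\<lambda>\<zeta>. exp m * (1 - m) + exp m * k \<zeta>) z =
       (\<integral>\<zeta>. exp m * (1 - m) * poisson_kernel z \<zeta> + exp m * (poisson_kernel z \<zeta> * k \<zeta>) \<partial>\<mu>)"
      unfolding poisson_integral_def by (simp add: algebra_simps)
    also have "\<dots> = exp m * (1 - m) + exp m * m"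
      using integrable_poisson_real[OF k(1) z] integrable_poisson_real[of "\<lambda>_. 1" z] z integral_poisson_kernel[OF z]
      by (simp add: m_def poisson_integral_def)
    finally show ?thesis by simp
  qed
  also have "\<dots> \<le> poisson_integral (\<lambda>\<zeta>. exp (k \<zeta>)) z"
    using k z tangent by (intro poisson_integral_mono) auto
  finally show ?thesis by (simp add: m_def)
qed

text \<open>The Poisson integral is the real part of a function that is analytic in the disk, to which the
  mean value property applies.\<close>

lemma integral_poisson_dilate:
  fixes u :: "complex \<Rightarrow> real"
  assumes u: "integrable \<mu> u" and r: "0 \<le> r" "r < 1"
  shows "integrable \<mu> (\<lambda>\<zeta>. poisson_integral u (of_real r * \<zeta>))"
    "(\<integral>\<zeta>. poisson_integral u (of_real r * \<zeta>) \<partial>\<mu>) = (\<integral>\<zeta>. u \<zeta> \<partial>\<mu>)"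
proof -
  note H = holomorphic_herglotz[OF u]
  have Re: "poisson_integral u (of_real r * \<zeta>) = Re (herglotz u (of_real r * \<zeta>))" if "norm \<zeta> = 1" for \<zeta>
    using that r by (subst Re_herglotz[OF u]) (auto simp: norm_mult)
  have int: "integrable \<mu> (\<lambda>\<zeta>. herglotz u (of_real r * \<zeta>))"
    by (rule integrable_circle_continuous[OF continuous_dilate[OF H r]])
  have "integrable \<mu> (\<lambda>\<zeta>. Re (herglotz u (of_real r * \<zeta>)))" using int by simp
  then show "integrable \<mu> (\<lambda>\<zeta>. poisson_integral u (of_real r * \<zeta>))"
    by (rule Bochner_Integration.integrable_cong[THEN iffD1, rotated -1]) (simp_all add: Re)
  have "(\<integral>\<zeta>. herglotz u (of_real r * \<zeta>) \<partial>\<mu>) = taylor_coeff (herglotz u) 0"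
    using dilate_coeff(1)[OF H r, of 0] by simp
  also have "\<dots> = of_real (\<integral>\<zeta>. u \<zeta> \<partial>\<mu>)"
    by (simp add: taylor_coeff_def herglotz_eq_cauchy[OF u] cauchy_integral_def)
  finally have *: "(\<integral>\<zeta>. herglotz u (of_real r * \<zeta>) \<partial>\<mu>) = of_real (\<integral>\<zeta>. u \<zeta> \<partial>\<mu>)" .
  have "(\<integral>\<zeta>. poisson_integral u (of_real r * \<zeta>) \<partial>\<mu>) = (\<integral>\<zeta>. Re (herglotz u (of_real r * \<zeta>)) \<partial>\<mu>)"
    by (rule Bochner_Integration.integral_cong) (simp_all add: Re)
  also have "\<dots> = Re (\<integral>\<zeta>. herglotz u (of_real r * \<zeta>) \<partial>\<mu>)"
    by (rule integral_Re[OF int])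
  finally show "(\<integral>\<zeta>. poisson_integral u (of_real r * \<zeta>) \<partial>\<mu>) = (\<integral>\<zeta>. u \<zeta> \<partial>\<mu>)"
    unfolding * by simp
qed

text \<open>By Jensen's inequality the \<open>p\<close>-th power of the modulus of an outer function is dominated by the
  Poisson integral of the \<open>p\<close>-th power of its boundary modulus, and Poisson integrals have constant
  means over circles.\<close>

lemma Hardy_bounded_times_outer:
  assumes B: "B holomorphic_on ball 0 1" "\<And>z. norm z < 1 \<Longrightarrow> norm (B z) \<le> C"
    and k: "integrable \<mu> k" "integrable \<mu> (\<lambda>\<zeta>. exp (p * k \<zeta>))" and p: "0 < p"
  shows "(\<lambda>z. B z * outer_exp k z) \<in> Hardy p"
proof -
  have hol: "(\<lambda>z. B z * outer_exp k z) holomorphic_on ball 0 1"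
    by (intro holomorphic_intros B holomorphic_outer_exp k)
  have C: "0 \<le> C" using order_trans[OF norm_ge_zero B(2)[of 0]] by simp
  have pk: "integrable \<mu> (\<lambda>\<zeta>. p * k \<zeta>)" using k by simp
  have le: "norm (B z * outer_exp k z) powr p \<le> C powr p * poisson_integral (\<lambda>\<zeta>. exp (p * k \<zeta>)) z"
    if z: "norm z < 1" for z
  proof -
    have "norm (B z * outer_exp k z) powr p = norm (B z) powr p * exp (p * poisson_integral k z)"
      using norm_outer_exp[OF k(1) z] by (simp add: norm_mult powr_mult exp_powr_real mult.commute)
    also have "p * poisson_integral k z = poisson_integral (\<lambda>\<zeta>. p * k \<zeta>) z"
      unfolding poisson_integral_def by (simp add: mult.left_commute)
    also have "norm (B z) powr p * exp \<dots> \<le> C powr p * poisson_integral (\<lambda>\<zeta>. exp (p * k \<zeta>)) z"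
      using B(2)[OF z] C p exp_poisson_integral_le[OF pk k(2) z]
      by (intro mult_mono powr_mono2) auto
    finally show ?thesis .
  qed
  have "(\<integral>\<zeta>. norm (B (of_real r * \<zeta>) * outer_exp k (of_real r * \<zeta>)) powr p \<partial>\<mu>)
     \<le> C powr p * (\<integral>\<zeta>. exp (p * k \<zeta>) \<partial>\<mu>)" if r: "r \<in> {0..<1}" for r
  proof -
    have r': "0 \<le> r" "r < 1" using r by auto
    have "(\<integral>\<zeta>. norm (B (of_real r * \<zeta>) * outer_exp k (of_real r * \<zeta>)) powr p \<partial>\<mu>)
      \<le> (\<integral>\<zeta>. C powr p * poisson_integral (\<lambda>\<zeta>. exp (p * k \<zeta>)) (of_real r * \<zeta>) \<partial>\<mu>)"
    proof (rule integral_mono)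
      show "integrable \<mu> (\<lambda>\<zeta>. norm (B (of_real r * \<zeta>) * outer_exp k (of_real r * \<zeta>)) powr p)"
        using p by (intro integrable_circle_continuous continuous_on_powr' continuous_on_norm
            continuous_dilate[OF hol r'] continuous_on_const) auto
      show "integrable \<mu> (\<lambda>\<zeta>. C powr p * poisson_integral (\<lambda>\<zeta>. exp (p * k \<zeta>)) (of_real r * \<zeta>))"
        using integral_poisson_dilate(1)[OF k(2) r'] by simp
    qed (use le r' in \<open>simp add: norm_mult\<close>)
    also have "\<dots> = C powr p * (\<integral>\<zeta>. exp (p * k \<zeta>) \<partial>\<mu>)"
      using integral_poisson_dilate[OF k(2) r'] by simp
    finally show ?thesis .
  qed
  then have "bdd_above ((\<lambda>r. \<integral>\<zeta>. norm (B (of_real r * \<zeta>) * outer_exp k (of_real r * \<zeta>)) powr p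
      \<partial>\<mu>) ` {0..<1})"
    by (rule bdd_aboveI2)
  then show ?thesis
    unfolding Hardy_def using hol by simp
qed

lemma bounded_Hardy:
  assumes B: "B holomorphic_on ball 0 1" "\<And>z. norm z < 1 \<Longrightarrow> norm (B z) \<le> C" and p: "0 < p"
  shows "B \<in> Hardy p"
proof -
  have "(\<lambda>z. B z * outer_exp (\<lambda>_. 0) z) \<in> Hardy p"
    by (rule Hardy_bounded_times_outer[OF B]) (use p in auto)
  then show ?thesis by (simp add: outer_exp_def herglotz_def)
qed

text \<open>The logarithm of the modulus is a Poisson integral, whose radial limits are known.\<close>

lemma outer_exp_boundary_norm:
  assumes k: "integrable \<mu> k"
  shows "AE \<zeta> in \<mu>. \<forall>w. has_angular_limit (outer_exp k) \<zeta> w \<longrightarrow> norm w = exp (k \<zeta>)"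
  using poisson_integral_angular_limit[OF k] AE_circle_norm
proof eventually_elim
  case (elim \<zeta>)
  show ?case
  proof (intro allI impI)
    fix w assume w: "has_angular_limit (outer_exp k) \<zeta> w"
    have "(poisson_integral k \<longlongrightarrow> k \<zeta>) (at \<zeta> within stolz_region \<zeta> 2)" using elim by simp
    then have "((\<lambda>r. poisson_integral k (of_real r * \<zeta>)) \<longlongrightarrow> k \<zeta>) (at_left 1)"
      by (rule filterlim_compose) (rule filterlim_radius_stolz, use elim in auto)
    then have 1: "((\<lambda>r. exp (poisson_integral k (of_real r * \<zeta>))) \<longlongrightarrow> exp (k \<zeta>)) (at_left 1)"
      by (intro tendsto_intros)
    have 2: "((\<lambda>r. norm (outer_exp k (of_real r * \<zeta>))) \<longlongrightarrow> norm w) (at_left 1)"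
      using elim by (intro tendsto_norm has_angular_limit_radial[OF w]) auto
    have "eventually (\<lambda>r. exp (poisson_integral k (of_real r * \<zeta>)) = norm (outer_exp k (of_real r * \<zeta>))) (at_left 1)"
      by (rule eventually_at_leftI[of 0]) (use elim k in \<open>auto simp: norm_outer_exp norm_mult\<close>)
    then have "((\<lambda>r. norm (outer_exp k (of_real r * \<zeta>))) \<longlongrightarrow> exp (k \<zeta>)) (at_left 1)"
      by (rule Lim_transform_eventually[OF 1])
    with 2 show "norm w = exp (k \<zeta>)"
      using tendsto_unique trivial_limit_at_left_real by blast
  qed
qed

text \<open>Fatou's theorem for Poisson integrals controls the modulus only, not the argument. Splitting \<open>k\<close>
  into its positive and negative parts makes the outer function a quotient of two bounded ones,
  which belong to \<open>H\<^sup>2\<close> and so have boundary values.\<close>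

lemma outer_exp_boundary:
  assumes k: "integrable \<mu> k"
  obtains \<phi> where "\<phi> \<in> borel_measurable \<mu>"
    "AE \<zeta> in \<mu>. has_angular_limit (outer_exp k) \<zeta> (\<phi> \<zeta>)"
    "AE \<zeta> in \<mu>. norm (\<phi> \<zeta>) = exp (k \<zeta>)"
proof -
  have bdd: "\<exists>\<phi>. \<phi> \<in> borel_measurable \<mu> \<and>
      (AE \<zeta> in \<mu>. has_angular_limit (outer_exp u) \<zeta> (\<phi> \<zeta>))"
    if u: "integrable \<mu> u" "\<And>\<zeta>. u \<zeta> \<le> 0" for u
  proof -
    have "norm (outer_exp u z) \<le> 1" if "norm z < 1" for z
      using poisson_integral_mono[OF u(1) _ that, of "\<lambda>_. 0"] u that
      by (simp add: norm_outer_exp poisson_integral_def)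
    then have "outer_exp u \<in> Hardy 2"
      by (intro bounded_Hardy holomorphic_outer_exp u) auto
    then obtain \<phi> where "integrable \<mu> \<phi>"
      "integrable \<mu> (\<lambda>\<zeta>. (norm (\<phi> \<zeta>))\<^sup>2)"
      "AE \<zeta> in \<mu>. has_angular_limit (outer_exp u) \<zeta> (\<phi> \<zeta>)"
      "\<forall>s\<in>{0..<1}. integrable \<mu> (\<lambda>\<zeta>. (norm (\<phi> \<zeta> - outer_exp u (of_real s * \<zeta>)))\<^sup>2) \<and>
      (\<integral>\<zeta>. (norm (\<phi> \<zeta> - outer_exp u (of_real s * \<zeta>)))\<^sup>2 \<partial>\<mu>) \<le> dilation_defect (outer_exp u) s"
      "\<forall>z\<in>ball 0 1. outer_exp u z = poisson_integral \<phi> z"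
      by (rule Hardy2_boundary)
    then show ?thesis by (intro exI[of _ \<phi>]) auto
  qed
  define u where "u = (\<lambda>\<zeta>. min (k \<zeta>) 0)"
  define v where "v = (\<lambda>\<zeta>. min (- k \<zeta>) 0)"
  have u: "integrable \<mu> u" "\<And>\<zeta>. u \<zeta> \<le> 0" and v: "integrable \<mu> v" "\<And>\<zeta>. v \<zeta> \<le> 0"
    unfolding u_def v_def using k by (auto intro!: integrable_min)
  obtain \<phi> \<psi> where \<phi>: "\<phi> \<in> borel_measurable \<mu>" "AE \<zeta> in \<mu>. has_angular_limit (outer_exp u) \<zeta> (\<phi> \<zeta>)"
    and \<psi>: "\<psi> \<in> borel_measurable \<mu>" "AE \<zeta> in \<mu>. has_angular_limit (outer_exp v) \<zeta> (\<psi> \<zeta>)"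
    using bdd[OF u] bdd[OF v] by auto
  have eq: "outer_exp u z / outer_exp v z = outer_exp k z" if "norm z < 1" for z
  proof -
    have "(\<lambda>\<zeta>. k \<zeta> + v \<zeta>) = u" by (auto simp: fun_eq_iff u_def v_def min_def)
    then have "outer_exp u z = outer_exp k z * outer_exp v z"
      using outer_exp_add[OF k v(1) that] by simp
    then show ?thesis by (simp add: outer_exp_nonzero)
  qed
  have lim: "AE \<zeta> in \<mu>. has_angular_limit (outer_exp k) \<zeta> (\<phi> \<zeta> / \<psi> \<zeta>)"
    using \<phi>(2) \<psi>(2) outer_exp_boundary_norm[OF v(1)]
  proof eventually_elim
    case (elim \<zeta>)
    then have "norm (\<psi> \<zeta>) = exp (v \<zeta>)" by simp
    then have "\<psi> \<zeta> \<noteq> 0" by auto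
    with elim have "has_angular_limit (\<lambda>z. outer_exp u z / outer_exp v z) \<zeta> (\<phi> \<zeta> / \<psi> \<zeta>)"
      by (intro has_angular_limit_divide)
    then show ?case by (rule has_angular_limit_cong[rotated]) (rule eq)
  qed
  moreover have "AE \<zeta> in \<mu>. norm (\<phi> \<zeta> / \<psi> \<zeta>) = exp (k \<zeta>)"
    using lim outer_exp_boundary_norm[OF k] by eventually_elim blast
  ultimately show ?thesis
    using \<phi>(1) \<psi>(1) by (intro that[of "\<lambda>\<zeta>. \<phi> \<zeta> / \<psi> \<zeta>"]) auto
qed

section \<open>Inner-outer factorization\<close>

text \<open>Dividing a dilate by the outer function with slightly larger boundary modulus gives an analytic
  function that is almost bounded by one near the circle, hence bounded by one in the disk by the
  maximum principle. The summand \<open>\<delta>\<close> keeps the logarithm continuous at zeros on the circle.\<close>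

lemma dilate_le_poisson_log:
  assumes f: "f holomorphic_on ball 0 1" and r: "0 \<le> r" "r < 1" and \<delta>: "\<delta> > 0" and z: "norm z < 1"
  shows "norm (f (of_real r * z)) \<le> exp (poisson_integral (\<lambda>\<zeta>. ln (norm (f (of_real r * \<zeta>)) + \<delta>)) z)"
proof -
  define F where "F = (\<lambda>\<zeta>. f (of_real r * \<zeta>))"
  define u where "u = (\<lambda>\<zeta>. ln (norm (F \<zeta>) + \<delta>))"
  have Fc: "continuous_on (sphere 0 1) F"
    unfolding F_def by (rule continuous_dilate[OF f r])
  have pos: "norm (F \<zeta>) + \<delta> > 0" for \<zeta> using \<delta> by (simp add: add_nonneg_pos)
  have uc: "continuous_on (sphere 0 1) u"
    unfolding u_def using pos by (intro continuous_intros Fc) (metis less_irrefl)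
  have u: "integrable \<mu> u" by (rule integrable_circle_continuous[OF uc])
  have Fp: "poisson_integral F w = F w" if "norm w < 1" for w
    unfolding F_def by (rule poisson_integral_dilate[OF f r that])
  have Fhol: "F holomorphic_on ball 0 1"
    unfolding F_def
  proof (rule holomorphic_on_compose_gen[of "\<lambda>z. of_real r * z" _ f "ball 0 1", unfolded o_def])
    have "r * norm w < 1" if "norm w < 1" for w :: complex
      using that r mult_right_mono[of r 1 "norm w"] by simp
    then show "(\<lambda>z. of_real r * z) ` ball 0 1 \<subseteq> ball (0::complex) 1"
      using r by (auto simp: norm_mult)
  qed (intro holomorphic_intros f)+
  define g where "g = (\<lambda>z. F z / outer_exp u z)"
  have ghol: "g holomorphic_on ball 0 1"
    unfolding g_def by (intro holomorphic_intros Fhol holomorphic_outer_exp u outer_exp_nonzero)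
  have gn: "norm (g w) = norm (F w) * exp (- poisson_integral u w)" if "norm w < 1" for w
    using norm_outer_exp[OF u that] by (simp add: g_def norm_divide exp_minus field_simps)
  have bound: "norm (g z) \<le> (1 + e) * exp e" if e: "e > 0" for e
  proof -
    obtain s1 where s1: "0 < s1" "s1 < 1"
      "\<And>z. s1 \<le> norm z \<Longrightarrow> norm z < 1 \<Longrightarrow> norm (poisson_integral u z - u (sgn z)) < e"
      using poisson_integral_uniform[OF uc e] by metis
    have "0 < e * \<delta>" using e \<delta> by simp
    then obtain s2 where s2: "0 < s2" "s2 < 1"
      "\<And>z. s2 \<le> norm z \<Longrightarrow> norm z < 1 \<Longrightarrow> norm (poisson_integral F z - F (sgn z)) < e * \<delta>"
      using poisson_integral_uniform[OF Fc] by metis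
    define \<rho> where "\<rho> = max (max s1 s2) (norm z)"
    have \<rho>: "0 < \<rho>" "\<rho> < 1" "s1 \<le> \<rho>" "s2 \<le> \<rho>" "norm z \<le> \<rho>"
      using s1 s2 z by (auto simp: \<rho>_def)
    have circle: "norm (g w) \<le> (1 + e) * exp e" if w: "norm w = \<rho>" for w
    proof -
      have w1: "norm w < 1" using w \<rho> by simp
      define x where "x = norm (F (sgn w))"
      have "norm (F w - F (sgn w)) < e * \<delta>"
        using s2(3)[of w] w \<rho> Fp[OF w1] by simp
      then have "norm (F w) \<le> x + e * \<delta>"
        using norm_triangle_ineq2[of "F w" "F (sgn w)"] by (simp add: x_def)
      moreover have "x + e * \<delta> \<le> (1 + e) * (x + \<delta>)"
        using e \<delta> by (simp add: algebra_simps x_def)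
      moreover have "x + \<delta> > 0" using pos by (simp add: x_def)
      moreover have "exp (- poisson_integral u w) \<le> exp e / (x + \<delta>)"
      proof -
        have "exp (- poisson_integral u w) \<le> exp (- u (sgn w) + e)"
          using s1(3)[of w] w \<rho> by (simp add: abs_less_iff)
        also have "\<dots> = exp e / (x + \<delta>)"
          using pos[of "sgn w"] by (simp add: u_def exp_diff x_def)
        finally show ?thesis .
      qed
      ultimately have "norm (F w) * exp (- poisson_integral u w) \<le> ((1 + e) * (x + \<delta>)) * (exp e / (x + \<delta>))"
        using e by (intro mult_mono) auto
      also have "\<dots> = (1 + e) * exp e" using \<open>x + \<delta> > 0\<close> by simp
      finally show ?thesis using gn[OF w1] by simp
    qed
    show ?thesis
    proof (rule maximum_modulus_frontier[of g "cball 0 \<rho>"])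
      have sub: "cball 0 \<rho> \<subseteq> ball (0::complex) 1" using \<rho> by auto
      show "g holomorphic_on interior (cball 0 \<rho>)"
        using holomorphic_on_subset[OF ghol] sub interior_subset by blast
      show "continuous_on (closure (cball 0 \<rho>)) g"
        using holomorphic_on_imp_continuous_on[OF holomorphic_on_subset[OF ghol sub]] by simp
    qed (use circle \<rho> in auto)
  qed
  have "((\<lambda>e. (1 + e) * exp e) \<longlongrightarrow> (1 + 0) * exp (0::real)) (at_right 0)"
    by (intro tendsto_intros)
  moreover have "eventually (\<lambda>e. norm (g z) \<le> (1 + e) * exp e) (at_right 0)"
    by (rule eventually_at_rightI[of 0 1]) (use bound in auto)
  ultimately have "norm (g z) \<le> (1 + 0) * exp 0"
    by (intro tendsto_lowerbound[of _ _ "at_right 0"]) auto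
  then have "norm (F z) * exp (- poisson_integral u z) \<le> 1" using gn[OF z] by simp
  then show ?thesis by (simp add: F_def u_def exp_minus field_simps)
qed

text \<open>For \<open>x \<ge> \<delta>\<close> apply \<open>ln y \<le> y\<close> to \<open>y = \<epsilon> p x\<^sup>p\<close>; the value of \<open>C\<close> collects the remaining constants.\<close>

lemma ln_le_powr:
  fixes p \<epsilon> \<delta> :: real
  assumes "p > 0" "\<epsilon> > 0" "\<delta> > 0"
  obtains C where "0 \<le> C" "\<And>x. x \<ge> 0 \<Longrightarrow> ln (x + \<delta>) \<le> \<epsilon> * x powr p + C"
proof (rule that[of "\<bar>ln 2 - ln (\<epsilon> * p) / p\<bar> + \<bar>ln (2 * \<delta>)\<bar>"])
  fix x :: real assume x: "x \<ge> 0"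
  show "ln (x + \<delta>) \<le> \<epsilon> * x powr p + (\<bar>ln 2 - ln (\<epsilon> * p) / p\<bar> + \<bar>ln (2 * \<delta>)\<bar>)"
  proof (cases "x < \<delta>")
    case True
    then have "ln (x + \<delta>) \<le> ln (2 * \<delta>)" using x assms by simp
    moreover have "0 \<le> \<epsilon> * x powr p" using assms by simp
    ultimately show ?thesis by linarith
  next
    case False
    then have x0: "x > 0" using assms by simp
    have "ln (x + \<delta>) \<le> ln (2 * x)" using False x0 assms by simp
    also have "\<dots> = ln 2 + ln (\<epsilon> * p * x powr p) / p - ln (\<epsilon> * p) / p"
      using x0 assms by (simp add: ln_mult ln_powr field_simps)
    also have "ln (\<epsilon> * p * x powr p) \<le> \<epsilon> * p * x powr p"
      using x0 assms ln_le_minus_one[of "\<epsilon> * p * x powr p"] by simp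
    then have "ln 2 + ln (\<epsilon> * p * x powr p) / p - ln (\<epsilon> * p) / p \<le> ln 2 + (\<epsilon> * p * x powr p) / p - ln (\<epsilon> * p) / p"
      using assms divide_right_mono[of "ln (\<epsilon> * p * x powr p)" "\<epsilon> * p * x powr p" p] by simp
    also have "\<dots> = \<epsilon> * x powr p + (ln 2 - ln (\<epsilon> * p) / p)"
      using assms by simp
    also have "\<dots> \<le> \<epsilon> * x powr p + (\<bar>ln 2 - ln (\<epsilon> * p) / p\<bar> + \<bar>ln (2 * \<delta>)\<bar>)"
      by linarith
    finally show ?thesis by simp
  qed
qed simp

lemma Hardy_integral_bound:
  assumes "f \<in> Hardy p"
  obtains A where "0 \<le> A" "\<And>r. 0 \<le> r \<Longrightarrow> r < 1 \<Longrightarrow> (\<integral>\<zeta>. norm (f (of_real r * \<zeta>)) powr p \<partial>\<mu>) \<le> A"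
proof -
  obtain A where "\<forall>r\<in>{0..<1}. (\<integral>\<zeta>. norm (f (of_real r * \<zeta>)) powr p \<partial>\<mu>) \<le> A"
    using assms by (auto simp: Hardy_def bdd_above_def)
  then show ?thesis
    by (intro that[of "\<bar>A\<bar>"]) (auto intro: order_trans[OF _ abs_ge_self])
qed

lemma integrable_dilate_powr:
  assumes "f holomorphic_on ball 0 1" "0 \<le> r" "r < 1" "0 < p"
  shows "integrable \<mu> (\<lambda>\<zeta>. norm (f (of_real r * \<zeta>)) powr p)"
  using assms(4) by (intro integrable_circle_continuous continuous_on_powr' continuous_on_norm
      continuous_dilate[OF assms(1-3)] continuous_on_const) auto

text \<open>A particular sequence tending to one from below; the convergence theorems for integrals are about
  sequences.\<close>

definition radius_seq :: "nat \<Rightarrow> real" where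
  "radius_seq j = 1 - 1 / real (Suc j)"

lemma radius_seq: "0 \<le> radius_seq j" "radius_seq j < 1" "filterlim radius_seq (at_left 1) sequentially"
proof -
  show "0 \<le> radius_seq j" "radius_seq j < 1" by (simp_all add: radius_seq_def)
  have "radius_seq \<longlonglongrightarrow> 1 - 0"
    unfolding radius_seq_def[abs_def] using LIMSEQ_inverse_real_of_nat
    by (intro tendsto_diff tendsto_const) (simp add: inverse_eq_divide)
  then show "filterlim radius_seq (at_left 1) sequentially"
    unfolding filterlim_at by (simp add: radius_seq_def always_eventually)
qed

lemma AE_radius_seq_lim:
  assumes "AE \<zeta> in \<mu>. has_angular_limit f \<zeta> (\<phi> \<zeta>)"
  shows "AE \<zeta> in \<mu>. (\<lambda>j. f (of_real (radius_seq j) * \<zeta>)) \<longlonglongrightarrow> \<phi> \<zeta>"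
  using assms AE_circle_norm
  by eventually_elim (rule filterlim_compose[OF has_angular_limit_radial radius_seq(3)])

lemma Hardy_boundary_integrable:
  assumes fH: "f \<in> Hardy p" and p: "0 < p"
    and \<phi>: "\<phi> \<in> borel_measurable \<mu>" "AE \<zeta> in \<mu>. has_angular_limit f \<zeta> (\<phi> \<zeta>)"
  shows "integrable \<mu> (\<lambda>\<zeta>. norm (\<phi> \<zeta>) powr p)"
proof -
  have f: "f holomorphic_on ball 0 1" using fH by (simp add: Hardy_def)
  obtain A where A: "0 \<le> A" "\<And>r. 0 \<le> r \<Longrightarrow> r < 1 \<Longrightarrow> (\<integral>\<zeta>. norm (f (of_real r * \<zeta>)) powr p \<partial>\<mu>) \<le> A"
    using Hardy_integral_bound[OF fH] by blast
  have lim: "AE \<zeta> in \<mu>. (\<lambda>j. norm (f (of_real (radius_seq j) * \<zeta>)) powr p) \<longlonglongrightarrow> norm (\<phi> \<zeta>) powr p"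
    using AE_radius_seq_lim[OF \<phi>(2)]
    by eventually_elim (use p in \<open>auto intro!: tendsto_powr' tendsto_norm\<close>)
  show ?thesis
    by (rule integrable_fatou(1)[OF integrable_dilate_powr[OF f radius_seq(1,2) p] _ lim _ A(2)[OF radius_seq(1,2)]])
       (use \<phi>(1) in auto)
qed

text \<open>The estimate for dilates is carried over to the boundary. For suitable \<open>C\<close> the function
  \<open>h x = \<epsilon> x\<^sup>p + C - ln (x + \<delta>)\<close> is nonnegative, so Fatou's lemma applies to the Poisson means of
  \<open>h \<bar>f\<bar>\<close>. The constant \<open>C\<close>, which grows as \<open>\<epsilon>\<close> decreases, cancels in the result, and the term with
  \<open>\<epsilon>\<close> disappears in the limit because the means of \<open>\<bar>f\<bar>\<^sup>p\<close> are bounded.\<close>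

lemma Hardy_le_poisson_log:
  assumes fH: "f \<in> Hardy p" and p: "0 < p"
    and \<phi>: "\<phi> \<in> borel_measurable \<mu>" "AE \<zeta> in \<mu>. has_angular_limit f \<zeta> (\<phi> \<zeta>)"
    and \<delta>: "\<delta> > 0" and z: "norm z < 1" and fz: "f z \<noteq> 0"
  shows "integrable \<mu> (\<lambda>\<zeta>. ln (norm (\<phi> \<zeta>) + \<delta>))"
    "ln (norm (f z)) \<le> poisson_integral (\<lambda>\<zeta>. ln (norm (\<phi> \<zeta>) + \<delta>)) z"
proof -
  note \<phi>m = \<phi>(1)[measurable]
  have f: "f holomorphic_on ball 0 1" using fH by (simp add: Hardy_def)
  note \<phi>p = Hardy_boundary_integrable[OF fH p \<phi>]
  obtain A where A: "0 \<le> A" "\<And>r. 0 \<le> r \<Longrightarrow> r < 1 \<Longrightarrow> (\<integral>\<zeta>. norm (f (of_real r * \<zeta>)) powr p \<partial>\<mu>) \<le> A"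
    using Hardy_integral_bound[OF fH] by blast
  define l where "l = (\<lambda>\<zeta>. ln (norm (\<phi> \<zeta>) + \<delta>))"
  have [measurable]: "l \<in> borel_measurable \<mu>" unfolding l_def by measurable
  show l: "integrable \<mu> l"
  proof -
    obtain C where C: "0 \<le> C" "\<And>x. x \<ge> 0 \<Longrightarrow> ln (x + \<delta>) \<le> 1 * x powr p + C"
      using ln_le_powr[OF p zero_less_one \<delta>] by blast
    show ?thesis
    proof (rule Bochner_Integration.integrable_bound)
      show "integrable \<mu> (\<lambda>\<zeta>. norm (\<phi> \<zeta>) powr p + (C + \<bar>ln \<delta>\<bar>))" using \<phi>p by simp
      show "AE \<zeta> in \<mu>. norm (l \<zeta>) \<le> norm (norm (\<phi> \<zeta>) powr p + (C + \<bar>ln \<delta>\<bar>))"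
      proof (rule AE_I2)
        fix \<zeta>
        have "ln \<delta> \<le> l \<zeta>" unfolding l_def using \<delta> by (simp add: add_nonneg_pos)
        moreover have "l \<zeta> \<le> norm (\<phi> \<zeta>) powr p + C" using C(2)[of "norm (\<phi> \<zeta>)"] by (simp add: l_def)
        moreover have "0 \<le> norm (\<phi> \<zeta>) powr p" by simp
        ultimately show "norm (l \<zeta>) \<le> norm (norm (\<phi> \<zeta>) powr p + (C + \<bar>ln \<delta>\<bar>))"
          using C(1) unfolding real_norm_def by linarith
      qed
    qed simp
  qed
  define K where "K = 2 / (1 - norm z)"
  have K: "K > 0" using z by (simp add: K_def)
  have main: "ln (norm (f z)) - \<epsilon> * (K * A) - \<epsilon> \<le> poisson_integral l z" if \<epsilon>: "\<epsilon> > 0" for \<epsilon>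
  proof -
    obtain C where C: "0 \<le> C" "\<And>x. x \<ge> 0 \<Longrightarrow> ln (x + \<delta>) \<le> \<epsilon> * x powr p + C"
      using ln_le_powr[OF p \<epsilon> \<delta>] by blast
    define h where "h = (\<lambda>x::real. \<epsilon> * x powr p + C - ln (x + \<delta>))"
    have h0: "0 \<le> h x" if "x \<ge> 0" for x using C(2)[OF that] by (simp add: h_def)
    have fs: "(\<lambda>j. f (of_real (radius_seq j) * z)) \<longlonglongrightarrow> f z"
    proof -
      have "radius_seq \<longlonglongrightarrow> 1" using radius_seq(3) by (simp add: filterlim_at)
      then have "(\<lambda>j. of_real (radius_seq j) * z) \<longlonglongrightarrow> of_real 1 * z"
        by (intro tendsto_intros)
      moreover have "isCont f z"
        using f z by (intro holomorphic_on_imp_continuous_on[THEN continuous_on_interior]) auto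
      ultimately show ?thesis using isCont_tendsto_compose by fastforce
    qed
    then have "(\<lambda>j. ln (norm (f (of_real (radius_seq j) * z)))) \<longlonglongrightarrow> ln (norm (f z))"
      using fz by (intro tendsto_ln tendsto_norm) auto
    then have "eventually (\<lambda>j. ln (norm (f z)) - \<epsilon> < ln (norm (f (of_real (radius_seq j) * z)))) sequentially"
      using \<epsilon> by (intro order_tendstoD) auto
    moreover have "eventually (\<lambda>j. f (of_real (radius_seq j) * z) \<noteq> 0) sequentially"
      using fs fz by (rule tendsto_imp_eventually_ne)
    ultimately have "eventually (\<lambda>j. f (of_real (radius_seq j) * z) \<noteq> 0 \<and>
        ln (norm (f z)) - \<epsilon> < ln (norm (f (of_real (radius_seq j) * z)))) sequentially"
      by eventually_elim simp
    then obtain N where N: "\<And>j. j \<ge> N \<Longrightarrow> f (of_real (radius_seq j) * z) \<noteq> 0 \<and>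
        ln (norm (f z)) - \<epsilon> < ln (norm (f (of_real (radius_seq j) * z)))"
      unfolding eventually_sequentially by blast
    \<comment> \<open>The shift by \<open>N\<close> makes the bound \<open>D\<close> valid for all indices.\<close>
    define v where "v = (\<lambda>j \<zeta>. poisson_kernel z \<zeta> * h (norm (f (of_real (radius_seq (j + N)) * \<zeta>))))"
    define D where "D = \<epsilon> * (K * A) + C - (ln (norm (f z)) - \<epsilon>)"
    have v: "integrable \<mu> (v j) \<and> (AE \<zeta> in \<mu>. 0 \<le> v j \<zeta>) \<and>
        (\<integral>\<zeta>. v j \<zeta> \<partial>\<mu>) \<le> D" for j
    proof (intro conjI)
      define r where "r = radius_seq (j + N)"
      have r: "0 \<le> r" "r < 1" using radius_seq by (auto simp: r_def)
      define F where "F = (\<lambda>\<zeta>. f (of_real r * \<zeta>))"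
      have Fc: "continuous_on (sphere 0 1) F" unfolding F_def by (rule continuous_dilate[OF f r])
      have pos: "norm (F \<zeta>) + \<delta> > 0" for \<zeta> using \<delta> by (simp add: add_nonneg_pos)
      have i1: "integrable \<mu> (\<lambda>\<zeta>. norm (F \<zeta>) powr p)"
        unfolding F_def by (rule integrable_dilate_powr[OF f r p])
      have i2: "integrable \<mu> (\<lambda>\<zeta>. ln (norm (F \<zeta>) + \<delta>))"
        using pos by (intro integrable_circle_continuous continuous_intros Fc) (metis less_irrefl)
      have ih: "integrable \<mu> (\<lambda>\<zeta>. h (norm (F \<zeta>)))"
        unfolding h_def using i1 i2 by simp
      have vj: "v j = (\<lambda>\<zeta>. poisson_kernel z \<zeta> * h (norm (F \<zeta>)))"
        by (simp add: v_def F_def r_def)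
      show "integrable \<mu> (v j)"
        unfolding vj by (rule integrable_poisson_real[OF ih z])
      show "AE \<zeta> in \<mu>. 0 \<le> v j \<zeta>"
        unfolding vj using z by (intro AE_I2 mult_nonneg_nonneg poisson_kernel_nonneg h0) auto
      have "(\<integral>\<zeta>. v j \<zeta> \<partial>\<mu>) =
          (\<integral>\<zeta>. \<epsilon> * (poisson_kernel z \<zeta> * norm (F \<zeta>) powr p) + C * poisson_kernel z \<zeta> -
             poisson_kernel z \<zeta> * ln (norm (F \<zeta>) + \<delta>) \<partial>\<mu>)"
        unfolding vj h_def by (simp add: algebra_simps)
      also have "\<dots> = \<epsilon> * (\<integral>\<zeta>. poisson_kernel z \<zeta> * norm (F \<zeta>) powr p \<partial>\<mu>) + C -
          poisson_integral (\<lambda>\<zeta>. ln (norm (F \<zeta>) + \<delta>)) z"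
        using integrable_poisson_real[OF i1 z] integrable_poisson_real[OF i2 z]
          integrable_poisson_real[of "\<lambda>_. 1" z] z
        by (simp add: integral_poisson_kernel[OF z] poisson_integral_def)
      also have "\<dots> \<le> D"
      proof -
        have "(\<integral>\<zeta>. poisson_kernel z \<zeta> * norm (F \<zeta>) powr p \<partial>\<mu>) \<le> (\<integral>\<zeta>. K * norm (F \<zeta>) powr p \<partial>\<mu>)"
          using i1 poisson_kernel_le_center[OF z]
          by (intro integral_mono integrable_poisson_real z mult_right_mono) (auto simp: K_def)
        also have "\<dots> \<le> K * A"
          using A(2)[OF r] K by (simp add: F_def)
        finally have 1: "\<epsilon> * (\<integral>\<zeta>. poisson_kernel z \<zeta> * norm (F \<zeta>) powr p \<partial>\<mu>) \<le> \<epsilon> * (K * A)"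
          using \<epsilon> by simp
        have nz: "f (of_real r * z) \<noteq> 0" "ln (norm (f z)) - \<epsilon> < ln (norm (f (of_real r * z)))"
          using N[of "j + N"] by (auto simp: r_def)
        have "ln (norm (f (of_real r * z))) \<le> poisson_integral (\<lambda>\<zeta>. ln (norm (F \<zeta>) + \<delta>)) z"
          using dilate_le_poisson_log[OF f r \<delta> z] nz(1)
          by (simp add: F_def ln_le_cancel_iff[symmetric, of _ "exp _"] del: ln_le_cancel_iff)
        with 1 nz(2) show ?thesis by (simp add: D_def)
      qed
      finally show "(\<integral>\<zeta>. v j \<zeta> \<partial>\<mu>) \<le> D" .
    qed
    have lim: "AE \<zeta> in \<mu>. (\<lambda>j. v j \<zeta>) \<longlonglongrightarrow> poisson_kernel z \<zeta> * h (norm (\<phi> \<zeta>))"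
      using AE_radius_seq_lim[OF \<phi>(2)]
    proof eventually_elim
      case (elim \<zeta>)
      then have "(\<lambda>j. norm (f (of_real (radius_seq (j + N)) * \<zeta>))) \<longlonglongrightarrow> norm (\<phi> \<zeta>)"
        by (intro tendsto_norm LIMSEQ_ignore_initial_segment)
      moreover have "norm (\<phi> \<zeta>) + \<delta> \<noteq> 0" using \<delta> add_nonneg_pos[of "norm (\<phi> \<zeta>)" \<delta>] by simp
      ultimately show ?case
        unfolding v_def h_def using p by (auto intro!: tendsto_intros tendsto_powr')
    qed
    have m: "(\<lambda>\<zeta>. poisson_kernel z \<zeta> * h (norm (\<phi> \<zeta>))) \<in> borel_measurable \<mu>"
      unfolding h_def using measurable_poisson_kernel[OF z] by measurable
    have le: "(\<integral>\<zeta>. poisson_kernel z \<zeta> * h (norm (\<phi> \<zeta>)) \<partial>\<mu>) \<le> D"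
      by (rule integrable_fatou(2)[where u = v, OF _ _ lim m]) (use v in auto)
    have "(\<integral>\<zeta>. poisson_kernel z \<zeta> * h (norm (\<phi> \<zeta>)) \<partial>\<mu>) =
          (\<integral>\<zeta>. \<epsilon> * (poisson_kernel z \<zeta> * norm (\<phi> \<zeta>) powr p) + C * poisson_kernel z \<zeta> -
             poisson_kernel z \<zeta> * l \<zeta> \<partial>\<mu>)"
      unfolding h_def l_def by (simp add: algebra_simps)
    also have "\<dots> = \<epsilon> * (\<integral>\<zeta>. poisson_kernel z \<zeta> * norm (\<phi> \<zeta>) powr p \<partial>\<mu>) + C - poisson_integral l z"
      using integrable_poisson_real[OF \<phi>p z] integrable_poisson_real[OF l z]
        integrable_poisson_real[of "\<lambda>_. 1" z] z
      by (simp add: integral_poisson_kernel[OF z] poisson_integral_def)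
    finally have "\<epsilon> * (\<integral>\<zeta>. poisson_kernel z \<zeta> * norm (\<phi> \<zeta>) powr p \<partial>\<mu>) + C - poisson_integral l z \<le> D"
      using le by simp
    moreover have "0 \<le> \<epsilon> * (\<integral>\<zeta>. poisson_kernel z \<zeta> * norm (\<phi> \<zeta>) powr p \<partial>\<mu>)"
      using \<epsilon> z by (intro mult_nonneg_nonneg Bochner_Integration.integral_nonneg poisson_kernel_nonneg) auto
    ultimately show ?thesis by (simp add: D_def)
  qed
  have "((\<lambda>\<epsilon>. ln (norm (f z)) - \<epsilon> * (K * A) - \<epsilon>) \<longlongrightarrow> ln (norm (f z)) - 0 * (K * A) - 0) (at_right 0)"
    by (intro tendsto_intros)
  moreover have "eventually (\<lambda>\<epsilon>. ln (norm (f z)) - \<epsilon> * (K * A) - \<epsilon> \<le> poisson_integral l z) (at_right 0)"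
    by (rule eventually_at_rightI[of 0 1]) (use main in auto)
  ultimately have "ln (norm (f z)) - 0 * (K * A) - 0 \<le> poisson_integral l z"
    by (intro tendsto_upperbound[of _ _ "at_right 0"]) auto
  then show "ln (norm (f z)) \<le> poisson_integral (\<lambda>\<zeta>. ln (norm (\<phi> \<zeta>) + \<delta>)) z"
    by (simp add: l_def[abs_def])
qed


text \<open>The preceding estimate for \<open>\<delta> = 1 / (j + 1)\<close>, with \<open>j\<close> tending to infinity. It bounds the Poisson
  mean of \<open>-ln \<delta>\<close> over the zero set of \<open>\<phi>\<close>, which therefore is a null set, and Fatou's lemma yields
  the integrability of \<open>ln \<bar>\<phi>\<bar>\<close>. The zero set must be treated first: \<open>ln 0 = 0\<close> is not the limit of
  \<open>ln \<delta>\<close>.\<close>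

lemma Hardy_log_integrable:
  assumes fH: "f \<in> Hardy p" and p: "0 < p"
    and \<phi>: "\<phi> \<in> borel_measurable \<mu>" "AE \<zeta> in \<mu>. has_angular_limit f \<zeta> (\<phi> \<zeta>)"
    and z: "norm z < 1" and fz: "f z \<noteq> 0"
  shows "AE \<zeta> in \<mu>. \<phi> \<zeta> \<noteq> 0"
    "integrable \<mu> (\<lambda>\<zeta>. ln (norm (\<phi> \<zeta>)))"
    "ln (norm (f z)) \<le> poisson_integral (\<lambda>\<zeta>. ln (norm (\<phi> \<zeta>))) z"
proof -
  note \<phi>m = \<phi>(1)[measurable]
  note \<phi>p = Hardy_boundary_integrable[OF fH p \<phi>]
  note Pm = measurable_poisson_kernel[OF z, measurable]
  have iP: "integrable \<mu> (poisson_kernel z)"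
    using integrable_poisson_real[of "\<lambda>_. 1" z] z by simp
  obtain C where C: "0 \<le> C" "\<And>x. x \<ge> 0 \<Longrightarrow> ln (x + 1) \<le> 1 * x powr p + C"
    using ln_le_powr[OF p zero_less_one zero_less_one] by blast
  define \<delta> where "\<delta> = (\<lambda>j. 1 / real (Suc j))"
  have \<delta>: "0 < \<delta> j" "\<delta> j \<le> 1" for j by (simp_all add: \<delta>_def)
  define v where "v = (\<lambda>j \<zeta>. poisson_kernel z \<zeta> * (norm (\<phi> \<zeta>) powr p + C - ln (norm (\<phi> \<zeta>) + \<delta> j)))"
  define M where "M = (\<integral>\<zeta>. poisson_kernel z \<zeta> * norm (\<phi> \<zeta>) powr p \<partial>\<mu>)"
  define D where "D = M + C - ln (norm (f z))"
  have split: "integrable \<mu> (\<lambda>\<zeta>. poisson_kernel z \<zeta> * (norm (\<phi> \<zeta>) powr p + C - l \<zeta>)) \<and>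
      (\<integral>\<zeta>. poisson_kernel z \<zeta> * (norm (\<phi> \<zeta>) powr p + C - l \<zeta>) \<partial>\<mu>) = M + C - poisson_integral l z"
    if l: "integrable \<mu> l" for l
  proof
    show "integrable \<mu> (\<lambda>\<zeta>. poisson_kernel z \<zeta> * (norm (\<phi> \<zeta>) powr p + C - l \<zeta>))"
      using \<phi>p l by (intro integrable_poisson_real z) auto
    have "(\<integral>\<zeta>. poisson_kernel z \<zeta> * (norm (\<phi> \<zeta>) powr p + C - l \<zeta>) \<partial>\<mu>) =
        (\<integral>\<zeta>. poisson_kernel z \<zeta> * norm (\<phi> \<zeta>) powr p + C * poisson_kernel z \<zeta> - poisson_kernel z \<zeta> * l \<zeta> \<partial>\<mu>)"
      by (simp add: algebra_simps)
    also have "\<dots> = M + C - poisson_integral l z"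
      using integrable_poisson_real[OF \<phi>p z] integrable_poisson_real[OF l z] iP
      by (simp add: M_def integral_poisson_kernel[OF z] poisson_integral_def)
    finally show "(\<integral>\<zeta>. poisson_kernel z \<zeta> * (norm (\<phi> \<zeta>) powr p + C - l \<zeta>) \<partial>\<mu>) = M + C - poisson_integral l z" .
  qed
  have vi: "integrable \<mu> (v j)" and vle: "(\<integral>\<zeta>. v j \<zeta> \<partial>\<mu>) \<le> D" for j
    using split[OF Hardy_le_poisson_log(1)[OF fH p \<phi> \<delta>(1) z fz]]
      Hardy_le_poisson_log(2)[OF fH p \<phi> \<delta>(1) z fz, of j]
    by (simp_all add: v_def D_def)
  have v0: "0 \<le> v j \<zeta>" for j \<zeta>
  proof -
    have "ln (norm (\<phi> \<zeta>) + \<delta> j) \<le> ln (norm (\<phi> \<zeta>) + 1)"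
      using \<delta>[of j] by (intro ln_mono) (auto simp: add_nonneg_pos)
    also have "\<dots> \<le> norm (\<phi> \<zeta>) powr p + C" using C(2)[of "norm (\<phi> \<zeta>)"] by simp
    finally show ?thesis
      unfolding v_def using z by (intro mult_nonneg_nonneg poisson_kernel_nonneg) auto
  qed
  define Z where "Z = {\<zeta> \<in> space \<mu>. \<phi> \<zeta> = 0}"
  have Z: "Z \<in> sets \<mu>" unfolding Z_def by measurable
  \<comment> \<open>The Poisson measure of the zero set \<open>Z\<close>.\<close>
  define \<kappa> where "\<kappa> = (\<integral>\<zeta>. indicator Z \<zeta> * poisson_kernel z \<zeta> \<partial>\<mu>)"
  have iZ: "integrable \<mu> (\<lambda>\<zeta>. indicator Z \<zeta> * poisson_kernel z \<zeta>)"
    using integrable_circle_mult[OF iP, of "indicator Z" 1] Z by (simp add: indicator_le_1)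
  have "\<kappa> * ln (real (Suc j)) \<le> D" for j
  proof -
    have "\<kappa> * ln (real (Suc j)) = (\<integral>\<zeta>. indicator Z \<zeta> * poisson_kernel z \<zeta> * ln (real (Suc j)) \<partial>\<mu>)"
      by (simp add: \<kappa>_def)
    also have "\<dots> \<le> (\<integral>\<zeta>. v j \<zeta> \<partial>\<mu>)"
    proof (rule integral_mono[OF _ vi])
      show "integrable \<mu> (\<lambda>\<zeta>. indicator Z \<zeta> * poisson_kernel z \<zeta> * ln (real (Suc j)))"
        using iZ by simp
      fix \<zeta>
      show "indicator Z \<zeta> * poisson_kernel z \<zeta> * ln (real (Suc j)) \<le> v j \<zeta>"
      proof (cases "\<zeta> \<in> Z")
        case True
        then have "v j \<zeta> = poisson_kernel z \<zeta> * (C + ln (real (Suc j)))"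
          using p by (simp add: v_def Z_def \<delta>_def ln_div)
        then show ?thesis
          using True C(1) z by (simp add: mult_left_mono poisson_kernel_nonneg)
      next
        case False
        then show ?thesis using v0 by simp
      qed
    qed
    also note vle
    finally show ?thesis .
  qed
  moreover have "0 \<le> \<kappa>"
    unfolding \<kappa>_def using z by (intro Bochner_Integration.integral_nonneg) (auto simp: poisson_kernel_nonneg)
  ultimately have "\<kappa> = 0"
  proof -
    have False if "\<kappa> > 0"
    proof -
      obtain n :: nat where n: "exp (D / \<kappa>) < real n" using reals_Archimedean2 by blast
      then have "exp (D / \<kappa>) < real (Suc n)" by simp
      then have "D / \<kappa> < ln (real (Suc n))"
        by (metis exp_less_cancel_iff exp_ln of_nat_0_less_iff zero_less_Suc)
      then have "D < \<kappa> * ln (real (Suc n))" using that by (simp add: field_simps)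
      then show False using \<open>\<kappa> * ln (real (Suc n)) \<le> D\<close> by simp
    qed
    then show ?thesis using \<open>0 \<le> \<kappa>\<close> by force
  qed
  then have "AE \<zeta> in \<mu>. indicator Z \<zeta> * poisson_kernel z \<zeta> = 0"
    unfolding \<kappa>_def using z
    by (subst (asm) integral_nonneg_eq_0_iff_AE[OF iZ]) (auto simp: poisson_kernel_nonneg)
  then show nz: "AE \<zeta> in \<mu>. \<phi> \<zeta> \<noteq> 0"
    using AE_space[of \<mu>]
  proof eventually_elim
    case (elim \<zeta>)
    then show ?case using poisson_kernel_pos[OF z, of \<zeta>] by (auto simp: Z_def indicator_def)
  qed
  define w where "w = (\<lambda>\<zeta>. poisson_kernel z \<zeta> * (norm (\<phi> \<zeta>) powr p + C - ln (norm (\<phi> \<zeta>))))"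
  have wm: "w \<in> borel_measurable \<mu>" unfolding w_def by measurable
  have "\<delta> \<longlonglongrightarrow> 0"
    unfolding \<delta>_def using LIMSEQ_inverse_real_of_nat by (simp add: inverse_eq_divide)
  have lim: "AE \<zeta> in \<mu>. (\<lambda>j. v j \<zeta>) \<longlonglongrightarrow> w \<zeta>"
    using nz
  proof (eventually_elim)
    case (elim \<zeta>)
    have "(\<lambda>j. norm (\<phi> \<zeta>) + \<delta> j) \<longlonglongrightarrow> norm (\<phi> \<zeta>) + 0"
      by (intro tendsto_intros \<open>\<delta> \<longlonglongrightarrow> 0\<close>)
    then have "(\<lambda>j. ln (norm (\<phi> \<zeta>) + \<delta> j)) \<longlonglongrightarrow> ln (norm (\<phi> \<zeta>))"
      using elim by (intro tendsto_ln) auto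
    then show ?case unfolding v_def w_def by (intro tendsto_mult tendsto_diff tendsto_const)
  qed
  have w: "integrable \<mu> w" "(\<integral>\<zeta>. w \<zeta> \<partial>\<mu>) \<le> D"
    using integrable_fatou[OF vi _ lim wm vle] v0 by auto
  have "integrable \<mu> (\<lambda>\<zeta>. norm (\<phi> \<zeta>) powr p + C - inverse (poisson_kernel z \<zeta>) *\<^sub>R w \<zeta>)"
  proof (intro Bochner_Integration.integrable_diff Bochner_Integration.integrable_add \<phi>p)
    show "integrable \<mu> (\<lambda>\<zeta>. inverse (poisson_kernel z \<zeta>) *\<^sub>R w \<zeta>)"
    proof (rule integrable_circle_mult[OF w(1), where B = "4 / (1 - (norm z)\<^sup>2)"])
      show "(\<lambda>\<zeta>. inverse (poisson_kernel z \<zeta>)) \<in> borel_measurable \<mu>" by measurable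
      fix \<zeta> :: complex assume \<zeta>: "norm \<zeta> = 1"
      have z2: "0 < 1 - (norm z)\<^sup>2" using z by (simp add: abs_square_less_1)
      have "norm (\<zeta> - z) \<le> 2" using norm_triangle_ineq4[of \<zeta> z] \<zeta> z by simp
      then have "(norm (\<zeta> - z))\<^sup>2 \<le> 2\<^sup>2" by (intro power_mono) auto
      then have "(norm (\<zeta> - z))\<^sup>2 / (1 - (norm z)\<^sup>2) \<le> 4 / (1 - (norm z)\<^sup>2)"
        using z2 by (intro divide_right_mono) auto
      then show "\<bar>inverse (poisson_kernel z \<zeta>)\<bar> \<le> 4 / (1 - (norm z)\<^sup>2)"
        using poisson_kernel_pos[OF z \<zeta>] z2 by (simp add: poisson_kernel_def)
    qed
  qed simp
  then show l: "integrable \<mu> (\<lambda>\<zeta>. ln (norm (\<phi> \<zeta>)))"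
  proof (rule Bochner_Integration.integrable_cong[THEN iffD1, rotated -1])
    fix \<zeta> assume "\<zeta> \<in> space \<mu>"
    then have "poisson_kernel z \<zeta> \<noteq> 0" using poisson_kernel_pos[OF z, of \<zeta>] by simp
    then show "norm (\<phi> \<zeta>) powr p + C - inverse (poisson_kernel z \<zeta>) *\<^sub>R w \<zeta> = ln (norm (\<phi> \<zeta>))"
      by (simp add: w_def mult.assoc[symmetric])
  qed simp
  show "ln (norm (f z)) \<le> poisson_integral (\<lambda>\<zeta>. ln (norm (\<phi> \<zeta>))) z"
    using split[OF l] w(2) by (simp add: w_def D_def)
qed

text \<open>The quotient of \<open>f\<close> by the outer function with the same boundary modulus is bounded by one, by the
  estimate above, and has boundary values of modulus one.\<close>

theorem Hardy_inner_outer: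
  assumes fH: "f \<in> Hardy p" and p: "0 < p"
    and \<phi>: "\<phi> \<in> borel_measurable \<mu>" "AE \<zeta> in \<mu>. has_angular_limit f \<zeta> (\<phi> \<zeta>)"
    and z0: "norm z0 < 1" "f z0 \<noteq> 0"
  obtains I where "inner_function I" "\<And>z. norm z < 1 \<Longrightarrow> norm (I z) \<le> 1"
    "\<And>z. norm z < 1 \<Longrightarrow> f z = I z * outer_exp (\<lambda>\<zeta>. ln (norm (\<phi> \<zeta>))) z"
proof -
  define k where "k = (\<lambda>\<zeta>. ln (norm (\<phi> \<zeta>)))"
  have f: "f holomorphic_on ball 0 1" using fH by (simp add: Hardy_def)
  note log = Hardy_log_integrable[OF fH p \<phi>, folded k_def]
  note k = log(2)[OF z0]
  define I where "I = (\<lambda>z. f z / outer_exp k z)"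
  have I: "I holomorphic_on ball 0 1"
    unfolding I_def by (intro holomorphic_intros f holomorphic_outer_exp k outer_exp_nonzero)
  have I1: "norm (I z) \<le> 1" if z: "norm z < 1" for z
  proof (cases "f z = 0")
    case False
    have "norm (f z) = exp (ln (norm (f z)))" using False by simp
    also have "\<dots> \<le> exp (poisson_integral k z)" using log(3)[OF z False] by simp
    also have "\<dots> = norm (outer_exp k z)" by (rule norm_outer_exp[OF k z, symmetric])
    finally show ?thesis
      by (simp add: I_def norm_divide divide_le_eq_1 outer_exp_nonzero)
  qed (simp add: I_def)
  obtain \<psi> where \<psi>: "AE \<zeta> in \<mu>. has_angular_limit (outer_exp k) \<zeta> (\<psi> \<zeta>)"
    "AE \<zeta> in \<mu>. norm (\<psi> \<zeta>) = exp (k \<zeta>)"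
    using outer_exp_boundary[OF k] by blast
  have "AE \<zeta> in \<mu>. \<exists>w. has_angular_limit I \<zeta> w \<and> norm w = 1"
    using \<phi>(2) \<psi> log(1)[OF z0]
  proof eventually_elim
    case (elim \<zeta>)
    have "\<psi> \<zeta> \<noteq> 0" using elim(3) by auto
    then have "has_angular_limit I \<zeta> (\<phi> \<zeta> / \<psi> \<zeta>)"
      unfolding I_def by (intro has_angular_limit_divide elim)
    moreover have "norm (\<phi> \<zeta> / \<psi> \<zeta>) = 1"
      using elim by (simp add: norm_divide k_def)
    ultimately show ?case by blast
  qed
  moreover have "bounded (I ` ball 0 1)"
    using I1 by (auto simp: bounded_iff intro!: exI[of _ 1])
  ultimately have "inner_function I"
    using I by (simp add: inner_function_def)
  then show ?thesis
    using I1 by (rule that) (auto simp: I_def outer_exp_nonzero k_def[symmetric])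
qed

section \<open>Boundary values\<close>

interpretation circle: complete_measure \<mu>
  unfolding circle_measure_eq by (rule completion.complete_measure_axioms)

lemma measurable_circle_cong_AE:
  assumes f: "f \<in> measurable \<mu> N" and ae: "AE \<zeta> in \<mu>. f \<zeta> = g \<zeta>"
    and g: "\<And>\<zeta>. g \<zeta> \<in> space N"
  shows "g \<in> measurable \<mu> N"
proof (rule measurableI)
  fix A assume A: "A \<in> sets N"
  show "g -` A \<inter> space \<mu> \<in> sets \<mu>"
  proof (rule circle.in_sets_AE)
    show "f -` A \<inter> space \<mu> \<in> sets \<mu>"
      using f A by (rule measurable_sets)
    show "AE \<zeta> in \<mu>. \<zeta> \<in> f -` A \<inter> space \<mu> \<longleftrightarrow> \<zeta> \<in> g -` A \<inter> space \<mu>"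
      using ae by eventually_elim simp
  qed simp
qed (rule g)

text \<open>Completeness of the measure makes \<^const>\<open>boundary_value\<close> measurable, whatever its values are at the
  points without an angular limit.\<close>

lemma boundary_value_measurable:
  assumes "\<phi> \<in> borel_measurable \<mu>" "AE \<zeta> in \<mu>. has_angular_limit f \<zeta> (\<phi> \<zeta>)"
  shows "boundary_value f \<in> borel_measurable \<mu>"
    "AE \<zeta> in \<mu>. has_angular_limit f \<zeta> (boundary_value f \<zeta>)"
    "AE \<zeta> in \<mu>. boundary_value f \<zeta> = \<phi> \<zeta>"
proof -
  show ae: "AE \<zeta> in \<mu>. boundary_value f \<zeta> = \<phi> \<zeta>"
    using assms(2) AE_circle_norm by eventually_elim (rule boundary_value_eq)
  then have "AE \<zeta> in \<mu>. \<phi> \<zeta> = boundary_value f \<zeta>"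
    by eventually_elim simp
  with assms(1) show "boundary_value f \<in> borel_measurable \<mu>"
    by (rule measurable_circle_cong_AE) simp
  show "AE \<zeta> in \<mu>. has_angular_limit f \<zeta> (boundary_value f \<zeta>)"
    using ae assms(2) by eventually_elim simp
qed

lemma Hardy2_boundary_value:
  assumes "f \<in> Hardy 2"
  shows "boundary_value f \<in> borel_measurable \<mu>"
    "AE \<zeta> in \<mu>. has_angular_limit f \<zeta> (boundary_value f \<zeta>)"
proof -
  obtain \<phi> where \<phi>: "integrable \<mu> \<phi>"
    "integrable \<mu> (\<lambda>\<zeta>. (norm (\<phi> \<zeta>))\<^sup>2)"
    "AE \<zeta> in \<mu>. has_angular_limit f \<zeta> (\<phi> \<zeta>)"
    "\<forall>s\<in>{0..<1}. integrable \<mu> (\<lambda>\<zeta>. (norm (\<phi> \<zeta> - f (of_real s * \<zeta>)))\<^sup>2) \<and>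
      (\<integral>\<zeta>. (norm (\<phi> \<zeta> - f (of_real s * \<zeta>)))\<^sup>2 \<partial>\<mu>) \<le> dilation_defect f s"
    "\<forall>z\<in>ball 0 1. f z = poisson_integral \<phi> z"
    by (rule Hardy2_boundary[OF assms])
  then show "boundary_value f \<in> borel_measurable \<mu>"
    "AE \<zeta> in \<mu>. has_angular_limit f \<zeta> (boundary_value f \<zeta>)"
    using boundary_value_measurable[of \<phi> f] by auto
qed

lemma outer_exp_boundary_value:
  assumes "integrable \<mu> k"
  shows "boundary_value (outer_exp k) \<in> borel_measurable \<mu>"
    "AE \<zeta> in \<mu>. has_angular_limit (outer_exp k) \<zeta> (boundary_value (outer_exp k) \<zeta>)"
    "AE \<zeta> in \<mu>. norm (boundary_value (outer_exp k) \<zeta>) = exp (k \<zeta>)"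
proof -
  obtain \<phi> where \<phi>: "\<phi> \<in> borel_measurable \<mu>"
    "AE \<zeta> in \<mu>. has_angular_limit (outer_exp k) \<zeta> (\<phi> \<zeta>)"
    "AE \<zeta> in \<mu>. norm (\<phi> \<zeta>) = exp (k \<zeta>)"
    by (rule outer_exp_boundary[OF assms])
  note bv = boundary_value_measurable[OF \<phi>(1,2)]
  show "boundary_value (outer_exp k) \<in> borel_measurable \<mu>"
    "AE \<zeta> in \<mu>. has_angular_limit (outer_exp k) \<zeta> (boundary_value (outer_exp k) \<zeta>)"
    by (rule bv)+
  show "AE \<zeta> in \<mu>. norm (boundary_value (outer_exp k) \<zeta>) = exp (k \<zeta>)"
    using bv(3) \<phi>(3) by eventually_elim simp
qed

lemma inner_function_bounded:
  assumes "inner_function I"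
  obtains C where "I holomorphic_on ball 0 1" "\<And>z. norm z < 1 \<Longrightarrow> norm (I z) \<le> C"
proof -
  obtain C where "\<forall>x\<in>I ` ball 0 1. norm x \<le> C"
    using assms unfolding inner_function_def bounded_iff by blast
  then show ?thesis using assms that[of C] by (auto simp: inner_function_def)
qed

lemma inner_function_boundary_value:
  assumes "inner_function I"
  shows "boundary_value I \<in> borel_measurable \<mu>"
    "AE \<zeta> in \<mu>. has_angular_limit I \<zeta> (boundary_value I \<zeta>)"
    "AE \<zeta> in \<mu>. norm (boundary_value I \<zeta>) = 1"
proof -
  obtain C where "I holomorphic_on ball 0 1" "\<And>z. norm z < 1 \<Longrightarrow> norm (I z) \<le> C"
    using inner_function_bounded[OF assms] by blast
  then have "I \<in> Hardy 2" by (rule bounded_Hardy) simp_all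
  note bv = Hardy2_boundary_value[OF this]
  show "boundary_value I \<in> borel_measurable \<mu>"
    "AE \<zeta> in \<mu>. has_angular_limit I \<zeta> (boundary_value I \<zeta>)"
    by (rule bv)+
  have "AE \<zeta> in \<mu>. \<exists>w. has_angular_limit I \<zeta> w \<and> norm w = 1"
    using assms by (simp add: inner_function_def)
  then show "AE \<zeta> in \<mu>. norm (boundary_value I \<zeta>) = 1"
    using AE_circle_norm by eventually_elim (use boundary_value_eq in blast)
qed

lemma outer_exp_cong_AE:
  assumes "integrable \<mu> k" "integrable \<mu> l"
    and "AE \<zeta> in \<mu>. k \<zeta> = l \<zeta>" and z: "norm z < 1"
  shows "outer_exp k z = outer_exp l z"
proof -
  have "herglotz k z = herglotz l z"
    unfolding herglotz_def
  proof (rule integral_cong_AE)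
    show "AE \<zeta> in \<mu>. (\<zeta> + z) / (\<zeta> - z) * of_real (k \<zeta>) = (\<zeta> + z) / (\<zeta> - z) * of_real (l \<zeta>)"
      using assms(3) by eventually_elim simp
  qed (use integrable_herglotz[OF assms(1) z] integrable_herglotz[OF assms(2) z] in auto)
  then show ?thesis by (simp add: outer_exp_def)
qed

lemma not_AE_circle_False: "\<not> (AE \<zeta> in \<mu>. False)"
proof
  assume "AE \<zeta> in \<mu>. False"
  then have "{\<zeta> \<in> space \<mu>. \<not> False} \<in> null_sets \<mu>"
    unfolding circle.AE_iff_null_sets .
  moreover have "{\<zeta> \<in> space \<mu>. \<not> False} = space \<mu>" by blast
  ultimately have "emeasure \<mu> (space \<mu>) = 0"
    using null_setsD1 by metis
  then show False using emeasure_circle_space by simp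
qed

lemma Hardy_nonzero:
  assumes "AE \<zeta> in \<mu>. has_angular_limit f \<zeta> (\<phi> \<zeta>)" "AE \<zeta> in \<mu>. \<phi> \<zeta> \<noteq> 0"
  obtains z where "norm z < 1" "f z \<noteq> 0"
proof -
  have "\<exists>z. norm z < 1 \<and> f z \<noteq> 0"
  proof (rule ccontr)
    assume "\<not> ?thesis"
    then have zero: "\<And>z. norm z < 1 \<Longrightarrow> 0 = f z" by auto
    have "AE \<zeta> in \<mu>. False"
      using assms AE_circle_norm
    proof eventually_elim
      case (elim \<zeta>)
      have "has_angular_limit f \<zeta> 0"
        by (rule has_angular_limit_cong[OF zero has_angular_limit_const])
      then show False using has_angular_limit_unique elim by blast
    qed
    then show False using not_AE_circle_False by blast
  qed
  then show ?thesis using that by blast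
qed

text \<open>Cauchy's theorem for functions in \<open>H\<^sup>1\<close>: halving the logarithm of the modulus of the outer function
  splits the function into two factors in \<open>H\<^sup>2\<close>.\<close>

lemma integral_bounded_times_outer:
  assumes B: "B holomorphic_on ball 0 1" "\<And>z. norm z < 1 \<Longrightarrow> norm (B z) \<le> C"
    and k: "integrable \<mu> k" "integrable \<mu> (\<lambda>\<zeta>. exp (k \<zeta>))"
    and \<gamma>: "\<gamma> \<in> borel_measurable \<mu>"
      "AE \<zeta> in \<mu>. has_angular_limit (\<lambda>z. B z * outer_exp k z) \<zeta> (\<gamma> \<zeta>)"
  shows "(\<integral>\<zeta>. \<gamma> \<zeta> * \<zeta> \<partial>\<mu>) = 0"
proof -
  have k2: "integrable \<mu> (\<lambda>\<zeta>. 1 / 2 * k \<zeta>)" using k by simp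
  have e2: "integrable \<mu> (\<lambda>\<zeta>. exp (2 * (1 / 2 * k \<zeta>)))" using k by simp
  define h where "h = outer_exp (\<lambda>\<zeta>. 1 / 2 * k \<zeta>)"
  have H1: "(\<lambda>z. B z * h z) \<in> Hardy 2"
    unfolding h_def by (rule Hardy_bounded_times_outer[OF B k2 e2]) simp_all
  have H2: "(\<lambda>z. 1 * h z) \<in> Hardy 2"
    unfolding h_def by (rule Hardy_bounded_times_outer[OF _ _ k2 e2, of _ 1]) auto
  note bv1 = Hardy2_boundary_value[OF H1] and bv2 = Hardy2_boundary_value[OF H2]
  have "(\<integral>\<zeta>. \<gamma> \<zeta> * \<zeta> \<partial>\<mu>) =
     (\<integral>\<zeta>. boundary_value (\<lambda>z. B z * h z) \<zeta> * boundary_value (\<lambda>z. 1 * h z) \<zeta> * \<zeta> \<partial>\<mu>)"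
  proof (rule integral_cong_AE)
    show "AE \<zeta> in \<mu>. \<gamma> \<zeta> * \<zeta> = boundary_value (\<lambda>z. B z * h z) \<zeta> * boundary_value (\<lambda>z. 1 * h z) \<zeta> * \<zeta>"
      using \<gamma>(2) bv1(2) bv2(2) AE_circle_norm
    proof eventually_elim
      case (elim \<zeta>)
      have "B z * h z * (1 * h z) = B z * outer_exp k z" if "norm z < 1" for z
        using outer_exp_add[OF k2 k2 that] by (simp add: h_def)
      then have "has_angular_limit (\<lambda>z. B z * outer_exp k z) \<zeta>
          (boundary_value (\<lambda>z. B z * h z) \<zeta> * boundary_value (\<lambda>z. 1 * h z) \<zeta>)"
        using has_angular_limit_mult[OF elim(2,3)] by (rule has_angular_limit_cong)
      from has_angular_limit_unique[OF elim(1) this elim(4)] show ?case by simp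
    qed
  qed (use \<gamma>(1) bv1(1) bv2(1) in measurable)
  also have "\<dots> = 0"
    by (rule Hardy2_product_orthogonal[OF H1 H2 bv1 bv2])
  finally show ?thesis .
qed

section \<open>Best approximation and the dual function\<close>

text \<open>Up to the factor \<open>p\<close> the gradient of \<open>\<bar>w\<bar>\<^sup>p\<close>. For \<open>p < 2\<close> the first factor is singular at zero, where
  the convention \<open>0 powr a = 0\<close> gives the value zero.\<close>

definition dual_fn :: "real \<Rightarrow> complex \<Rightarrow> complex" where
  "dual_fn p w = of_real (norm w powr (p - 2)) * cnj w"

lemma Re_of_real_mult: "Re (of_real r * z) = r * Re z"
  by simp

lemma norm_dual_fn: "norm (dual_fn p w) = norm w powr (p - 1)"
proof (cases "w = 0")
  case False
  then have "norm w powr (p - 2) * norm w powr 1 = norm w powr (p - 1)"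
    by (simp only: powr_add[symmetric]) simp
  then show ?thesis using False by (simp add: dual_fn_def norm_mult)
qed (simp add: dual_fn_def)

lemma measurable_dual_fn [measurable]:
  assumes f: "f \<in> borel_measurable M"
  shows "(\<lambda>x. dual_fn p (f x)) \<in> borel_measurable M"
proof -
  have 1: "(\<lambda>x. norm (f x)) \<in> borel_measurable M"
    by (rule measurable_compose[OF f borel_measurable_continuous_onI]) (intro continuous_intros)
  have 2: "(\<lambda>x. cnj (f x)) \<in> borel_measurable M"
    by (rule measurable_compose[OF f borel_measurable_continuous_onI]) (intro continuous_intros)
  show ?thesis
    unfolding dual_fn_def scaleR_conv_of_real[symmetric]
    by (intro borel_measurable_scaleR powr_real_measurable 1 2) simp
qed

text \<open>For \<open>y = 1\<close> this is Bernoulli's inequality, which follows from the inequality of the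
  weighted means with weights \<open>1 / p\<close> and \<open>1 - 1 / p\<close>; the general case is obtained by scaling.\<close>

lemma powr_tangent:
  fixes x y p :: real
  assumes "0 \<le> x" "0 < y" "1 \<le> p"
  shows "y powr p + p * y powr (p - 1) * (x - y) \<le> x powr p"
proof -
  have t: "1 + p * (t - 1) \<le> t powr p" if "0 \<le> t" for t
  proof (cases "t = 0")
    case False
    then have "(t powr p) powr (1 / p) * 1 powr (1 - 1 / p) \<le> 1 / p * t powr p + (1 - 1 / p) * 1"
      using that assms by (intro Youngs_inequality_0) auto
    then have "t \<le> 1 / p * t powr p + (1 - 1 / p)"
      using that assms by (simp add: powr_powr)
    then have "p * t \<le> p * (1 / p * t powr p + (1 - 1 / p))"
      using assms by (intro mult_left_mono) auto
    also have "\<dots> = t powr p + (p - 1)" using assms by (simp add: algebra_simps)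
    finally show ?thesis by (simp add: algebra_simps)
  qed (use assms in simp)
  have "y powr p * (1 + p * (x / y - 1)) \<le> y powr p * (x / y) powr p"
    using assms by (intro mult_left_mono t) auto
  also have "\<dots> = x powr p"
    using assms by (simp add: powr_divide)
  also have "y powr p * (1 + p * (x / y - 1)) = y powr p + p * (y powr p / y) * (x - y)"
    using assms by (simp add: field_simps)
  also have "y powr p / y = y powr (p - 1)"
    using assms by (simp add: powr_diff)
  finally show ?thesis .
qed

text \<open>The real inequality for the moduli combined with \<open>Re (cnj w a) \<le> \<bar>w\<bar> \<bar>a\<bar>\<close>.\<close>

lemma norm_powr_tangent:
  assumes "1 \<le> p"
  shows "norm w powr p + p * Re (dual_fn p w * (a - w)) \<le> norm a powr p"
proof (cases "w = 0")
  case False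
  then have w: "0 < norm w" by simp
  have "Re (cnj w * a) \<le> norm w * norm a"
    using complex_Re_le_cmod[of "cnj w * a"] by (simp add: norm_mult)
  moreover have "Re (cnj w * w) = norm w * norm w"
    by (simp add: cmod_power2[symmetric] power2_eq_square[symmetric])
  ultimately have "Re (cnj w * (a - w)) \<le> norm w * (norm a - norm w)"
    by (simp add: algebra_simps)
  then have "norm w powr (p - 2) * Re (cnj w * (a - w)) \<le> norm w powr (p - 2) * (norm w * (norm a - norm w))"
    by (intro mult_left_mono) auto
  moreover have "norm w powr (p - 2) * norm w = norm w powr (p - 1)"
    using norm_dual_fn[of p w] by (simp add: dual_fn_def norm_mult)
  moreover have "Re (dual_fn p w * (a - w)) = norm w powr (p - 2) * Re (cnj w * (a - w))"
    unfolding dual_fn_def mult.assoc by (rule Re_of_real_mult)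
  ultimately have "Re (dual_fn p w * (a - w)) \<le> norm w powr (p - 1) * (norm a - norm w)"
    by (metis mult.assoc)
  then have "p * Re (dual_fn p w * (a - w)) \<le> p * (norm w powr (p - 1) * (norm a - norm w))"
    using assms by (intro mult_left_mono) auto
  moreover have "norm w powr p + p * (norm w powr (p - 1) * (norm a - norm w)) \<le> norm a powr p"
    using powr_tangent[of "norm a" "norm w" p] w assms by (simp only: mult.assoc norm_ge_zero)
  ultimately show ?thesis by linarith
qed (simp add: dual_fn_def)

lemma norm_add_powr_le:
  fixes a b :: complex
  assumes "0 \<le> p"
  shows "norm (a + b) powr p \<le> 2 powr p * (norm a powr p + norm b powr p)"
proof -
  define m where "m = max (norm a) (norm b)"
  have "norm (a + b) \<le> 2 * m"
    using norm_triangle_ineq[of a b] by (simp add: m_def)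
  then have "norm (a + b) powr p \<le> (2 * m) powr p"
    using assms by (intro powr_mono2) auto
  also have "\<dots> = 2 powr p * m powr p"
    by (simp add: powr_mult m_def)
  also have "m powr p \<le> norm a powr p + norm b powr p"
    by (simp add: m_def max_def)
  finally show ?thesis by (simp add: mult_left_mono)
qed

text \<open>A crude form of Young's inequality that also covers \<open>p = 1\<close>.\<close>

lemma powr_minus_one_mult_le:
  fixes x y p :: real
  assumes "0 \<le> x" "0 \<le> y" "1 \<le> p"
  shows "x powr (p - 1) * y \<le> x powr p + y powr p"
proof (cases "y \<le> x")
  case True
  have "x powr (p - 1) * y \<le> x powr (p - 1) * x" using True by (intro mult_left_mono) auto
  also have "\<dots> = x powr p"
    using assms by (cases "x = 0") (auto simp: powr_diff)
  finally show ?thesis by (simp add: add_increasing2)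
next
  case False
  then have "x powr (p - 1) * y \<le> y powr (p - 1) * y"
    using assms by (intro mult_right_mono powr_mono2) auto
  also have "\<dots> = y powr p"
    using assms False by (auto simp: powr_diff)
  finally show ?thesis by (simp add: add_increasing)
qed

lemma Lp_circle_diff:
  assumes "f \<in> Lp_circle p" "g \<in> Lp_circle p" "0 \<le> p"
  shows "(\<lambda>\<zeta>. f \<zeta> - g \<zeta>) \<in> Lp_circle p"
proof -
  have m: "f \<in> borel_measurable \<mu>" "g \<in> borel_measurable \<mu>"
    using assms by (auto simp: Lp_circle_def)
  have int: "integrable \<mu> (\<lambda>\<zeta>. 2 powr p * (norm (f \<zeta>) powr p + norm (g \<zeta>) powr p))"
    using assms by (auto simp: Lp_circle_def)
  have "integrable \<mu> (\<lambda>\<zeta>. norm (f \<zeta> - g \<zeta>) powr p)"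
  proof (rule Bochner_Integration.integrable_bound[OF int])
    show "AE \<zeta> in \<mu>. norm (norm (f \<zeta> - g \<zeta>) powr p) \<le> norm (2 powr p * (norm (f \<zeta>) powr p + norm (g \<zeta>) powr p))"
      using norm_add_powr_le[OF assms(3), of "f \<zeta>" "- g \<zeta>" for \<zeta>] by (intro AE_I2) simp
  qed (use m in measurable)
  then show ?thesis using m by (simp add: Lp_circle_def)
qed

lemma integrable_dual_fn_mult:
  assumes f: "f \<in> Lp_circle p" and h: "h \<in> Lp_circle p" and p: "1 \<le> p"
  shows "integrable \<mu> (\<lambda>\<zeta>. dual_fn p (f \<zeta>) * h \<zeta>)"
proof -
  have m: "f \<in> borel_measurable \<mu>" "h \<in> borel_measurable \<mu>"
    using f h by (auto simp: Lp_circle_def)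
  have int: "integrable \<mu> (\<lambda>\<zeta>. norm (f \<zeta>) powr p + norm (h \<zeta>) powr p)"
    using f h by (auto simp: Lp_circle_def)
  show ?thesis
  proof (rule Bochner_Integration.integrable_bound[OF int])
    show "AE \<zeta> in \<mu>. norm (dual_fn p (f \<zeta>) * h \<zeta>) \<le> norm (norm (f \<zeta>) powr p + norm (h \<zeta>) powr p)"
      using powr_minus_one_mult_le[OF _ _ p, of "norm (f \<zeta>)" "norm (h \<zeta>)" for \<zeta>]
      by (intro AE_I2) (simp add: norm_mult norm_dual_fn)
  qed (use m in measurable)
qed

lemma Hardy_boundary_Lp:
  assumes "h \<in> boundary_functions (Hardy p)" "0 < p"
  shows "h \<in> Lp_circle p"
  using assms Hardy_boundary_integrable by (auto simp: boundary_functions_def Lp_circle_def)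

lemma Lp_norm_le_iff:
  assumes p: "0 < p"
  shows "Lp_norm p f \<le> Lp_norm p g \<longleftrightarrow>
    (\<integral>\<zeta>. norm (f \<zeta>) powr p \<partial>\<mu>) \<le> (\<integral>\<zeta>. norm (g \<zeta>) powr p \<partial>\<mu>)"
    (is "_ \<longleftrightarrow> ?A \<le> ?B")
proof -
  have "0 \<le> ?A" "0 \<le> ?B" by auto
  then show ?thesis
    unfolding Lp_norm_def using p powr_mono2[of "1 / p" ?A ?B] powr_less_mono2[of "1 / p" ?B ?A]
    by (auto simp: not_le[symmetric])
qed

lemma zero_boundary_function: "(\<lambda>\<zeta>. 0) \<in> boundary_functions (Hardy p)"
proof -
  have "(\<lambda>z. 0) \<in> Hardy p" by (auto simp: Hardy_def bdd_above_def)
  then show ?thesis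
    unfolding boundary_functions_def using has_angular_limit_const[of 0]
    by (auto intro!: bexI[of _ "\<lambda>z. 0"])
qed

lemma badly_approximable_iff:
  assumes g: "g \<in> Lp_circle p" and p: "0 < p"
  shows "badly_approximable p g \<longleftrightarrow> (\<forall>h\<in>boundary_functions (Hardy p).
    (\<integral>\<zeta>. norm (g \<zeta>) powr p \<partial>\<mu>) \<le> (\<integral>\<zeta>. norm (g \<zeta> - h \<zeta>) powr p \<partial>\<mu>))"
proof -
  let ?N = "\<lambda>h. Lp_norm p (\<lambda>\<zeta>. g \<zeta> - h \<zeta>)"
  have bdd: "bdd_below (?N ` boundary_functions (Hardy p))"
    by (rule bdd_belowI[of _ 0]) (auto simp: Lp_norm_def)
  have "Lp_norm p g = (INF h\<in>boundary_functions (Hardy p). ?N h) \<longleftrightarrow>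
      (\<forall>h\<in>boundary_functions (Hardy p). Lp_norm p g \<le> ?N h)"
  proof
    assume *: "Lp_norm p g = (INF h\<in>boundary_functions (Hardy p). ?N h)"
    show "\<forall>h\<in>boundary_functions (Hardy p). Lp_norm p g \<le> ?N h"
      unfolding * using cINF_lower[OF bdd] by blast
  next
    assume *: "\<forall>h\<in>boundary_functions (Hardy p). Lp_norm p g \<le> ?N h"
    show "Lp_norm p g = (INF h\<in>boundary_functions (Hardy p). ?N h)"
    proof (rule antisym)
      show "Lp_norm p g \<le> (INF h\<in>boundary_functions (Hardy p). ?N h)"
        using * zero_boundary_function by (intro cINF_greatest) auto
      show "(INF h\<in>boundary_functions (Hardy p). ?N h) \<le> Lp_norm p g"
        using cINF_lower[OF bdd zero_boundary_function] by simp
    qed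
  qed
  then show ?thesis
    using g by (simp add: badly_approximable_def Lp_norm_le_iff[OF p])
qed

text \<open>Integrate the tangent inequality at \<open>g\<close>; the linear term vanishes by hypothesis.\<close>

lemma orthogonal_badly_approximable:
  assumes g: "g \<in> Lp_circle p" and p: "1 \<le> p"
    and orth: "\<And>h. h \<in> boundary_functions (Hardy p) \<Longrightarrow> (\<integral>\<zeta>. dual_fn p (g \<zeta>) * h \<zeta> \<partial>\<mu>) = 0"
  shows "badly_approximable p g"
proof -
  have p0: "0 < p" using p by simp
  show ?thesis
    unfolding badly_approximable_iff[OF g p0]
  proof
    fix h assume h: "h \<in> boundary_functions (Hardy p)"
    note hL = Hardy_boundary_Lp[OF h p0]
    note int = integrable_dual_fn_mult[OF g hL p]
    have intRe: "integrable \<mu> (\<lambda>\<zeta>. Re (dual_fn p (g \<zeta>) * h \<zeta>))"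
      using int by (rule integrable_Re)
    have gp: "integrable \<mu> (\<lambda>\<zeta>. norm (g \<zeta>) powr p)"
      using g by (simp add: Lp_circle_def)
    have "(\<integral>\<zeta>. Re (dual_fn p (g \<zeta>) * h \<zeta>) \<partial>\<mu>) = 0"
      using integral_Re[OF int] orth[OF h] by simp
    then have "(\<integral>\<zeta>. norm (g \<zeta>) powr p \<partial>\<mu>) =
        (\<integral>\<zeta>. norm (g \<zeta>) powr p - p * Re (dual_fn p (g \<zeta>) * h \<zeta>) \<partial>\<mu>)"
      using intRe gp by simp
    also have "\<dots> \<le> (\<integral>\<zeta>. norm (g \<zeta> - h \<zeta>) powr p \<partial>\<mu>)"
    proof (rule integral_mono)
      show "integrable \<mu> (\<lambda>\<zeta>. norm (g \<zeta>) powr p - p * Re (dual_fn p (g \<zeta>) * h \<zeta>))"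
        using intRe gp by simp
      show "integrable \<mu> (\<lambda>\<zeta>. norm (g \<zeta> - h \<zeta>) powr p)"
        using Lp_circle_diff[OF g hL] p by (simp add: Lp_circle_def)
      fix \<zeta>
      show "norm (g \<zeta>) powr p - p * Re (dual_fn p (g \<zeta>) * h \<zeta>) \<le> norm (g \<zeta> - h \<zeta>) powr p"
        using norm_powr_tangent[OF p, of "g \<zeta>" "g \<zeta> - h \<zeta>"] by (simp add: algebra_simps)
    qed
    finally show "(\<integral>\<zeta>. norm (g \<zeta>) powr p \<partial>\<mu>) \<le> (\<integral>\<zeta>. norm (g \<zeta> - h \<zeta>) powr p \<partial>\<mu>)" .
  qed
qed

text \<open>Moving from \<open>g\<close> a small step \<open>t\<close> in the direction \<open>-h\<close> does not decrease the norm. The tangent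
  inequality is applied at the moved point \<open>g - t h\<close>, rather than at \<open>g\<close>; it then bounds the linear
  term from above, and the limit \<open>t \<rightarrow> 0\<close> is taken by dominated convergence. For \<open>p = 1\<close> the dual
  function is discontinuous at zero, so this uses that \<open>g\<close> vanishes almost nowhere.\<close>

lemma badly_approximable_variation:
  assumes bad: "badly_approximable p g" and p: "1 \<le> p" and nz: "AE \<zeta> in \<mu>. g \<zeta> \<noteq> 0"
    and h: "h \<in> borel_measurable \<mu>" "\<And>\<zeta>. norm \<zeta> = 1 \<Longrightarrow> norm (h \<zeta>) \<le> 1"
    and cone: "\<And>t. (\<lambda>\<zeta>. of_real t * h \<zeta>) \<in> boundary_functions (Hardy p)"
  shows "(\<integral>\<zeta>. Re (dual_fn p (g \<zeta>) * h \<zeta>) \<partial>\<mu>) \<le> 0"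
proof -
  have p0: "0 < p" using p by simp
  have g: "g \<in> Lp_circle p" using bad by (simp add: badly_approximable_def)
  have gm: "g \<in> borel_measurable \<mu>" using g by (simp add: Lp_circle_def)
  note [measurable] = gm h(1)
  note min = bad[unfolded badly_approximable_iff[OF g p0], rule_format, OF cone]
  define t where "t = (\<lambda>j. 1 / real (Suc j))"
  have t: "0 < t j" "t j \<le> 1" for j by (simp_all add: t_def)
  have tlim: "t \<longlonglongrightarrow> 0"
    unfolding t_def using LIMSEQ_inverse_real_of_nat by (simp add: inverse_eq_divide)
  define w where "w = (\<lambda>j \<zeta>. g \<zeta> - of_real (t j) * h \<zeta>)"
  have wL: "w j \<in> Lp_circle p" for j
    unfolding w_def using Lp_circle_diff[OF g Hardy_boundary_Lp[OF cone p0]] p0 by simp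
  have hL: "h \<in> Lp_circle p"
    using Hardy_boundary_Lp[OF cone[of 1] p0] by simp
  have neg: "(\<integral>\<zeta>. Re (dual_fn p (w j \<zeta>) * h \<zeta>) \<partial>\<mu>) \<le> 0" for j
  proof -
    have intRe: "integrable \<mu> (\<lambda>\<zeta>. Re (dual_fn p (w j \<zeta>) * h \<zeta>))"
      using integrable_dual_fn_mult[OF wL hL p] by (rule integrable_Re)
    have wp: "integrable \<mu> (\<lambda>\<zeta>. norm (w j \<zeta>) powr p)"
      using wL by (simp add: Lp_circle_def)
    have "(\<integral>\<zeta>. norm (w j \<zeta>) powr p \<partial>\<mu>) + p * t j * (\<integral>\<zeta>. Re (dual_fn p (w j \<zeta>) * h \<zeta>) \<partial>\<mu>)
       = (\<integral>\<zeta>. norm (w j \<zeta>) powr p + p * t j * Re (dual_fn p (w j \<zeta>) * h \<zeta>) \<partial>\<mu>)"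
      using intRe wp by simp
    also have "\<dots> \<le> (\<integral>\<zeta>. norm (g \<zeta>) powr p \<partial>\<mu>)"
    proof (rule integral_mono)
      show "integrable \<mu> (\<lambda>\<zeta>. norm (w j \<zeta>) powr p + p * t j * Re (dual_fn p (w j \<zeta>) * h \<zeta>))"
        using intRe wp by simp
      show "integrable \<mu> (\<lambda>\<zeta>. norm (g \<zeta>) powr p)"
        using g by (simp add: Lp_circle_def)
      fix \<zeta>
      have "Re (dual_fn p (w j \<zeta>) * (of_real (t j) * h \<zeta>)) = t j * Re (dual_fn p (w j \<zeta>) * h \<zeta>)"
        by (metis Re_of_real_mult mult.left_commute)
      then show "norm (w j \<zeta>) powr p + p * t j * Re (dual_fn p (w j \<zeta>) * h \<zeta>) \<le> norm (g \<zeta>) powr p"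
        using norm_powr_tangent[OF p, of "w j \<zeta>" "g \<zeta>"] by (simp add: w_def mult.assoc)
    qed
    also have "\<dots> \<le> (\<integral>\<zeta>. norm (w j \<zeta>) powr p \<partial>\<mu>)"
      unfolding w_def by (rule min)
    finally show ?thesis
      using p t[of j] by (simp add: mult_le_0_iff)
  qed
  have "(\<lambda>j. \<integral>\<zeta>. Re (dual_fn p (w j \<zeta>) * h \<zeta>) \<partial>\<mu>) \<longlonglongrightarrow>
      (\<integral>\<zeta>. Re (dual_fn p (g \<zeta>) * h \<zeta>) \<partial>\<mu>)"
  proof (rule integral_dominated_convergence[where w = "\<lambda>\<zeta>. 2 powr p * (norm (g \<zeta>) powr p + 1) + 1"])
    show "integrable \<mu> (\<lambda>\<zeta>. 2 powr p * (norm (g \<zeta>) powr p + 1) + 1)"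
      using g by (simp add: Lp_circle_def)
    show "AE \<zeta> in \<mu>. (\<lambda>j. Re (dual_fn p (w j \<zeta>) * h \<zeta>)) \<longlonglongrightarrow> Re (dual_fn p (g \<zeta>) * h \<zeta>)"
      using nz
    proof eventually_elim
      case (elim \<zeta>)
      have "(\<lambda>j. w j \<zeta>) \<longlonglongrightarrow> g \<zeta> - of_real 0 * h \<zeta>"
        unfolding w_def by (intro tendsto_intros tlim)
      then show ?case
        unfolding dual_fn_def using elim by (auto intro!: tendsto_intros)
    qed
    show "AE \<zeta> in \<mu>. norm (Re (dual_fn p (w j \<zeta>) * h \<zeta>)) \<le> 2 powr p * (norm (g \<zeta>) powr p + 1) + 1" for j
    proof (rule AE_I2)
      fix \<zeta> assume "\<zeta> \<in> space \<mu>"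
      then have h1: "norm (h \<zeta>) \<le> 1" using h(2) by simp
      have "norm (Re (dual_fn p (w j \<zeta>) * h \<zeta>)) \<le> norm (w j \<zeta>) powr (p - 1) * norm (h \<zeta>)"
        using abs_Re_le_cmod[of "dual_fn p (w j \<zeta>) * h \<zeta>"] by (simp add: norm_mult norm_dual_fn)
      also have "\<dots> \<le> norm (w j \<zeta>) powr (p - 1) * 1"
        using h1 by (intro mult_left_mono) auto
      also have "\<dots> \<le> norm (w j \<zeta>) powr p + 1 powr p"
        by (rule powr_minus_one_mult_le) (use p in auto)
      also have "norm (w j \<zeta>) powr p \<le> 2 powr p * (norm (g \<zeta>) powr p + norm (of_real (t j) * h \<zeta>) powr p)"
        unfolding w_def using norm_add_powr_le[of p "g \<zeta>" "- (of_real (t j) * h \<zeta>)"] p by simp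
      also have "norm (of_real (t j) * h \<zeta>) powr p \<le> 1"
        using h1 t[of j] p by (intro powr_le1) (auto simp: norm_mult intro: mult_le_one)
      finally show "norm (Re (dual_fn p (w j \<zeta>) * h \<zeta>)) \<le> 2 powr p * (norm (g \<zeta>) powr p + 1) + 1"
        by (simp add: mult_left_mono)
    qed
  qed (unfold w_def, measurable)
  then show ?thesis
    by (rule LIMSEQ_le_const2) (use neg in auto)
qed

text \<open>Apply the variational inequality to \<open>c \<zeta>\<^sup>n\<close> with the unimodular \<open>c\<close> that makes the integral
  nonnegative.\<close>

lemma badly_approximable_orthogonal_powers:
  assumes bad: "badly_approximable p g" and p: "1 \<le> p" and nz: "AE \<zeta> in \<mu>. g \<zeta> \<noteq> 0"
  shows "(\<integral>\<zeta>. dual_fn p (g \<zeta>) * \<zeta> ^ n \<partial>\<mu>) = 0"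
proof (rule ccontr)
  define J where "J = (\<integral>\<zeta>. dual_fn p (g \<zeta>) * \<zeta> ^ n \<partial>\<mu>)"
  assume "(\<integral>\<zeta>. dual_fn p (g \<zeta>) * \<zeta> ^ n \<partial>\<mu>) \<noteq> 0"
  then have J: "J \<noteq> 0" by (simp add: J_def)
  have p0: "0 < p" using p by simp
  define c where "c = cnj J / of_real (norm J)"
  have c: "norm c = 1" using J by (simp add: c_def norm_divide)
  have bf: "(\<lambda>\<zeta>. of_real t * (c * \<zeta> ^ n)) \<in> boundary_functions (Hardy p)" for t
  proof -
    have "(\<lambda>\<zeta>. of_real t * (c * \<zeta> ^ n)) \<in> Hardy p"
    proof (rule bounded_Hardy[OF _ _ p0])
      show "norm (of_real t * (c * z ^ n)) \<le> \<bar>t\<bar>" if "norm z < 1" for z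
        using that c by (simp add: norm_mult norm_power power_le_one mult_left_le)
    qed (intro holomorphic_intros)
    moreover have "has_angular_limit (\<lambda>\<zeta>. of_real t * (c * \<zeta> ^ n)) \<zeta> (of_real t * (c * \<zeta> ^ n))" for \<zeta>
      unfolding has_angular_limit_def by (auto intro!: tendsto_intros)
    moreover have "(\<lambda>\<zeta>. of_real t * (c * \<zeta> ^ n)) \<in> borel_measurable \<mu>"
      by (intro measurable_circle_continuous continuous_intros)
    ultimately show ?thesis unfolding boundary_functions_def by blast
  qed
  have le: "(\<integral>\<zeta>. Re (dual_fn p (g \<zeta>) * (c * \<zeta> ^ n)) \<partial>\<mu>) \<le> 0"
  proof (rule badly_approximable_variation[OF bad p nz _ _ bf])
    show "(\<lambda>\<zeta>. c * \<zeta> ^ n) \<in> borel_measurable \<mu>"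
      by (intro measurable_circle_continuous continuous_intros)
  qed (use c in \<open>simp add: norm_mult norm_power\<close>)
  have int: "integrable \<mu> (\<lambda>\<zeta>. dual_fn p (g \<zeta>) * (c * \<zeta> ^ n))"
    using integrable_dual_fn_mult[OF _ Hardy_boundary_Lp[OF bf[of 1] p0] p] bad
    by (simp add: badly_approximable_def)
  have "(\<integral>\<zeta>. Re (dual_fn p (g \<zeta>) * (c * \<zeta> ^ n)) \<partial>\<mu>) = Re (\<integral>\<zeta>. dual_fn p (g \<zeta>) * (c * \<zeta> ^ n) \<partial>\<mu>)"
    by (rule integral_Re[OF int])
  also have "(\<integral>\<zeta>. dual_fn p (g \<zeta>) * (c * \<zeta> ^ n) \<partial>\<mu>) = c * J"
    unfolding J_def by (simp add: mult.left_commute)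
  also have "c * J = of_real (norm J)"
  proof -
    have "c * J = (J * cnj J) / of_real (norm J)" by (simp add: c_def)
    also have "J * cnj J = of_real (norm J) * of_real (norm J)"
      by (simp flip: complex_norm_square add: power2_eq_square)
    finally show ?thesis using J by simp
  qed
  finally have "norm J \<le> 0" using le by simp
  then show False using J by simp
qed

section \<open>The two implications\<close>

text \<open>The Fourier coefficients of \<open>cnj \<zeta> \<psi>\<close> with negative index vanish, so its Poisson integral is
  analytic; and the modulus of a Poisson integral is dominated by that of the modulus.\<close>

lemma Hardy1_of_orthogonal:
  assumes \<psi>: "integrable \<mu> \<psi>"
    and orth: "\<And>n. (\<integral>\<zeta>. \<psi> \<zeta> * \<zeta> ^ n \<partial>\<mu>) = 0"
  obtains f where "f \<in> Hardy 1"
    "AE \<zeta> in \<mu>. has_angular_limit f \<zeta> (cnj \<zeta> * \<psi> \<zeta>)"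
proof -
  define k where "k = (\<lambda>\<zeta>. cnj \<zeta> * \<psi> \<zeta>)"
  have k: "integrable \<mu> k"
    using integrable_circle_cnj_power(1)[OF \<psi>, of 1] by (simp add: k_def mult.commute)
  have coeff: "(\<integral>\<zeta>. k \<zeta> * \<zeta> ^ Suc n \<partial>\<mu>) = 0" for n
  proof -
    have "(\<integral>\<zeta>. k \<zeta> * \<zeta> ^ Suc n \<partial>\<mu>) = (\<integral>\<zeta>. \<psi> \<zeta> * \<zeta> ^ n \<partial>\<mu>)"
    proof (rule Bochner_Integration.integral_cong[OF refl])
      fix \<zeta> assume "\<zeta> \<in> space \<mu>"
      then have "\<zeta> * cnj \<zeta> = 1" using circle_cnj by simp
      then have "(\<zeta> * cnj \<zeta>) * (\<psi> \<zeta> * \<zeta> ^ n) = \<psi> \<zeta> * \<zeta> ^ n" by simp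
      then show "k \<zeta> * \<zeta> ^ Suc n = \<psi> \<zeta> * \<zeta> ^ n" by (simp add: k_def mult_ac)
    qed
    then show ?thesis using orth by simp
  qed
  define f where "f = cauchy_integral k"
  have fP: "poisson_integral k z = f z" if "norm z < 1" for z
    unfolding f_def by (rule poisson_eq_cauchy_integral[OF k that coeff])
  have f: "f holomorphic_on ball 0 1"
    unfolding f_def by (rule holomorphic_cauchy_integral[OF k])
  have "(\<integral>\<zeta>. norm (f (of_real r * \<zeta>)) powr 1 \<partial>\<mu>) \<le> (\<integral>\<zeta>. norm (k \<zeta>) \<partial>\<mu>)"
    if "r \<in> {0..<1}" for r
  proof -
    have r: "0 \<le> r" "r < 1" using that by auto
    have nk: "integrable \<mu> (\<lambda>\<zeta>. norm (k \<zeta>))" using k by simp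
    have "(\<integral>\<zeta>. norm (f (of_real r * \<zeta>)) powr 1 \<partial>\<mu>) \<le>
        (\<integral>\<zeta>. poisson_integral (\<lambda>\<zeta>. norm (k \<zeta>)) (of_real r * \<zeta>) \<partial>\<mu>)"
    proof (rule integral_mono[OF _ integral_poisson_dilate(1)[OF nk r]])
      show "integrable \<mu> (\<lambda>\<zeta>. norm (f (of_real r * \<zeta>)) powr 1)"
        by (rule integrable_dilate_powr[OF f r]) simp
      fix \<zeta> assume "\<zeta> \<in> space \<mu>"
      then have *: "norm (of_real r * \<zeta>) < 1" using r by (simp add: norm_mult)
      show "norm (f (of_real r * \<zeta>)) powr 1 \<le> poisson_integral (\<lambda>\<zeta>. norm (k \<zeta>)) (of_real r * \<zeta>)"
        using norm_poisson_integral_le[OF k *] by (simp add: fP[OF *])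
    qed
    also have "\<dots> = (\<integral>\<zeta>. norm (k \<zeta>) \<partial>\<mu>)"
      by (rule integral_poisson_dilate(2)[OF nk r])
    finally show ?thesis .
  qed
  then have "bdd_above ((\<lambda>r. \<integral>\<zeta>. norm (f (of_real r * \<zeta>)) powr 1 \<partial>\<mu>) ` {0..<1})"
    by (rule bdd_aboveI2)
  then have "f \<in> Hardy 1" using f by (simp add: Hardy_def)
  moreover have "AE \<zeta> in \<mu>. has_angular_limit f \<zeta> (cnj \<zeta> * \<psi> \<zeta>)"
    using poisson_integral_angular_limit[OF k]
  proof eventually_elim
    case (elim \<zeta>)
    then have "has_angular_limit (poisson_integral k) \<zeta> (cnj \<zeta> * \<psi> \<zeta>)"
      by (simp add: has_angular_limit_def k_def)
    then show ?case by (rule has_angular_limit_cong[rotated]) (rule fP)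
  qed
  ultimately show ?thesis by (rule that)
qed

text \<open>In the notation of the introduction, \<open>K = ln \<bar>h\<bar>\<close> and \<open>u\<close> is the outer function belonging to \<open>K\<close>. The
  powers \<open>u\<^bsup>p/2\<^esup>\<close> and \<open>u\<^bsup>p-1\<^esup>\<close> are the outer functions belonging to the corresponding multiples of
  \<open>K\<close>.\<close>

lemma badly_approximable_imp_E_class:
  assumes \<theta>: "inner_function \<theta>" and p: "1 \<le> p" and gH: "g \<in> conj_inner_Hardy \<theta> p"
    and bad: "badly_approximable p g"
  shows "(\<lambda>\<zeta>. boundary_value \<theta> \<zeta> * g \<zeta>) \<in> boundary_functions (E_class \<theta> p)"
proof -
  have p0: "0 < p" using p by simp
  note \<theta>b = inner_function_boundary_value[OF \<theta>]
  have gL: "g \<in> Lp_circle p" using gH by (simp add: conj_inner_Hardy_def)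
  obtain h where hB: "h \<in> boundary_functions (Hardy p)"
    and gh: "AE \<zeta> in \<mu>. g \<zeta> = cnj (boundary_value \<theta> \<zeta>) * h \<zeta>"
    using gH by (auto simp: conj_inner_Hardy_def)
  obtain f where fH: "f \<in> Hardy p" and fh: "AE \<zeta> in \<mu>. has_angular_limit f \<zeta> (h \<zeta>)"
    and hm: "h \<in> borel_measurable \<mu>"
    using hB by (auto simp: boundary_functions_def)
  have \<theta>g: "AE \<zeta> in \<mu>. h \<zeta> = boundary_value \<theta> \<zeta> * g \<zeta>"
    using gh \<theta>b(3)
  proof eventually_elim
    case (elim \<zeta>)
    have "boundary_value \<theta> \<zeta> * cnj (boundary_value \<theta> \<zeta>) = 1"
      by (rule circle_cnj[OF elim(2)])
    then show ?case using elim(1) by (simp add: mult.assoc[symmetric])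
  qed
  have meas: "(\<lambda>\<zeta>. boundary_value \<theta> \<zeta> * g \<zeta>) \<in> borel_measurable \<mu>"
    by (rule measurable_circle_cong_AE[OF hm \<theta>g]) simp
  have lim: "AE \<zeta> in \<mu>. has_angular_limit f \<zeta> (boundary_value \<theta> \<zeta> * g \<zeta>)"
    using fh \<theta>g by eventually_elim simp
  have "f \<in> E_class \<theta> p"
  proof (cases "\<forall>z\<in>ball 0 1. f z = 0")
    case True
    then show ?thesis by (simp add: E_class_def)
  next
    case False
    then obtain z0 where z0: "norm z0 < 1" "f z0 \<noteq> 0" by auto
    define K where "K = (\<lambda>\<zeta>. ln (norm (h \<zeta>)))"
    note h0 = Hardy_log_integrable(1)[OF fH p0 hm fh z0]
    note K = Hardy_log_integrable(2)[OF fH p0 hm fh z0, folded K_def]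
    obtain I where I: "inner_function I"
      and fI: "\<And>z. norm z < 1 \<Longrightarrow> f z = I z * outer_exp K z"
      using Hardy_inner_outer[OF fH p0 hm fh z0, folded K_def] by metis
    have g0: "AE \<zeta> in \<mu>. g \<zeta> \<noteq> 0"
      using \<theta>g h0 by eventually_elim auto
    have gh_norm: "AE \<zeta> in \<mu>. norm (g \<zeta>) = exp (K \<zeta>)"
      using \<theta>g \<theta>b(3) h0 by eventually_elim (simp add: K_def norm_mult)
    have one: "(\<lambda>_. 1) \<in> Lp_circle p" by (simp add: Lp_circle_def)
    define \<psi> where "\<psi> = (\<lambda>\<zeta>. dual_fn p (g \<zeta>))"
    have \<psi>: "integrable \<mu> \<psi>"
      using integrable_dual_fn_mult[OF gL one p] by (simp add: \<psi>_def)
    have orth: "(\<integral>\<zeta>. \<psi> \<zeta> * \<zeta> ^ n \<partial>\<mu>) = 0" for n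
      unfolding \<psi>_def by (rule badly_approximable_orthogonal_powers[OF bad p g0])
    obtain k where kH: "k \<in> Hardy 1"
      and kb: "AE \<zeta> in \<mu>. has_angular_limit k \<zeta> (cnj \<zeta> * \<psi> \<zeta>)"
      by (rule Hardy1_of_orthogonal[OF \<psi> orth])
    have km: "(\<lambda>\<zeta>. cnj \<zeta> * \<psi> \<zeta>) \<in> borel_measurable \<mu>"
      using integrable_circle_cnj_power(1)[OF \<psi>, of 1] by (auto simp: mult.commute)
    have knorm: "AE \<zeta> in \<mu>. norm (cnj \<zeta> * \<psi> \<zeta>) = exp ((p - 1) * K \<zeta>)"
      using gh_norm AE_circle_norm
      by eventually_elim (simp add: norm_mult \<psi>_def norm_dual_fn exp_powr_real mult.commute)
    then have k0: "AE \<zeta> in \<mu>. cnj \<zeta> * \<psi> \<zeta> \<noteq> 0"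
      by eventually_elim auto
    obtain z1 where z1: "norm z1 < 1" "k z1 \<noteq> 0"
      by (rule Hardy_nonzero[OF kb k0])
    define l where "l = (\<lambda>\<zeta>. ln (norm (cnj \<zeta> * \<psi> \<zeta>)))"
    note l = Hardy_log_integrable(2)[OF kH zero_less_one km kb z1, folded l_def]
    obtain B where B: "inner_function B"
      and kB: "\<And>z. norm z < 1 \<Longrightarrow> k z = B z * outer_exp l z"
      using Hardy_inner_outer[OF kH zero_less_one km kb z1, folded l_def] by metis
    have K1: "integrable \<mu> (\<lambda>\<zeta>. (p - 1) * K \<zeta>)"
      and K2: "integrable \<mu> (\<lambda>\<zeta>. p / 2 * K \<zeta>)" using K by auto
    have lK: "AE \<zeta> in \<mu>. l \<zeta> = (p - 1) * K \<zeta>"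
      using knorm by eventually_elim (simp add: l_def)
    define F where "F = outer_exp (\<lambda>\<zeta>. p / 2 * K \<zeta>)"
    have eF: "integrable \<mu> (\<lambda>\<zeta>. exp (2 * (p / 2 * K \<zeta>)))"
    proof (rule integrable_cong_AE_imp)
      show "integrable \<mu> (\<lambda>\<zeta>. norm (g \<zeta>) powr p)"
        using gL by (simp add: Lp_circle_def)
      show "(\<lambda>\<zeta>. exp (2 * (p / 2 * K \<zeta>))) \<in> borel_measurable \<mu>" using K by measurable
      show "AE \<zeta> in \<mu>. norm (g \<zeta>) powr p = exp (2 * (p / 2 * K \<zeta>))"
        using gh_norm by eventually_elim (simp add: exp_powr_real mult.commute)
    qed
    obtain C1 where C1: "I holomorphic_on ball 0 1" "\<And>z. norm z < 1 \<Longrightarrow> norm (I z) \<le> C1"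
      using inner_function_bounded[OF I] by blast
    obtain C2 where C2: "B holomorphic_on ball 0 1" "\<And>z. norm z < 1 \<Longrightarrow> norm (B z) \<le> C2"
      using inner_function_bounded[OF B] by blast
    have IF: "(\<lambda>z. I z * F z) \<in> Hardy 2"
      unfolding F_def by (rule Hardy_bounded_times_outer[OF C1 K2 eF]) simp_all
    have BF: "(\<lambda>z. B z * F z) \<in> Hardy 2"
      unfolding F_def by (rule Hardy_bounded_times_outer[OF C2 K2 eF]) simp_all
    note Ib = inner_function_boundary_value[OF I] and Bb = inner_function_boundary_value[OF B]
      and ob = outer_exp_boundary_value[OF K] and o1b = outer_exp_boundary_value[OF K1]
      and Fb = outer_exp_boundary_value[OF K2, folded F_def]
    have FF: "outer_exp K z * outer_exp (\<lambda>\<zeta>. (p - 1) * K \<zeta>) z = F z * F z" if z: "norm z < 1" for z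
    proof -
      have "(\<lambda>\<zeta>. K \<zeta> + (p - 1) * K \<zeta>) = (\<lambda>\<zeta>. p / 2 * K \<zeta> + p / 2 * K \<zeta>)"
        by (simp add: fun_eq_iff algebra_simps)
      then show ?thesis
        using outer_exp_add[OF K K1 z] outer_exp_add[OF K2 K2 z] by (simp add: F_def)
    qed
    have kB': "k z = B z * outer_exp (\<lambda>\<zeta>. (p - 1) * K \<zeta>) z" if "norm z < 1" for z
      using kB[OF that] outer_exp_cong_AE[OF l K1 lK that] by simp
    have "AE \<zeta> in \<mu>. boundary_value (\<lambda>z. I z * F z) \<zeta> =
        cnj \<zeta> * boundary_value \<theta> \<zeta> * cnj (boundary_value (\<lambda>z. B z * F z) \<zeta>)"
      using AE_circle_norm gh \<theta>b(3) fh kb Ib(2,3) Bb(2,3) ob(2,3) o1b(2,3) Fb(2,3) gh_norm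
    proof eventually_elim
      case (elim \<zeta>)
      \<comment> \<open>Boundary values of \<open>\<theta>\<close>, \<open>I\<close>, \<open>B\<close>, \<open>u\<close>, \<open>u\<^bsup>p-1\<^esup>\<close> and \<open>F\<close>.\<close>
      define t i b u v w where "t = boundary_value \<theta> \<zeta>" and "i = boundary_value I \<zeta>"
        and "b = boundary_value B \<zeta>" and "u = boundary_value (outer_exp K) \<zeta>"
        and "v = boundary_value (outer_exp (\<lambda>\<zeta>. (p - 1) * K \<zeta>)) \<zeta>" and "w = boundary_value F \<zeta>"
      note lims = elim[folded t_def i_def b_def u_def v_def w_def]
      have IFb: "boundary_value (\<lambda>z. I z * F z) \<zeta> = i * w"
        using lims by (intro boundary_value_eq has_angular_limit_mult) auto
      have BFb: "boundary_value (\<lambda>z. B z * F z) \<zeta> = b * w"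
        using lims by (intro boundary_value_eq has_angular_limit_mult) auto
      have "has_angular_limit f \<zeta> (i * u)"
        by (rule has_angular_limit_cong[OF _ has_angular_limit_mult]) (use lims fI in auto)
      then have hiu: "h \<zeta> = i * u" using has_angular_limit_unique lims by blast
      have "has_angular_limit k \<zeta> (b * v)"
        by (rule has_angular_limit_cong[OF _ has_angular_limit_mult]) (use lims kB' in auto)
      then have kbv: "cnj \<zeta> * \<psi> \<zeta> = b * v" using has_angular_limit_unique lims by blast
      have "has_angular_limit (\<lambda>z. outer_exp K z * outer_exp (\<lambda>\<zeta>. (p - 1) * K \<zeta>) z) \<zeta> (w * w)"
        by (rule has_angular_limit_cong[OF _ has_angular_limit_mult]) (use lims FF in auto)
      moreover have "has_angular_limit (\<lambda>z. outer_exp K z * outer_exp (\<lambda>\<zeta>. (p - 1) * K \<zeta>) z) \<zeta> (u * v)"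
        using lims by (intro has_angular_limit_mult) auto
      ultimately have uv: "u * v = w * w" using has_angular_limit_unique lims by blast
      have tt: "t * cnj t = 1" and ii: "i * cnj i = 1" and zz: "\<zeta> * cnj \<zeta> = 1"
        using lims circle_cnj by auto
      define E where "E = exp (K \<zeta>)"
      have E: "E > 0" by (simp add: E_def)
      have uu: "u * cnj u = of_real (E powr 2)"
        using lims E by (simp add: complex_norm_square[symmetric] E_def)
      have ww: "w * cnj w = of_real (E powr p)"
      proof -
        have "(norm w)\<^sup>2 = E powr p"
          using lims by (simp add: E_def exp_powr_real power2_eq_square mult.commute flip: exp_add)
        then show ?thesis by (simp add: complex_norm_square[symmetric] del: of_real_power)
      qed
      have w0: "w \<noteq> 0" using lims by auto
      \<comment> \<open>Multiply the identity for \<open>\<psi>\<close> by \<open>u\<close>; the factor \<open>w\<close> is cancelled afterwards.\<close>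
      have "b * w * w = u * (b * v)" using uv by (simp add: mult_ac)
      also have "\<dots> = u * (cnj \<zeta> * (of_real (E powr (p - 2)) * (t * cnj (i * u))))"
        using lims hiu by (simp add: kbv[symmetric] \<psi>_def dual_fn_def E_def[symmetric] mult_ac)
      also have "\<dots> = cnj \<zeta> * t * cnj i * of_real (E powr (p - 2)) * (u * cnj u)"
        by (simp add: mult_ac)
      also have "\<dots> = cnj \<zeta> * t * cnj i * (w * cnj w)"
      proof -
        have "E powr (p - 2) * E powr 2 = E powr p" by (simp flip: powr_add)
        then show ?thesis unfolding uu ww by (simp flip: of_real_mult)
      qed
      finally have "b * w * w = cnj \<zeta> * t * cnj i * cnj w * w" by (simp add: mult_ac)
      then have bw: "b * w = cnj \<zeta> * t * cnj (i * w)" using w0 by simp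
      have "cnj \<zeta> * t * cnj (b * w) = (\<zeta> * cnj \<zeta>) * (t * cnj t) * (i * w)"
        unfolding bw by (simp add: mult_ac)
      then show ?case unfolding IFb BFb t_def[symmetric] tt zz by simp
    qed
    then have "(\<lambda>z. I z * F z) \<in> coinvariant \<theta>"
      unfolding coinvariant_def using IF BF by blast
    moreover have "outer_function F"
      unfolding F_def by (rule outer_function_outer_exp[OF K2])
    moreover have "analytic_power F (2 / p) (outer_exp K)"
      unfolding analytic_power_def
    proof (intro exI[of _ "herglotz (\<lambda>\<zeta>. p / 2 * K \<zeta>)"] conjI ballI)
      show "herglotz (\<lambda>\<zeta>. p / 2 * K \<zeta>) holomorphic_on ball 0 1"
        by (rule holomorphic_herglotz[OF K2])
      fix z :: complex assume "z \<in> ball 0 1"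
      then have z: "norm z < 1" by simp
      show "F z = exp (herglotz (\<lambda>\<zeta>. p / 2 * K \<zeta>) z)" by (simp add: F_def outer_exp_def)
      show "outer_exp K z = exp (of_real (2 / p) * herglotz (\<lambda>\<zeta>. p / 2 * K \<zeta>) z)"
        unfolding herglotz_mult[OF K z] outer_exp_def using p0
        by (simp add: mult.assoc[symmetric] flip: of_real_mult)
    qed
    moreover have "\<forall>z\<in>ball 0 1. f z = 1 * I z * outer_exp K z"
      using fI by simp
    ultimately show ?thesis
      unfolding E_class_def using I by blast
  qed
  with meas lim show ?thesis
    unfolding boundary_functions_def by blast
qed

text \<open>Two logarithms of \<open>F\<close> in the disk differ by a constant, because their difference has a constant
  exponential.\<close>

lemma outer_function_power:
  assumes F: "outer_function F" and G: "analytic_power F s G"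
  obtains k \<alpha> \<beta> where "integrable \<mu> k" "norm \<alpha> = 1" "norm \<beta> = 1"
    "\<forall>z\<in>ball 0 1. F z = \<alpha> * outer_exp k z"
    "\<forall>z\<in>ball 0 1. G z = \<beta> * outer_exp (\<lambda>\<zeta>. s * k \<zeta>) z"
proof -
  obtain \<alpha> and k :: "complex \<Rightarrow> real" where \<alpha>: "norm \<alpha> = 1" and k: "integrable \<mu> k"
    and Fk: "\<And>z. norm z < 1 \<Longrightarrow> F z = \<alpha> * exp (herglotz k z)"
    using F unfolding outer_function_def herglotz_def by auto
  obtain L where L: "L holomorphic_on ball 0 1"
    and FL: "\<And>z. norm z < 1 \<Longrightarrow> F z = exp (L z)"
    and GL: "\<And>z. norm z < 1 \<Longrightarrow> G z = exp (of_real s * L z)"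
    using G unfolding analytic_power_def by auto
  define D where "D = (\<lambda>z. L z - herglotz k z)"
  have D: "D holomorphic_on ball 0 1"
    unfolding D_def by (intro holomorphic_intros L holomorphic_herglotz k)
  have eD: "exp (D z) = \<alpha>" if "norm z < 1" for z
    using FL[OF that] Fk[OF that] by (simp add: D_def exp_diff nonzero_divide_eq_eq)
  have const: "D z = D 0" if z: "norm z < 1" for z
  proof (rule has_field_derivative_zero_constant[of "ball 0 1" D, THEN exE])
    show "convex (ball (0::complex) 1)" by simp
    fix w :: complex assume w: "w \<in> ball 0 1"
    have dD: "(D has_field_derivative deriv D w) (at w)"
      using holomorphic_derivI[OF D] w by simp
    then have "((\<lambda>z. exp (D z)) has_field_derivative exp (D w) * deriv D w) (at w)"
      by (rule DERIV_fun_exp)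
    moreover have "((\<lambda>z. exp (D z)) has_field_derivative 0) (at w)"
    proof (rule has_field_derivative_transform_within_open[where S = "ball 0 1" and f = "\<lambda>_. \<alpha>"])
      show "((\<lambda>_. \<alpha>) has_field_derivative 0) (at w)" by simp
    qed (use w eD in auto)
    ultimately have "exp (D w) * deriv D w = 0" by (rule DERIV_unique)
    then show "(D has_field_derivative 0) (at w within ball 0 1)"
      using dD by (auto intro: has_field_derivative_at_within)
  next
    fix c assume "\<forall>x\<in>ball 0 1. D x = c"
    then show ?thesis using z by simp
  qed
  have "norm \<alpha> = exp (Re (D 0))" using eD[of 0] by (metis norm_exp_eq_Re norm_zero zero_less_one)
  then have Re0: "Re (D 0) = 0" using \<alpha> by simp
  have "G z = exp (of_real s * D 0) * outer_exp (\<lambda>\<zeta>. s * k \<zeta>) z" if z: "norm z < 1" for z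
  proof -
    have "L z = herglotz k z + D 0" using const[OF z] by (simp add: D_def algebra_simps)
    then show ?thesis
      unfolding GL[OF z] outer_exp_mult[OF k z] by (simp add: distrib_left exp_add mult.commute)
  qed
  moreover have "norm (exp (of_real s * D 0)) = 1" using Re0 by simp
  ultimately show ?thesis
    using that[OF k \<alpha>, of "exp (of_real s * D 0)"] Fk by (simp add: outer_exp_def)
qed


lemma AE_zero_badly_approximable:
  assumes g: "g \<in> Lp_circle p" and p: "0 < p" and zero: "AE \<zeta> in \<mu>. g \<zeta> = 0"
  shows "badly_approximable p g"
proof -
  have "(\<integral>\<zeta>. norm (g \<zeta>) powr p \<partial>\<mu>) = 0"
    by (rule integral_eq_zero_AE) (use zero in \<open>eventually_elim, simp\<close>)
  then show ?thesis
    unfolding badly_approximable_iff[OF g p] by simp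
qed

text \<open>The computation of the other direction in reverse. With \<open>k = ln \<bar>F\<bar>\<close>, the element \<open>m\<close> of \<open>H\<^sup>2\<close> that
  witnesses \<open>I F \<in> K\<^sup>2\<^sub>\<theta>\<close> is an inner function \<open>B\<close> times the outer function belonging to \<open>k\<close>, and
  the dual function of \<open>g\<close> is a constant times \<open>\<zeta>\<close> times \<open>B\<close> times the outer function belonging to
  \<open>(2 - 2 / p) k\<close>. Multiplied by a function in \<open>H\<^sup>p\<close> this stays bounded times outer and is
  integrable, so that Cauchy's theorem applies.\<close>

lemma E_class_imp_badly_approximable:
  assumes \<theta>: "inner_function \<theta>" and p: "1 \<le> p" and gL: "g \<in> Lp_circle p"
    and E: "(\<lambda>\<zeta>. boundary_value \<theta> \<zeta> * g \<zeta>) \<in> boundary_functions (E_class \<theta> p)"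
  shows "badly_approximable p g"
proof -
  have p0: "0 < p" using p by simp
  note \<theta>b = inner_function_boundary_value[OF \<theta>]
  obtain u where uE: "u \<in> E_class \<theta> p"
    and ub: "AE \<zeta> in \<mu>. has_angular_limit u \<zeta> (boundary_value \<theta> \<zeta> * g \<zeta>)"
    using E by (auto simp: boundary_functions_def)
  show ?thesis
  proof (cases "\<forall>z\<in>ball 0 1. u z = 0")
    case True
    have "AE \<zeta> in \<mu>. g \<zeta> = 0"
      using ub \<theta>b(3) AE_circle_norm
    proof eventually_elim
      case (elim \<zeta>)
      have "has_angular_limit u \<zeta> 0"
        by (rule has_angular_limit_cong[OF _ has_angular_limit_const]) (use True in simp)
      then have "boundary_value \<theta> \<zeta> * g \<zeta> = 0"
        using has_angular_limit_unique elim by blast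
      then show ?case using elim by auto
    qed
    then show ?thesis by (rule AE_zero_badly_approximable[OF gL p0])
  next
    case False
    then obtain c I F G where I: "inner_function I" and F: "outer_function F"
      and IFc: "(\<lambda>z. I z * F z) \<in> coinvariant \<theta>" and G: "analytic_power F (2 / p) G"
      and u_ball: "\<forall>z\<in>ball 0 1. u z = c * I z * G z"
      using uE unfolding E_class_def by blast
    have u: "u z = c * I z * G z" if "norm z < 1" for z
      using u_ball that by simp
    have c: "c \<noteq> 0" using False u by auto
    obtain k \<alpha> \<beta> where k: "integrable \<mu> k" and \<alpha>: "norm \<alpha> = 1" and \<beta>: "norm \<beta> = 1"
      and Fk: "\<forall>z\<in>ball 0 1. F z = \<alpha> * outer_exp k z"
      and Gk: "\<forall>z\<in>ball 0 1. G z = \<beta> * outer_exp (\<lambda>\<zeta>. 2 / p * k \<zeta>) z"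
      by (rule outer_function_power[OF F G])
    obtain m where mH: "m \<in> Hardy 2" and mb: "AE \<zeta> in \<mu>. boundary_value (\<lambda>z. I z * F z) \<zeta> =
        cnj \<zeta> * boundary_value \<theta> \<zeta> * cnj (boundary_value m \<zeta>)"
      using IFc by (auto simp: coinvariant_def)
    have K2: "integrable \<mu> (\<lambda>\<zeta>. 2 / p * k \<zeta>)"
      and K3: "integrable \<mu> (\<lambda>\<zeta>. (2 - 2 / p) * k \<zeta>)" using k by auto
    note Ib = inner_function_boundary_value[OF I] and kb = outer_exp_boundary_value[OF k]
      and k2b = outer_exp_boundary_value[OF K2] and k3b = outer_exp_boundary_value[OF K3]
      and m' = Hardy2_boundary_value[OF mH]
    have IFb: "AE \<zeta> in \<mu>. boundary_value (\<lambda>z. I z * F z) \<zeta> =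
        boundary_value I \<zeta> * (\<alpha> * boundary_value (outer_exp k) \<zeta>)"
      using Ib(2) kb(2) AE_circle_norm
    proof eventually_elim
      case (elim \<zeta>)
      show ?case
      proof (rule boundary_value_eq[OF _ elim(3)], rule has_angular_limit_cong)
        show "has_angular_limit (\<lambda>z. I z * (\<alpha> * outer_exp k z)) \<zeta> (boundary_value I \<zeta> * (\<alpha> * boundary_value (outer_exp k) \<zeta>))"
          by (intro has_angular_limit_mult has_angular_limit_const elim)
      qed (simp add: Fk)
    qed
    have mnorm: "AE \<zeta> in \<mu>. norm (boundary_value m \<zeta>) = exp (k \<zeta>)"
      using mb IFb Ib(3) kb(3) \<theta>b(3) AE_circle_norm
    proof eventually_elim
      case (elim \<zeta>)
      have "norm (boundary_value I \<zeta> * (\<alpha> * boundary_value (outer_exp k) \<zeta>)) =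
          norm (cnj \<zeta> * boundary_value \<theta> \<zeta> * cnj (boundary_value m \<zeta>))"
        using elim by simp
      then show ?case using elim \<alpha> by (simp add: norm_mult)
    qed
    then have m0: "AE \<zeta> in \<mu>. boundary_value m \<zeta> \<noteq> 0"
      by eventually_elim auto
    obtain z1 where z1: "norm z1 < 1" "m z1 \<noteq> 0"
      by (rule Hardy_nonzero[OF m'(2) m0])
    define l where "l = (\<lambda>\<zeta>. ln (norm (boundary_value m \<zeta>)))"
    have two: "(0::real) < 2" by simp
    note l = Hardy_log_integrable(2)[OF mH two m' z1, folded l_def]
    obtain B where B: "inner_function B"
      and mB: "\<And>z. norm z < 1 \<Longrightarrow> m z = B z * outer_exp l z"
      using Hardy_inner_outer[OF mH two m' z1, folded l_def] by metis
    have lk: "AE \<zeta> in \<mu>. l \<zeta> = k \<zeta>"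
      using mnorm by eventually_elim (simp add: l_def)
    have mB': "m z = B z * outer_exp k z" if "norm z < 1" for z
      using mB[OF that] outer_exp_cong_AE[OF l k lk that] by simp
    note Bb = inner_function_boundary_value[OF B]
    have split: "outer_exp (\<lambda>\<zeta>. (2 - 2 / p) * k \<zeta>) z * outer_exp (\<lambda>\<zeta>. 2 / p * k \<zeta>) z = outer_exp k z * outer_exp k z"
      if z: "norm z < 1" for z
    proof -
      have "(\<lambda>\<zeta>. (2 - 2 / p) * k \<zeta> + 2 / p * k \<zeta>) = (\<lambda>\<zeta>. k \<zeta> + k \<zeta>)"
        by (simp add: fun_eq_iff algebra_simps)
      then show ?thesis
        using outer_exp_add[OF K3 K2 z] outer_exp_add[OF k k z] by simp
    qed
    define \<kappa> where "\<kappa> = of_real (norm c powr (p - 2)) * cnj (c * \<beta>) * \<alpha>"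
    have main: "AE \<zeta> in \<mu>. norm (g \<zeta>) = norm c * exp (2 / p * k \<zeta>) \<and>
        dual_fn p (g \<zeta>) = \<kappa> * (boundary_value B \<zeta> * boundary_value (outer_exp (\<lambda>\<zeta>. (2 - 2 / p) * k \<zeta>)) \<zeta>) * \<zeta>"
      using AE_circle_norm \<theta>b(3) ub m'(2) mb IFb Ib(2,3) Bb(2,3) kb(2,3) k2b(2,3) k3b(2,3)
    proof eventually_elim
      case (elim \<zeta>)
      \<comment> \<open>Boundary values of \<open>\<theta>\<close>, \<open>I\<close>, \<open>B\<close> and of the outer functions belonging to \<open>k\<close>, \<open>(2 / p) k\<close> and \<open>(2 - 2 / p) k\<close>.\<close>
      define t i b w v x where "t = boundary_value \<theta> \<zeta>" and "i = boundary_value I \<zeta>"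
        and "b = boundary_value B \<zeta>" and "w = boundary_value (outer_exp k) \<zeta>"
        and "v = boundary_value (outer_exp (\<lambda>\<zeta>. 2 / p * k \<zeta>)) \<zeta>"
        and "x = boundary_value (outer_exp (\<lambda>\<zeta>. (2 - 2 / p) * k \<zeta>)) \<zeta>"
      note lims = elim[folded t_def i_def b_def w_def v_def x_def]
      define E where "E = exp (k \<zeta>)"
      have E: "E > 0" by (simp add: E_def)
      have nv: "norm v = E powr (2 / p)"
        using lims by (simp add: E_def exp_powr_real mult.commute)
      have tg: "t * g \<zeta> = c * i * (\<beta> * v)"
      proof -
        have "has_angular_limit u \<zeta> (c * i * (\<beta> * v))"
        proof (rule has_angular_limit_cong)
          show "has_angular_limit (\<lambda>z. c * I z * (\<beta> * outer_exp (\<lambda>\<zeta>. 2 / p * k \<zeta>) z)) \<zeta> (c * i * (\<beta> * v))"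
            using lims by (intro has_angular_limit_mult has_angular_limit_const) auto
        qed (simp add: u Gk)
        then show ?thesis using has_angular_limit_unique lims by blast
      qed
      have mbw: "boundary_value m \<zeta> = b * w"
      proof -
        have "has_angular_limit m \<zeta> (b * w)"
          by (rule has_angular_limit_cong[OF _ has_angular_limit_mult]) (use lims mB' in auto)
        then show ?thesis using has_angular_limit_unique lims by blast
      qed
      have xv: "x * v = w * w"
      proof -
        have "has_angular_limit (\<lambda>z. outer_exp (\<lambda>\<zeta>. (2 - 2 / p) * k \<zeta>) z * outer_exp (\<lambda>\<zeta>. 2 / p * k \<zeta>) z) \<zeta> (w * w)"
          by (rule has_angular_limit_cong[OF _ has_angular_limit_mult]) (use lims split in auto)
        moreover have "has_angular_limit (\<lambda>z. outer_exp (\<lambda>\<zeta>. (2 - 2 / p) * k \<zeta>) z * outer_exp (\<lambda>\<zeta>. 2 / p * k \<zeta>) z) \<zeta> (x * v)"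
          using lims by (intro has_angular_limit_mult) auto
        ultimately show ?thesis using has_angular_limit_unique lims by blast
      qed
      have tt: "cnj t * t = 1" and zz: "\<zeta> * cnj \<zeta> = 1" and aa: "\<alpha> * cnj \<alpha> = 1"
        using lims circle_cnj \<alpha> by (auto simp: mult.commute)
      have ng: "norm (g \<zeta>) = norm c * E powr (2 / p)"
        using arg_cong[OF tg, of norm] lims \<beta> nv by (simp add: norm_mult)
      have cg: "cnj (g \<zeta>) = t * cnj (c * i * (\<beta> * v))"
      proof -
        have "t * cnj (c * i * (\<beta> * v)) = (cnj t * t) * cnj (g \<zeta>)"
          unfolding tg[symmetric] by (simp add: mult_ac)
        then show ?thesis using tt by simp
      qed
      have iw: "i * (\<alpha> * w) = cnj \<zeta> * t * cnj (b * w)" using lims mbw by simp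
      have tiw: "t * cnj i * cnj w = \<alpha> * \<zeta> * (b * w)"
      proof -
        have "t * cnj i * cnj w = (\<alpha> * cnj \<alpha>) * (t * cnj i * cnj w)" using aa by simp
        also have "\<dots> = \<alpha> * t * cnj (i * (\<alpha> * w))" by (simp add: mult_ac)
        also have "\<dots> = (cnj t * t) * \<alpha> * \<zeta> * (b * w)" unfolding iw by (simp add: mult_ac)
        finally show ?thesis using tt by simp
      qed
      have ww: "w * cnj w = of_real (E powr 2)"
        using lims E by (simp add: complex_norm_square[symmetric] E_def)
      have vv: "v * cnj v = of_real (E powr (4 / p))"
        using nv E by (simp add: complex_norm_square[symmetric] power2_eq_square flip: powr_add of_real_mult)
      \<comment> \<open>The part of \<open>\<bar>g\<bar>\<^bsup>p-2\<^esup>\<close> that depends on \<open>k\<close>; it turns \<open>\<bar>v\<bar>\<^sup>2\<close> into \<open>\<bar>w\<bar>\<^sup>2\<close>, which is cancelled at the end.\<close>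
      define R where "R = E powr (2 / p * (p - 2))"
      have R: "R * E powr (4 / p) = E powr 2"
      proof -
        have "2 / p * (p - 2) + 4 / p = 2" using p0 by (simp add: field_simps)
        then show ?thesis unfolding R_def by (simp flip: powr_add)
      qed
      have gR: "norm (g \<zeta>) powr (p - 2) = norm c powr (p - 2) * R"
        unfolding ng R_def using E by (simp add: powr_mult powr_powr)
      have "t * cnj i * cnj v * (w * cnj w) = (t * cnj i * cnj w) * (w * cnj v)"
        by (simp add: mult_ac)
      also have "\<dots> = \<alpha> * \<zeta> * b * (w * w) * cnj v" unfolding tiw by (simp add: mult_ac)
      also have "\<dots> = \<alpha> * \<zeta> * b * x * (v * cnj v)" unfolding xv[symmetric] by (simp add: mult_ac)
      finally have key: "t * cnj i * cnj v * (w * cnj w) = \<alpha> * \<zeta> * b * x * (v * cnj v)" .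
      have "dual_fn p (g \<zeta>) * (w * cnj w) =
          of_real (norm c powr (p - 2)) * cnj (c * \<beta>) * of_real R * (t * cnj i * cnj v * (w * cnj w))"
        unfolding dual_fn_def gR cg by (simp add: mult_ac)
      also have "\<dots> = \<kappa> * (b * x) * \<zeta> * (of_real R * (v * cnj v))"
        unfolding key \<kappa>_def by (simp add: mult_ac)
      also have "of_real R * (v * cnj v) = w * cnj w"
        unfolding vv ww using R by (simp flip: of_real_mult)
      finally have "dual_fn p (g \<zeta>) * (w * cnj w) = \<kappa> * (b * x) * \<zeta> * (w * cnj w)" .
      moreover have "w * cnj w \<noteq> 0" using lims by auto
      ultimately have "dual_fn p (g \<zeta>) = \<kappa> * (b * x) * \<zeta>" by simp
      moreover have "norm (g \<zeta>) = norm c * exp (2 / p * k \<zeta>)"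
        using ng by (simp add: E_def exp_powr_real mult.commute)
      ultimately show ?case by (simp add: b_def x_def)
    qed
    show ?thesis
    proof (rule orthogonal_badly_approximable[OF gL p])
      fix h assume hB: "h \<in> boundary_functions (Hardy p)"
      then obtain f where fH: "f \<in> Hardy p" and fh: "AE \<zeta> in \<mu>. has_angular_limit f \<zeta> (h \<zeta>)"
        and hm: "h \<in> borel_measurable \<mu>"
        by (auto simp: boundary_functions_def)
      note dh = integrable_dual_fn_mult[OF gL Hardy_boundary_Lp[OF hB p0] p]
      show "(\<integral>\<zeta>. dual_fn p (g \<zeta>) * h \<zeta> \<partial>\<mu>) = 0"
      proof (cases "\<forall>z\<in>ball 0 1. f z = 0")
        case True
        have "AE \<zeta> in \<mu>. dual_fn p (g \<zeta>) * h \<zeta> = 0"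
          using fh AE_circle_norm
        proof eventually_elim
          case (elim \<zeta>)
          have "has_angular_limit f \<zeta> 0"
            by (rule has_angular_limit_cong[OF _ has_angular_limit_const]) (use True in simp)
          then have "h \<zeta> = 0" using has_angular_limit_unique elim by blast
          then show ?case by simp
        qed
        then show ?thesis by (rule integral_eq_zero_AE)
      next
        case False
        then obtain z0 where z0: "norm z0 < 1" "f z0 \<noteq> 0" by auto
        define q where "q = (\<lambda>\<zeta>. ln (norm (h \<zeta>)))"
        note h0 = Hardy_log_integrable(1)[OF fH p0 hm fh z0]
        note q = Hardy_log_integrable(2)[OF fH p0 hm fh z0, folded q_def]
        obtain J where J: "inner_function J"
          and fJ: "\<And>z. norm z < 1 \<Longrightarrow> f z = J z * outer_exp q z"
          using Hardy_inner_outer[OF fH p0 hm fh z0, folded q_def] by metis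
        define r where "r = (\<lambda>\<zeta>. (2 - 2 / p) * k \<zeta> + q \<zeta>)"
        have r: "integrable \<mu> r" unfolding r_def using K3 q by simp
        have er: "integrable \<mu> (\<lambda>\<zeta>. exp (r \<zeta>))"
        proof (rule integrable_cong_AE_imp)
          show "integrable \<mu> (\<lambda>\<zeta>. norm (dual_fn p (g \<zeta>) * h \<zeta>) / norm c powr (p - 1))"
            using dh by simp
          show "(\<lambda>\<zeta>. exp (r \<zeta>)) \<in> borel_measurable \<mu>" using r by measurable
          show "AE \<zeta> in \<mu>. norm (dual_fn p (g \<zeta>) * h \<zeta>) / norm c powr (p - 1) = exp (r \<zeta>)"
            using main h0
          proof eventually_elim
            case (elim \<zeta>)
            have "2 / p * k \<zeta> * (p - 1) = (2 - 2 / p) * k \<zeta>" using p0 by (simp add: field_simps)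
            then have "norm (g \<zeta>) powr (p - 1) = norm c powr (p - 1) * exp ((2 - 2 / p) * k \<zeta>)"
              using elim by (simp add: powr_mult exp_powr_real)
            then have "norm (dual_fn p (g \<zeta>) * h \<zeta>) = norm c powr (p - 1) * exp (r \<zeta>)"
              unfolding norm_mult norm_dual_fn using elim(2) by (simp add: r_def q_def exp_add)
            then show ?case using c by simp
          qed
        qed
        note Jb = inner_function_boundary_value[OF J] and qb = outer_exp_boundary_value[OF q]
          and rb = outer_exp_boundary_value[OF r]
        define \<gamma> where "\<gamma> = (\<lambda>\<zeta>. boundary_value B \<zeta> * boundary_value J \<zeta> * boundary_value (outer_exp r) \<zeta>)"
        have \<gamma>m: "\<gamma> \<in> borel_measurable \<mu>"
          unfolding \<gamma>_def using Bb(1) Jb(1) rb(1) by measurable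
        obtain C1 where C1: "B holomorphic_on ball 0 1" "\<And>z. norm z < 1 \<Longrightarrow> norm (B z) \<le> C1"
          using inner_function_bounded[OF B] by blast
        obtain C2 where C2: "J holomorphic_on ball 0 1" "\<And>z. norm z < 1 \<Longrightarrow> norm (J z) \<le> C2"
          using inner_function_bounded[OF J] by blast
        have "(\<integral>\<zeta>. \<gamma> \<zeta> * \<zeta> \<partial>\<mu>) = 0"
        proof (rule integral_bounded_times_outer[OF _ _ r er \<gamma>m])
          show "(\<lambda>z. B z * J z) holomorphic_on ball 0 1" by (intro holomorphic_intros C1 C2)
          show "norm (B z * J z) \<le> C1 * C2" if "norm z < 1" for z
            unfolding norm_mult using C1(2)[OF that] C2(2)[OF that]
            by (intro mult_mono) (auto intro: order_trans[OF norm_ge_zero])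
          show "AE \<zeta> in \<mu>. has_angular_limit (\<lambda>z. B z * J z * outer_exp r z) \<zeta> (\<gamma> \<zeta>)"
            using Bb(2) Jb(2) rb(2) by eventually_elim (simp add: \<gamma>_def has_angular_limit_mult)
        qed
        moreover have "(\<integral>\<zeta>. dual_fn p (g \<zeta>) * h \<zeta> \<partial>\<mu>) = (\<integral>\<zeta>. \<kappa> * (\<gamma> \<zeta> * \<zeta>) \<partial>\<mu>)"
        proof (rule integral_cong_AE)
          show "AE \<zeta> in \<mu>. dual_fn p (g \<zeta>) * h \<zeta> = \<kappa> * (\<gamma> \<zeta> * \<zeta>)"
            using main fh Jb(2) qb(2) rb(2) k3b(2) AE_circle_norm
          proof eventually_elim
            case (elim \<zeta>)
            have "has_angular_limit f \<zeta> (boundary_value J \<zeta> * boundary_value (outer_exp q) \<zeta>)"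
              by (rule has_angular_limit_cong[OF _ has_angular_limit_mult]) (use elim fJ in auto)
            then have hj: "h \<zeta> = boundary_value J \<zeta> * boundary_value (outer_exp q) \<zeta>"
              using has_angular_limit_unique elim by blast
            have "has_angular_limit (outer_exp r) \<zeta> (boundary_value (outer_exp (\<lambda>\<zeta>. (2 - 2 / p) * k \<zeta>)) \<zeta> * boundary_value (outer_exp q) \<zeta>)"
              by (rule has_angular_limit_cong[OF _ has_angular_limit_mult])
                 (use elim outer_exp_add[OF K3 q] in \<open>auto simp: r_def\<close>)
            then have "boundary_value (outer_exp r) \<zeta> = boundary_value (outer_exp (\<lambda>\<zeta>. (2 - 2 / p) * k \<zeta>)) \<zeta> * boundary_value (outer_exp q) \<zeta>"
              by (rule boundary_value_eq) (use elim in simp)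
            then show ?case using elim hj by (simp add: \<gamma>_def mult_ac)
          qed
        qed (use dh \<gamma>m in measurable)
        ultimately show ?thesis by simp
      qed
    qed
  qed
qed

theorem proposition5p2:
  fixes \<theta> g :: "complex \<Rightarrow> complex" and p :: real
  assumes "inner_function \<theta>"
    and "1 \<le> p"
    and "g \<in> conj_inner_Hardy \<theta> p"
  shows "badly_approximable p g \<longleftrightarrow>
    (\<lambda>\<zeta>. boundary_value \<theta> \<zeta> * g \<zeta>) \<in> boundary_functions (E_class \<theta> p)"
proof
  assume "badly_approximable p g"
  then show "(\<lambda>\<zeta>. boundary_value \<theta> \<zeta> * g \<zeta>) \<in> boundary_functions (E_class \<theta> p)"
    by (rule badly_approximable_imp_E_class[OF assms])
next
  assume "(\<lambda>\<zeta>. boundary_value \<theta> \<zeta> * g \<zeta>) \<in> boundary_functions (E_class \<theta> p)"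
  moreover have "g \<in> Lp_circle p" using assms(3) by (simp add: conj_inner_Hardy_def)
  ultimately show "badly_approximable p g"
    by (intro E_class_imp_badly_approximable[OF assms(1,2)])
qed

end
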